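(* Let $n,k,\ell$ be positive integers such that either $n\ge 2\ell>2k$ or $n>2\ell=2k$. Let $\mathcal{A}\subseteq\binom{[n]}{k}$ and $\mathcal{B}\subseteq\binom{[n]}{\ell}$ be cross-intersecting families with $\bigcap_{F\in\mathcal{A}\cup\mathcal{B}}F=\emptyset$. Then \[ |\mathcal{A}||\mathcal{B}|\le \max\left\{\left(\binom{n-1}{k-1}+\binom{n-2}{k-1}\right)\binom{n-2}{\ell-2},\ \left(\binom{n-1}{k-1}+1\right)\left(\binom{n-1}{\ell-1}-\binom{n-k-1}{\ell-1}\right)\right\}. \] More precisely, either $|\mathcal{A}||\mathcal{B}|\le \left(\binom{n-1}{k-1}+\binom{n-2}{k-1}\right)\binom{n-2}{\ell-2}$, where the unique extremal pair up to a permutation of $[n]$ is $\mathcal{A}=\{A\in\binom{[n]}{k}: 1\in A \text{ or } 2\in A\}$, $\mathcal{B}=\{B\in\binom{[n]}{\ell}: \{1,2\}\subseteq B\}$; or $|\mathcal{A}||\mathcal{B}|\le \left(\binom{n-1}{k-1}+1\right)\left(\binom{n-1}{\ell-1}-\binom{n-k-1}{\ell-1}\right)$, where the unique extremal pair up to a permutation of $[n]$ is $\mathcal{A}=\{A\in\binom{[n]}{k}: 1\in A\}\cup\{\{2,3,\dots,k+1\}\}$, $\mathcal{B}=\{B\in\binom{[n]}{\ell}: 1\in B,\ B\cap\{2,\dots,k+1\}\neq\emptyset\}$.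
   Context: $[n]=\{1,\dots,n\}$ and $\binom{[n]}{k}$ denotes the family of all $k$-element subsets of $[n]$. Two families $\mathcal{A},\mathcal{B}$ of sets are cross-intersecting if $A\cap B\neq\emptyset$ for all $A\in\mathcal{A}$, $B\in\mathcal{B}$.
   Formalization: Uniqueness of the extremal pair is stated up to a permutation of [n] and, when k=ℓ, also up to exchanging 𝒜 and ℬ (else false by symmetry); it is claimed only for ℓ≥2, since for ℓ=1 both bounds are 0 and every admissible pair attains them. *)

theory Defs
  imports "HOL-Library.Ramsey" "HOL-Combinatorics.Permutations"
begin

definition cross_intersecting :: "nat set set \<Rightarrow> nat set set \<Rightarrow> bool" where
  "cross_intersecting \<A> \<B> \<longleftrightarrow> (\<forall>A\<in>\<A>. \<forall>B\<in>\<B>. A \<inter> B \<noteq> {})"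

text \<open>Admissible pairs; \<^term>\<open>[{1..n}]\<^bsup>k\<^esup>\<close> is the family of \<open>k\<close>-element subsets of \<open>{1..n}\<close>.
  The pair with both families empty is excluded here (\<^prop>\<open>\<Inter> {} = UNIV\<close>), as it is when the
  empty intersection is read as the ground set.\<close>

definition nontrivial_cross_pair ::
    "nat \<Rightarrow> nat \<Rightarrow> nat \<Rightarrow> nat set set \<Rightarrow> nat set set \<Rightarrow> bool" where
  "nontrivial_cross_pair n k l \<A> \<B> \<longleftrightarrow>
     \<A> \<subseteq> [{1..n}]\<^bsup>k\<^esup> \<and> \<B> \<subseteq> [{1..n}]\<^bsup>l\<^esup> \<and>
     cross_intersecting \<A> \<B> \<and> \<Inter> (\<A> \<union> \<B>) = {}"

text \<open>For \<open>l = 1\<close> the factor \<open>binomial (n - 2) (l - 2)\<close> has lower index \<open>-1\<close> and means \<open>0\<close>,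
  whereas truncated subtraction on \<^typ>\<open>nat\<close> would give \<open>1\<close>.\<close>

definition star_bound :: "nat \<Rightarrow> nat \<Rightarrow> nat \<Rightarrow> nat" where
  "star_bound n k l =
     (((n - 1) choose (k - 1)) + ((n - 2) choose (k - 1))) *
     (if l < 2 then 0 else (n - 2) choose (l - 2))"

definition hm_bound :: "nat \<Rightarrow> nat \<Rightarrow> nat \<Rightarrow> nat" where
  "hm_bound n k l =
     (((n - 1) choose (k - 1)) + 1) *
     (((n - 1) choose (l - 1)) - ((n - k - 1) choose (l - 1)))"

definition star_A :: "nat \<Rightarrow> nat \<Rightarrow> nat set set" where
  "star_A n k = {A \<in> [{1..n}]\<^bsup>k\<^esup>. 1 \<in> A \<or> 2 \<in> A}"

definition star_B :: "nat \<Rightarrow> nat \<Rightarrow> nat set set" where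
  "star_B n l = {B \<in> [{1..n}]\<^bsup>l\<^esup>. {1, 2} \<subseteq> B}"

definition hm_A :: "nat \<Rightarrow> nat \<Rightarrow> nat set set" where
  "hm_A n k = {A \<in> [{1..n}]\<^bsup>k\<^esup>. 1 \<in> A} \<union> {{2..k+1}}"

definition hm_B :: "nat \<Rightarrow> nat \<Rightarrow> nat \<Rightarrow> nat set set" where
  "hm_B n k l = {B \<in> [{1..n}]\<^bsup>l\<^esup>. 1 \<in> B \<and> B \<inter> {2..k+1} \<noteq> {}}"

definition equal_up_to_perm ::
    "nat \<Rightarrow> nat set set \<times> nat set set \<Rightarrow> nat set set \<times> nat set set \<Rightarrow> bool" where
  "equal_up_to_perm n P Q \<longleftrightarrow>
     (\<exists>\<sigma>. \<sigma> permutes {1..n} \<and>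
        fst P = (\<lambda>S. \<sigma> ` S) ` fst Q \<and> snd P = (\<lambda>S. \<sigma> ` S) ` snd Q)"

text \<open>For \<open>k = l\<close> the two families play symmetric roles, so interchanging the two members of an
  extremal pair gives another extremal pair, in general not equal to it up to a permutation of
  the ground set; uniqueness must be read modulo this interchange.\<close>

definition unique_pair_form ::
    "nat \<Rightarrow> nat \<Rightarrow> nat \<Rightarrow> nat set set \<times> nat set set \<Rightarrow> nat set set \<times> nat set set \<Rightarrow> bool" where
  "unique_pair_form n k l P Q \<longleftrightarrow>
     equal_up_to_perm n P Q \<or> (k = l \<and> equal_up_to_perm n (prod.swap P) Q)"

end

theory Submission
  imports Defs Complex_Main
begin

text \<open>The Kruskal--Katona theorem is used along chords: if the size of a family is at least a convex
  combination of cascade numbers with two leading terms, its shadow is at least the same convex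
  combination of the numbers one level down. For a cross-intersecting pair, with one family replaced
  by the complements of its members, this confines \<open>(|\<A>|, |\<B>|)\<close> to a region below piecewise
  linear curves. If \<open>|\<A>|\<close> exceeds the size of a full star, the product is a quadratic function on
  each chord, and it is largest at one of the two corners given by the extremal pairs.
  If \<open>|\<A>|\<close> is at most the size of a full star plus one, \<open>|\<B>|\<close> is at most that of a full star and the
  product is large, then an induction on \<open>n\<close>, applied to the members of \<open>\<A>\<close> avoiding an element \<open>i\<close>
  of largest degree in \<open>\<B>\<close> and to the link of \<open>i\<close> in \<open>\<B>\<close>, shows that one of the families is a star; the
  absence of a common element then gives the bound. Equality in the first bound is the uniqueness of
  cliques in the Kruskal--Katona theorem.\<close>

section \<open>Shadows along chords of cascade numbers\<close>

text \<open>Sizes alone cannot give the theorem: two full stars with the same centre are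
  cross-intersecting, satisfy every shadow inequality, and for \<open>2 \<le> k\<close> the product
  of their sizes exceeds both bounds. So the region of possible sizes is decisive only when a family
  is larger than a full star; below that the empty intersection must enter through structure, which
  is what the induction is for. Chords replace exact Kruskal-Katona sizes because along a chord both
  bounds are linear in one parameter: the product is then a quadratic that is controlled by its
  slope at one end or by its values at both ends. Only a few vertices of the boundary matter, and
  the estimates there become polynomial inequalities in \<open>k - 1\<close>, \<open>l - 1\<close>,
  \<open>n - 1\<close>. The induction survives the passage to smaller parameters because an element
  of largest degree lies in a share of at least \<open>l / n\<close> of the second family, while a
  second element lies only in a share \<open>(l - 1) / (n - 1)\<close> of a full star.\<close>

definition level :: "nat set set \<Rightarrow> nat \<Rightarrow> nat set set" where
  "level F r = {T. card T = r \<and> finite T \<and> (\<exists>X\<in>F. T \<subseteq> X)}"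

section \<open>Shifting a family towards a fixed element\<close>

definition shift :: "nat \<Rightarrow> nat \<Rightarrow> nat set set \<Rightarrow> nat set \<Rightarrow> nat set" where
  "shift x j F A = (if j \<in> A \<and> x \<notin> A \<and> insert x (A - {j}) \<notin> F then insert x (A - {j}) else A)"

lemma shift_inj: "inj_on (shift x j F) F"
proof (rule inj_onI)
  fix A B assume A: "A \<in> F" and B: "B \<in> F" and eq: "shift x j F A = shift x j F B"
  have rec: "C = insert j (insert x (C - {j}) - {x})" if "j \<in> C" "x \<notin> C" for C
    using that by auto
  show "A = B"
  proof (cases "j \<in> A \<and> x \<notin> A \<and> insert x (A - {j}) \<notin> F")
    case True
    then have sA: "shift x j F A = insert x (A - {j})" by (simp add: shift_def)
    show ?thesis
    proof (cases "j \<in> B \<and> x \<notin> B \<and> insert x (B - {j}) \<notin> F")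
      case True2: True
      then have "insert x (A - {j}) = insert x (B - {j})" using sA eq by (simp add: shift_def)
      then show ?thesis using rec[of A] rec[of B] True True2 by metis
    next
      case False
      then have "shift x j F B = B" by (auto simp: shift_def)
      then show ?thesis using sA eq B True by simp
    qed
  next
    case False
    then have sA: "shift x j F A = A" by (auto simp: shift_def)
    show ?thesis
    proof (cases "j \<in> B \<and> x \<notin> B \<and> insert x (B - {j}) \<notin> F")
      case True
      then have "shift x j F B = insert x (B - {j})" by (simp add: shift_def)
      then show ?thesis using sA eq A True by simp
    next
      case False
      then have "shift x j F B = B" by (auto simp: shift_def)
      then show ?thesis using sA eq by simp
    qed
  qed
qed

lemma card_swap_elem:
  assumes "finite A" "j \<in> A" "x \<notin> A"
  shows "card (insert x (A - {j})) = card A"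
proof -
  have "card (insert x (A - {j})) = Suc (card (A - {j}))" using assms by simp
  then show ?thesis using assms by (metis card_Suc_Diff1)
qed

text \<open>A shift acts separately on each pair formed by a set and the set with \<open>j\<close>
  and \<open>x\<close> exchanged. Describing the image pair by pair removes the preimage from the
  case analysis of \<open>level_shift\<close>.\<close>

lemma mem_shift_image:
  "T \<in> shift x j G ` G \<longleftrightarrow>
     (T \<in> G \<and> (j \<in> T \<and> x \<notin> T \<longrightarrow> insert x (T - {j}) \<in> G)) \<or>
     (T \<notin> G \<and> x \<in> T \<and> j \<notin> T \<and> insert j (T - {x}) \<in> G)" if "j \<noteq> x"
proof
  assume "T \<in> shift x j G ` G"
  then obtain A where A: "A \<in> G" "T = shift x j G A" by blast
  show "(T \<in> G \<and> (j \<in> T \<and> x \<notin> T \<longrightarrow> insert x (T - {j}) \<in> G)) \<or>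
     (T \<notin> G \<and> x \<in> T \<and> j \<notin> T \<and> insert j (T - {x}) \<in> G)"
  proof (cases "j \<in> A \<and> x \<notin> A \<and> insert x (A - {j}) \<notin> G")
    case True
    then have T: "T = insert x (A - {j})" using A by (simp add: shift_def)
    then have "insert j (T - {x}) = A" using True by auto
    then show ?thesis using T True A that by auto
  next
    case False
    then have "T = A" using A by (auto simp: shift_def)
    then show ?thesis using False A by auto
  qed
next
  assume R: "(T \<in> G \<and> (j \<in> T \<and> x \<notin> T \<longrightarrow> insert x (T - {j}) \<in> G)) \<or>
     (T \<notin> G \<and> x \<in> T \<and> j \<notin> T \<and> insert j (T - {x}) \<in> G)"
  then show "T \<in> shift x j G ` G"
  proof
    assume "T \<in> G \<and> (j \<in> T \<and> x \<notin> T \<longrightarrow> insert x (T - {j}) \<in> G)"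
    then have "shift x j G T = T" "T \<in> G" by (auto simp: shift_def)
    then show ?thesis by (metis image_eqI)
  next
    assume *: "T \<notin> G \<and> x \<in> T \<and> j \<notin> T \<and> insert j (T - {x}) \<in> G"
    have "insert x (insert j (T - {x}) - {j}) = T" using * that by auto
    then have "shift x j G (insert j (T - {x})) = T" using * that by (auto simp: shift_def)
    then show ?thesis using * by (metis image_eqI)
  qed
qed

text \<open>The right-hand side has at most as many members as the old shadow, so shifting never
  enlarges a shadow.\<close>

lemma level_shift:
  assumes F: "\<And>A. A \<in> F \<Longrightarrow> finite A \<and> card A = Suc r" and jx: "j \<noteq> x"
  shows "level (shift x j F ` F) r \<subseteq> shift x j (level F r) ` level F r"
proof
  fix T assume "T \<in> level (shift x j F ` F) r"
  then obtain Y where T: "card T = r" "finite T" "T \<subseteq> Y" and Y: "Y \<in> shift x j F ` F"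
    by (auto simp: level_def)
  have sw: "card (insert x (T - {j})) = r" if "j \<in> T" "x \<notin> T"
    using card_swap_elem[of T j x] that T by simp
  have sw2: "card (insert j (T - {x})) = r" if "x \<in> T" "j \<notin> T"
    using card_swap_elem[of T x j] that T by simp
  have lev: "Z \<in> level F r" if "card Z = r" "finite Z" "Z \<subseteq> W" "W \<in> F" for Z W
    using that by (auto simp: level_def)
  show "T \<in> shift x j (level F r) ` level F r"
    unfolding mem_shift_image[OF jx]
  proof (cases "T \<in> level F r")
    case True
    have "insert x (T - {j}) \<in> level F r" if h: "j \<in> T" "x \<notin> T"
    proof -
      from Y show ?thesis unfolding mem_shift_image[OF jx]
      proof
        assume *: "Y \<in> F \<and> (j \<in> Y \<and> x \<notin> Y \<longrightarrow> insert x (Y - {j}) \<in> F)"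
        show ?thesis
        proof (cases "x \<in> Y")
          case True
          then have "insert x (T - {j}) \<subseteq> Y" using T by auto
          then show ?thesis using lev sw[OF h] T * by auto
        next
          case False
          then have "insert x (Y - {j}) \<in> F" using * h T by auto
          moreover have "insert x (T - {j}) \<subseteq> insert x (Y - {j})" using T by auto
          ultimately show ?thesis using lev[OF sw[OF h]] T by blast
        qed
      next
        assume "Y \<notin> F \<and> x \<in> Y \<and> j \<notin> Y \<and> insert j (Y - {x}) \<in> F"
        then show ?thesis using h T by auto
      qed
    qed
    then show "(T \<in> level F r \<and> (j \<in> T \<and> x \<notin> T \<longrightarrow> insert x (T - {j}) \<in> level F r)) \<or>
      (T \<notin> level F r \<and> x \<in> T \<and> j \<notin> T \<and> insert j (T - {x}) \<in> level F r)"
      using True by blast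
  next
    case False
    have "Y \<notin> F" using lev[OF T(1-3)] False by blast
    then have Y2: "x \<in> Y" "j \<notin> Y" "insert j (Y - {x}) \<in> F"
      using Y unfolding mem_shift_image[OF jx] by auto
    have "x \<in> T"
    proof (rule ccontr)
      assume "x \<notin> T"
      then have "T \<subseteq> insert j (Y - {x})" using T by auto
      then show False using lev T(1,2) Y2 False by blast
    qed
    moreover have "j \<notin> T" using T Y2 by auto
    moreover have "insert j (T - {x}) \<subseteq> insert j (Y - {x})" using T by auto
    then have "insert j (T - {x}) \<in> level F r"
      using lev[of "insert j (T - {x})" "insert j (Y - {x})"] Y2(3) sw2 calculation T(2) by blast
    ultimately show "(T \<in> level F r \<and> (j \<in> T \<and> x \<notin> T \<longrightarrow> insert x (T - {j}) \<in> level F r)) \<or>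
      (T \<notin> level F r \<and> x \<in> T \<and> j \<notin> T \<and> insert j (T - {x}) \<in> level F r)"
      using False by blast
  qed
qed

lemma finite_level: "finite S \<Longrightarrow> (\<And>A. A \<in> F \<Longrightarrow> A \<subseteq> S) \<Longrightarrow> finite (level F r)"
  by (rule finite_subset[of _ "Pow S"]) (auto simp: level_def)

text \<open>An extremal choice replaces iterated shifting: among the families of the same size with
  no larger shadow, one with the most members containing \<open>x\<close> cannot be changed by any
  shift from some \<open>j\<close> to \<open>x\<close>, since such a change would add another member
  containing \<open>x\<close>.\<close>

lemma compress:
  assumes S: "finite S" "x \<in> S" and F: "F \<subseteq> [S]\<^bsup>Suc r\<^esup>"
  obtains F' where "F' \<subseteq> [S]\<^bsup>Suc r\<^esup>" "card F' = card F" "card (level F' r) \<le> card (level F r)"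
    "\<And>A j. A \<in> F' \<Longrightarrow> j \<in> A \<Longrightarrow> x \<notin> A \<Longrightarrow> insert x (A - {j}) \<in> F'"
proof -
  define ok where "ok G \<longleftrightarrow> G \<subseteq> [S]\<^bsup>Suc r\<^esup> \<and> card G = card F \<and> card (level G r) \<le> card (level F r)" for G
  define mu where "mu G = card {A\<in>G. x \<in> A}" for G :: "nat set set"
  have fin: "finite ([S]\<^bsup>Suc r\<^esup>)" using S by (simp add: finite_imp_finite_nsets)
  have bound: "mu G \<le> card ([S]\<^bsup>Suc r\<^esup>)" if "ok G" for G
    unfolding mu_def using that fin by (intro card_mono) (auto simp: ok_def)
  have "ok F" using F by (simp add: ok_def)
  then obtain G where G: "ok G" and mx: "\<And>H. ok H \<Longrightarrow> mu H \<le> mu G"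
    using ex_has_greatest_nat[of ok F mu "card ([S]\<^bsup>Suc r\<^esup>) + 1"] bound by (metis less_Suc_eq_le Suc_eq_plus1)
  have GF: "finite A \<and> card A = Suc r" "A \<subseteq> S" if "A \<in> G" for A
    using G that by (auto simp: ok_def nsets_def)
  have finG: "finite G" using G fin by (auto simp: ok_def intro: finite_subset)
  have "insert x (A - {j}) \<in> G" if A: "A \<in> G" "j \<in> A" "x \<notin> A" for A j
  proof (rule ccontr)
    assume nin: "insert x (A - {j}) \<notin> G"
    have jx: "j \<noteq> x" using A by auto
    define H where "H = shift x j G ` G"
    have H1: "H \<subseteq> [S]\<^bsup>Suc r\<^esup>"
    proof
      fix B assume "B \<in> H"
      then obtain C where C: "C \<in> G" "B = shift x j G C" by (auto simp: H_def)
      then show "B \<in> [S]\<^bsup>Suc r\<^esup>"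
        using GF[OF C(1)] card_swap_elem[of C j x] S by (auto simp: shift_def nsets_def)
    qed
    have H2: "card H = card F" using card_image[OF shift_inj[of x j G]] G by (simp add: H_def ok_def)
    have finl: "finite (level G r)" using finite_level[OF S(1)] GF by blast
    have "card (level H r) \<le> card (level G r)"
      using card_mono[OF _ level_shift[OF GF(1) jx]] card_image_le[OF finl] finl
      unfolding H_def by (meson finite_imageI le_trans)
    then have okH: "ok H" using H1 H2 G by (auto simp: ok_def)
    have sub: "insert (insert x (A - {j})) {B\<in>G. x \<in> B} \<subseteq> {B\<in>H. x \<in> B}"
    proof -
      have "shift x j G A = insert x (A - {j})" using A nin by (simp add: shift_def)
      then have "insert x (A - {j}) \<in> H" using A by (metis H_def image_eqI)
      moreover have "B \<in> H" if "B \<in> G" "x \<in> B" for B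
        using that unfolding H_def by (metis (no_types, lifting) image_eqI shift_def)
      ultimately show ?thesis by auto
    qed
    have "finite {B\<in>H. x \<in> B}" using finG by (simp add: H_def)
    then have "mu G + 1 \<le> mu H"
      using card_mono[OF _ sub] nin finG by (simp add: mu_def)
    then show False using mx[OF okH] by simp
  qed
  then show ?thesis using that[of G] G by (auto simp: ok_def)
qed

text \<open>For \<open>t = 0\<close> and \<open>t = 1\<close> this is the size at level \<open>m\<close> of an initial segment of the colexicographic
  order; \<open>e = 0\<close> drops the leading binomial coefficient.\<close>

definition cascade :: "nat \<Rightarrow> nat \<Rightarrow> nat \<Rightarrow> nat \<Rightarrow> real \<Rightarrow> nat \<Rightarrow> real" where
  "cascade e N i j t m =
     real e * real (N choose m) + (1 - t) * real (i choose (m - e)) + t * real (j choose (m - e))"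

lemma cascade_ge_1:
  assumes "m - e \<le> i" "i \<le> j" "0 \<le> t" "t \<le> 1"
  shows "cascade e N i j t m \<ge> real e * real (N choose m) + 1"
proof -
  have a: "real (i choose (m - e)) \<ge> 1" "real (j choose (m - e)) \<ge> 1"
    using assms by (auto simp: Suc_le_eq)
  have "(1 - t) * real (i choose (m - e)) \<ge> (1 - t) * 1" "t * real (j choose (m - e)) \<ge> t * 1"
    using a assms by (intro mult_left_mono; simp)+
  then show ?thesis by (simp add: cascade_def)
qed

text \<open>Pascal's rule in each term. It mirrors the split of a family at one element into the
  sets avoiding it, which stay on level \<open>m\<close>, and its link, which lives on level
  \<open>m - 1\<close>.\<close>

lemma cascade_pascal:
  assumes "e < m" "0 < i" "0 < j" "e = 0 \<or> 0 < N"
  shows "cascade e N i j t m =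
    cascade e (N - 1) (i - 1) (j - 1) t m + cascade e (N - 1) (i - 1) (j - 1) t (m - 1)"
proof -
  obtain m' where m: "m = Suc m'" using assms by (cases m) auto
  then obtain d where d: "Suc m' - e = Suc d" "m' - e = d" using assms by (metis Suc_diff_le less_Suc_eq_le)
  obtain i' j' where ij: "i = Suc i'" "j = Suc j'" using assms gr0_conv_Suc by metis
  have N: "real e * real (N choose Suc m') = real e * real ((N - 1) choose Suc m') + real e * real ((N - 1) choose m')"
    using assms(4) by (cases N) (auto simp: algebra_simps)
  show ?thesis unfolding cascade_def m d(1) diff_Suc_1 d(2) ij
    using N by (simp add: algebra_simps)
qed

text \<open>The base of the induction in \<open>chord_shadow\<close> when a leading term is present:
  on level 1 the two-term part of the cascade equals 1, whatever \<open>i\<close>, \<open>j\<close>,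
  \<open>t\<close> are, so only the number of vertices covered by the edges has to be compared with
  \<open>N\<close>.\<close>

lemma card_level_1_gr:
  assumes S: "finite S" and F: "F \<subseteq> [S]\<^bsup>2\<^esup>" and c: "N choose 2 < card F"
  shows "N < card (level F 1)"
proof -
  have sub: "F \<subseteq> [\<Union>F]\<^bsup>2\<^esup>" using F by (auto simp: nsets_def)
  have finU: "finite (\<Union>F)" by (rule finite_subset[OF _ S]) (use F in \<open>auto simp: nsets_def\<close>)
  have "card F \<le> card (\<Union>F) choose 2"
    using card_mono[OF _ sub] finU by (simp add: finite_imp_finite_nsets)
  then have lt: "N choose 2 < card (\<Union>F) choose 2" using c by simp
  have "N < card (\<Union>F)"
  proof (rule ccontr)
    assume "\<not> N < card (\<Union>F)"
    then have "card (\<Union>F) choose 2 \<le> N choose 2" by (intro binomial_right_mono) auto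
    then show False using lt by simp
  qed
  moreover have "(\<lambda>v. {v}) ` (\<Union>F) \<subseteq> level F 1" by (auto simp: level_def)
  then have "card ((\<lambda>v. {v}) ` (\<Union>F)) \<le> card (level F 1)"
    by (intro card_mono finite_level[OF S]) (use F in \<open>auto simp: nsets_def\<close>)
  then have "card (\<Union>F) \<le> card (level F 1)" by (simp add: card_image)
  ultimately show ?thesis by simp
qed

text \<open>The points \<open>(0, 1)\<close>, \<open>(1, u)\<close>, \<open>(c, c')\<close> are in
  concave position. The chord from the first to the third stays below height \<open>u\<close> up to
  abscissa 1, and beyond that below the chord from the second to the third. In the application the
  first point is fictitious: it is a binomial coefficient that has dropped to 0 while the one below
  it is still 1.\<close>

lemma chord_arith:
  fixes t c c' d u :: real
  assumes t: "0 \<le> t" "t \<le> 1" and u: "u \<ge> 2" and d: "d \<ge> 1" and cc: "c' * d = c * u" and c: "c \<ge> 1"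
    and d1: "d < 2 \<Longrightarrow> c = 1"
    and d2: "d = 1 \<or> d \<ge> 2"
  shows "t * c \<le> 1 \<Longrightarrow> (1 - t) + t * c' \<le> u"
    and "c > 1 \<Longrightarrow> (1 - t) + t * c' \<le> (1 - (t * c - 1) / (c - 1)) * u + (t * c - 1) / (c - 1) * c'"
proof -
  assume tc: "t * c \<le> 1"
  show "(1 - t) + t * c' \<le> u"
  proof (cases "d = 1")
    case True
    then have "c = 1" "c' = u" using d1 cc by auto
    moreover have "t * u + (1 - t) * 1 \<le> t * u + (1 - t) * u"
      using t u by (intro add_left_mono mult_left_mono) auto
    ultimately show ?thesis by (simp add: algebra_simps)
  next
    case False
    then have d: "d \<ge> 2" using d2 by simp
    have "c' = c * u / d" using cc d by (simp add: field_simps)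
    also have "\<dots> \<le> c * u / 2" using d c u by (intro divide_left_mono) auto
    finally have "t * c' \<le> t * (c * u / 2)" using t by (intro mult_left_mono) auto
    also have "\<dots> = (t * c) * (u / 2)" by simp
    also have "\<dots> \<le> 1 * (u / 2)" using tc u by (intro mult_right_mono) auto
    finally show ?thesis using t u by simp
  qed
next
  assume c1: "c > 1"
  then have d: "d \<ge> 2" using d1 by force
  have "c' = c * u / d" using cc d by (simp add: field_simps)
  also have "\<dots> \<le> c * u / 2" using d c u by (intro divide_left_mono) auto
  finally have c': "c' \<le> c * u / 2" .
  have "0 \<le> c * (u / 2 - 1)" using c u by simp
  then have pos: "0 \<le> c * (u - 1) - c' + 1" using c' by (simp add: algebra_simps)
  have "(1 - (t * c - 1) / (c - 1)) * u + (t * c - 1) / (c - 1) * c' - ((1 - t) + t * c')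
     = (1 - t) / (c - 1) * (c * (u - 1) - c' + 1)"
  proof -
    define r where "r = (1 - t) / (c - 1)"
    have r: "r * (c - 1) = 1 - t" using c1 by (simp add: r_def)
    have 1: "1 - (t * c - 1) / (c - 1) = r * c" "(t * c - 1) / (c - 1) = t - r"
      using c1 by (simp_all add: r_def field_simps)
    have "r * c * u + (t - r) * c' - (r * (c - 1) + t * c') = r * (c * (u - 1) - c' + 1)"
      by (simp add: algebra_simps)
    then show ?thesis unfolding r_def[symmetric] by (subst 1(1), subst 1(2)) (simp add: r)
  qed
  also have "\<dots> \<ge> 0" using t c1 pos by simp
  finally show "(1 - t) + t * c' \<le> (1 - (t * c - 1) / (c - 1)) * u + (t * c - 1) / (c - 1) * c'"
    by simp
qed

lemma level_Suc:
  assumes "\<And>A. A \<in> F \<Longrightarrow> finite A \<and> card A = m" "r < m"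
  shows "level F r = level (level F (Suc r)) r"
proof -
  have "\<exists>Y. card Y = Suc r \<and> finite Y \<and> Y \<subseteq> X \<and> T \<subseteq> Y" if "X \<in> F" "T \<subseteq> X" "card T = r" for X T
  proof -
    have "\<not> X \<subseteq> T" using assms that by (metis card_mono finite_subset leD)
    then obtain y where "y \<in> X" "y \<notin> T" by blast
    then show ?thesis using that assms(1)[of X] finite_subset[of T X]
      by (intro exI[of _ "insert y T"]) auto
  qed
  note ex = this
  show ?thesis
  proof (rule set_eqI)
    fix T
    have "(\<exists>X\<in>F. T \<subseteq> X) \<longleftrightarrow> (\<exists>Y. (card Y = Suc r \<and> finite Y \<and> (\<exists>X\<in>F. Y \<subseteq> X)) \<and> T \<subseteq> Y)" if "card T = r"
      using ex[of _ T] that by (meson subset_trans)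
    then show "T \<in> level F r \<longleftrightarrow> T \<in> level (level F (Suc r)) r"
      by (auto simp: level_def)
  qed
qed

text \<open>The shifting proof of the Kruskal-Katona theorem, carried out for chords. After
  compression towards \<open>x\<close>, the shadow of the sets avoiding \<open>x\<close> lies in the
  link of \<open>x\<close>. Hence the link cannot be too small: otherwise the sets avoiding
  \<open>x\<close> would be so numerous that their shadow, by induction, outgrows the link. The link
  and its own shadow raised by \<open>x\<close> are disjoint parts of the whole shadow, and Pascal's
  rule adds up their bounds.\<close>

proposition chord_shadow:
  assumes "finite S" "F \<subseteq> [S]\<^bsup>Suc r\<^esup>" "e \<le> 1" "e \<le> r" "Suc r - e \<le> i" "i \<le> j" "e = 1 \<longrightarrow> j \<le> N"
    "0 \<le> t" "t \<le> 1" "cascade e N i j t (Suc r) \<le> card F"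
  shows "cascade e N i j t r \<le> card (level F r)"
  using assms
proof (induction S arbitrary: F r N i j t rule: finite_induct)
  case empty
  then have "F = {}" by (auto simp: nsets_def)
  moreover have "1 \<le> real (card F)"
  proof -
    have "0 \<le> real e * real (N choose Suc r)" by simp
    then show ?thesis using cascade_ge_1[OF empty(4,5,7,8), of N] empty(9) by linarith
  qed
  ultimately show ?case by simp
next
  case (insert x S)
  note prems = insert.prems and IH = insert.IH
  have finS: "finite (insert x S)" using insert by simp
  show ?case
  proof (cases "r = e")
    case True
    show ?thesis
    proof (cases "e = 0")
      case e0: True
      have "1 \<le> real (card F)" using cascade_ge_1[OF prems(4,5,7,8), of N] prems(9) e0 by simp
      then have "F \<noteq> {}" by auto
      then have "level F 0 = {{}}" by (auto simp: level_def)
      then show ?thesis using True e0 by (simp add: cascade_def)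
    next
      case False
      then have e: "e = 1" "r = 1" using prems True by auto
      then have F2: "F \<subseteq> [insert x S]\<^bsup>2\<^esup>" using prems by (simp add: numeral_2_eq_2)
      have "real (N choose 2) + 1 \<le> real (card F)"
        using cascade_ge_1[OF prems(4,5,7,8), of N] prems(9) e by (simp add: numeral_2_eq_2)
      then have "N choose 2 < card F" by linarith
      then have "N < card (level F 1)" using card_level_1_gr[OF finS F2] by simp
      then show ?thesis using e by (simp add: cascade_def)
    qed
  next
    case False
    then have re: "e < r" using prems by simp
    obtain F' where F': "F' \<subseteq> [insert x S]\<^bsup>Suc r\<^esup>" "card F' = card F" "card (level F' r) \<le> card (level F r)"
      and st: "\<And>A j. A \<in> F' \<Longrightarrow> j \<in> A \<Longrightarrow> x \<notin> A \<Longrightarrow> insert x (A - {j}) \<in> F'"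
      using compress[OF finS insertI1 prems(1)] by metis
    have finF': "finite F'" using F'(1) finS by (meson finite_imp_finite_nsets finite_subset)
    have F'D: "finite A" "card A = Suc r" "A \<subseteq> insert x S" if "A \<in> F'" for A
      using that F'(1) by (auto simp: nsets_def)
    define F1 where "F1 = (\<lambda>A. A - {x}) ` {A\<in>F'. x \<in> A}"
    define F0 where "F0 = {A\<in>F'. x \<notin> A}"
    have inj1: "inj_on (\<lambda>A. A - {x}) {A\<in>F'. x \<in> A}"
      by (rule inj_onI) (metis (mono_tags, lifting) insert_Diff mem_Collect_eq)
    have cF: "card F1 + card F0 = card F"
    proof -
      have "card F1 = card {A\<in>F'. x \<in> A}" unfolding F1_def using inj1 by (rule card_image)
      moreover have "card F' = card {A\<in>F'. x \<in> A} + card F0"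
        unfolding F0_def using finF' by (subst card_Un_disjoint[symmetric]) (auto intro: arg_cong[of _ _ card])
      ultimately show ?thesis using F' by simp
    qed
    have F1s: "F1 \<subseteq> [S]\<^bsup>r\<^esup>" unfolding F1_def nsets_def using F'D by auto
    have F0s: "F0 \<subseteq> [S]\<^bsup>Suc r\<^esup>" unfolding F0_def nsets_def using F'D by auto
    have finF1: "finite F1" using finF' by (simp add: F1_def)
    have lev0: "level F0 r \<subseteq> F1"
    proof
      fix T assume "T \<in> level F0 r"
      then obtain A where A: "A \<in> F'" "x \<notin> A" "T \<subseteq> A" "card T = r" "finite T"
        by (auto simp: level_def F0_def)
      have "\<not> A \<subseteq> T"
      proof
        assume "A \<subseteq> T"
        then have "card A \<le> card T" using A(5) by (intro card_mono)
        then show False using A(4) F'D[OF A(1)] by simp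
      qed
      then obtain j where j: "j \<in> A" "j \<notin> T" by blast
      have "card (A - {j}) = r" using j F'D[OF A(1)] by simp
      then have "T = A - {j}" using j A F'D(1)[OF A(1)] by (intro card_subset_eq) auto
      then have "insert x T \<in> F'" "x \<notin> T" using st[OF A(1) j(1) A(2)] A by auto
      then show "T \<in> F1" unfolding F1_def by (intro image_eqI[of _ _ "insert x T"]) auto
    qed
    have low0: "card (level F0 r) \<le> card F1" using lev0 finF1 by (rule card_mono[rotated])
    have finl1: "finite (level F1 (r - 1))" using finite_level[OF insert.hyps(1), of F1] F1s unfolding nsets_def by blast
    have lev1: "card F1 + card (level F1 (r - 1)) \<le> card (level F' r)"
    proof -
      have x1: "x \<notin> T" if "T \<in> level F1 (r - 1)" for T
        using that F1s insert.hyps by (auto simp: level_def nsets_def)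
      have x2: "x \<notin> T" if "T \<in> F1" for T
        using that by (auto simp: F1_def)
      have "inj_on (insert x) (level F1 (r - 1))"
        by (rule inj_onI) (metis x1 insert_ident)
      then have "card (insert x ` level F1 (r - 1)) = card (level F1 (r - 1))" by (rule card_image)
      moreover have "F1 \<inter> insert x ` level F1 (r - 1) = {}" using x2 by auto
      ultimately have "card F1 + card (level F1 (r - 1)) = card (F1 \<union> insert x ` level F1 (r - 1))"
        using finF1 finl1 by (simp add: card_Un_disjoint)
      also have "\<dots> \<le> card (level F' r)"
      proof (rule card_mono)
        show "finite (level F' r)" using finite_level[OF finS] F'D by blast
        have a: "T \<in> level F' r" if T: "T \<in> F1" for T
        proof -
          obtain A where A: "A \<in> F'" "T = A - {x}" using T unfolding F1_def by blast
          have "card T = r" "finite T" using T F1s by (auto simp: nsets_def)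
          then show ?thesis using A by (auto simp: level_def)
        qed
        have b: "insert x T \<in> level F' r" if T: "T \<in> level F1 (r - 1)" for T
        proof -
          obtain A where A: "A \<in> F'" "x \<in> A" "T \<subseteq> A - {x}" "card T = r - 1" "finite T"
            using T by (auto simp: level_def F1_def)
          have "card (insert x T) = r" using x1[OF T] A re by simp
          then show ?thesis using A by (auto simp: level_def)
        qed
        show "F1 \<union> insert x ` level F1 (r - 1) \<subseteq> level F' r" using a b by auto
      qed
      finally show ?thesis .
    qed
    define G where "G = cascade e (N - 1) (i - 1) (j - 1) t"
    have pos: "0 < i" "0 < j" "e = 0 \<or> 0 < N" using prems re by auto
    have p1: "cascade e N i j t (Suc r) = G (Suc r) + G r"
      using cascade_pascal[of e "Suc r" i j N t] pos re by (simp add: G_def)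
    have p2: "cascade e N i j t r = G r + G (r - 1)"
      using cascade_pascal[of e r i j N t] pos re by (simp add: G_def)
    have "G r \<le> card F1"
    proof (rule ccontr)
      assume "\<not> G r \<le> card F1"
      then have big: "G (Suc r) < card F0" and small: "card (level F0 r) < G r"
        using p1 prems(9) cF low0 by linarith+
      define \<mu> where "\<mu> = Suc r - e"
      have \<mu>: "\<mu> \<ge> 2" "Suc r - e = \<mu>" "r - e = \<mu> - 1" "Suc (r - e) = \<mu>" using re by (auto simp: \<mu>_def)
      show False
      proof (cases "i - 1 \<ge> \<mu>")
        case True
        have "G r \<le> card (level F0 r)" unfolding G_def
          by (rule IH[OF F0s]) (use prems True big \<mu> pos in \<open>auto simp: G_def\<close>)
        then show False using small by simp
      next
        case False
        \<comment> \<open>Lowering \<open>i\<close> leaves the range of the induction hypothesis: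
          the left end of the chord now counts no set at all on the upper level but still
          contributes 1 on the lower one. The hypothesis is applied instead to a chord starting at a
          single set, and \<open>chord_arith\<close> compares the two.\<close>
        then have i: "i = \<mu>" using prems(4) \<mu> pos by simp
        have z: "(\<mu> - Suc 0) choose \<mu> = 0" using \<mu> by simp
        have o: "(\<mu> - Suc 0) choose (\<mu> - Suc 0) = 1" by simp
        define c where "c = real ((j - 1) choose \<mu>)"
        define c' where "c' = real ((j - 1) choose (\<mu> - 1))"
        define b where "b = real e * real ((N - 1) choose Suc r)"
        define b' where "b' = real e * real ((N - 1) choose r)"
        have GS: "G (Suc r) = b + t * c"
          using z by (simp add: G_def cascade_def \<mu> i c_def b_def del: binomial_eq_0_iff)
        have Gr: "G r = b' + (1 - t) + t * c'"
          using o by (simp add: G_def cascade_def \<mu> i c'_def b'_def)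
        have bint: "b = real (e * ((N - 1) choose Suc r))" by (simp add: b_def)
        have c0: "c \<ge> 0" by (simp add: c_def)
        have "b < card F0" using big GS c0 prems(7) by (smt (verit) mult_nonneg_nonneg)
        then have "e * ((N - 1) choose Suc r) < card F0" unfolding bint of_nat_less_iff .
        then have F0b: "b + 1 \<le> card F0" unfolding bint by (metis Suc_eq_plus1 Suc_leI of_nat_1 of_nat_add of_nat_mono)
        have unit: "b' + real \<mu> \<le> card (level F0 r)" if "e = 1 \<longrightarrow> \<mu> \<le> N - 1"
        proof -
          have "cascade e (N - 1) \<mu> \<mu> 0 r \<le> card (level F0 r)"
            by (rule IH[OF F0s]) (use prems \<mu> that F0b in \<open>auto simp: cascade_def b_def\<close>)
          moreover have "\<mu> choose (\<mu> - 1) = \<mu>" using \<mu>(1) by (cases \<mu>) auto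
          ultimately show ?thesis using \<mu> by (simp add: cascade_def b'_def)
        qed
        show False
        proof (cases "j = \<mu>")
          case j: True
          then have Gr1: "G r = b' + 1" using Gr by (simp add: c'_def)
          show False
          proof (cases "e = 1 \<longrightarrow> \<mu> \<le> N - 1")
            case True
            then show False using unit Gr1 small \<mu> by simp
          next
            case False
            then have "N - 1 < r" "e = 1" using \<mu> by auto
            then have "b' = 0" by (simp add: b'_def)
            then have "card (level F0 r) < 1" using Gr1 small by simp
            moreover have "F0 \<noteq> {}" using F0b by (auto simp: b_def) (smt (verit) of_nat_0_le_iff mult_nonneg_nonneg)
            then obtain A where A: "A \<in> F0" by auto
            then have "card A = Suc r" "finite A" using F0s by (auto simp: nsets_def)
            then obtain T where "T \<subseteq> A" "card T = r" "finite T"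
              by (metis obtain_subset_with_card_n le_SucI order_refl)
            then have "T \<in> level F0 r" using A by (auto simp: level_def)
            moreover have "finite (level F0 r)" using lev0 finF1 by (rule finite_subset)
            ultimately show False by (metis card_eq_0_iff empty_iff less_one)
          qed
        next
          case False
          then have j: "j - 1 \<ge> \<mu>" "\<mu> < j" using prems(5) i by auto
          have Nj: "e = 1 \<longrightarrow> \<mu> \<le> N - 1" "e = 1 \<longrightarrow> j - 1 \<le> N - 1" using j prems(6) by auto
          define d where "d = real (j - \<mu>)"
          have c1: "c \<ge> 1" using j by (simp add: c_def Suc_le_eq)
          have cc: "c' * d = c * real \<mu>"
          proof -
            have "\<mu> * ((j - 1) choose \<mu>) = (j - 1) * ((j - 2) choose (\<mu> - 1))"
              using times_binomial_minus1_eq[of \<mu> "j - 1"] \<mu> by (simp add: numeral_2_eq_2)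
            moreover have "(j - 1 - (\<mu> - 1)) * ((j - 1) choose (\<mu> - 1)) = (j - 1) * ((j - 2) choose (\<mu> - 1))"
              using binomial_absorb_comp[of "j - 1" "\<mu> - 1"] by (simp add: numeral_2_eq_2)
            moreover have "j - 1 - (\<mu> - 1) = j - \<mu>" using \<mu> by simp
            ultimately have "\<mu> * ((j - 1) choose \<mu>) = (j - \<mu>) * ((j - 1) choose (\<mu> - 1))" by simp
            then show ?thesis unfolding c_def c'_def d_def by (metis mult.commute of_nat_mult)
          qed
          have ar: "t * c \<le> 1 \<Longrightarrow> (1 - t) + t * c' \<le> real \<mu>"
            "c > 1 \<Longrightarrow> (1 - t) + t * c' \<le> (1 - (t * c - 1) / (c - 1)) * real \<mu> + (t * c - 1) / (c - 1) * c'"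
          proof -
            have x: "0 \<le> t" "t \<le> 1" "real \<mu> \<ge> 2" "d \<ge> 1" using prems \<mu> j by (auto simp: d_def)
            have y: "c = 1" if "d < 2"
            proof -
              have "j - 1 = \<mu>" using that j by (simp add: d_def)
              then show ?thesis by (simp add: c_def)
            qed
            have "j - \<mu> = 1 \<or> 2 \<le> j - \<mu>" using j by linarith
            then have z: "d = 1 \<or> 2 \<le> d" unfolding d_def by auto
            show "t * c \<le> 1 \<Longrightarrow> (1 - t) + t * c' \<le> real \<mu>"
            "c > 1 \<Longrightarrow> (1 - t) + t * c' \<le> (1 - (t * c - 1) / (c - 1)) * real \<mu> + (t * c - 1) / (c - 1) * c'"
              using chord_arith[OF x cc c1 y z] by blast+
          qed
          show False
          proof (cases "t * c \<le> 1")
            case True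
            then show False using ar(1) unit Nj Gr small by linarith
          next
            case False
            then have tc: "t * c > 1" by simp
            then have c2: "c > 1" using prems(7,8) c1 mult_left_le_one_le[of c t] by linarith
            \<comment> \<open>The weight at which the chord from 1 to \<open>c\<close> has the same
              height \<open>t * c\<close> as the old chord from 0 to \<open>c\<close>.\<close>
            define s where "s = (t * c - 1) / (c - 1)"
            have s: "0 \<le> s" "s \<le> 1" using tc c2 prems(7,8) mult_left_le_one_le[of c t] by (auto simp: s_def)
            have "s * (c - 1) = t * c - 1" using c2 by (simp add: s_def)
            then have sc: "(1 - s) + s * c = t * c" by (simp add: algebra_simps)
            have "cascade e (N - 1) \<mu> (j - 1) s r \<le> card (level F0 r)"
            proof (rule IH[OF F0s])
              show "cascade e (N - 1) \<mu> (j - 1) s (Suc r) \<le> real (card F0)"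
                using sc big GS by (simp add: cascade_def \<mu> c_def b_def)
            qed (use prems \<mu> Nj j s in auto)
            moreover have "cascade e (N - 1) \<mu> (j - 1) s r = b' + (1 - s) * real \<mu> + s * c'"
            proof -
              have "\<mu> choose (\<mu> - 1) = \<mu>" using \<mu>(1) by (cases \<mu>) auto
              then show ?thesis using \<mu> by (simp add: cascade_def b'_def c'_def)
            qed
            ultimately show False using ar(2)[OF c2] Gr small unfolding s_def by linarith
          qed
        qed
      qed
    qed
    moreover have "G (r - 1) \<le> card (level F1 (r - 1))"
    proof -
      have "cascade e (N - 1) (i - 1) (j - 1) t (r - 1) \<le> card (level F1 (r - 1))"
      proof (rule IH)
        show "F1 \<subseteq> [S]\<^bsup>Suc (r - 1)\<^esup>" using F1s re by simp
        show "cascade e (N - 1) (i - 1) (j - 1) t (Suc (r - 1)) \<le> real (card F1)"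
          using \<open>G r \<le> card F1\<close> re by (simp add: G_def)
      qed (use prems re in auto)
      then show ?thesis by (simp add: G_def)
    qed
    ultimately have "cascade e N i j t r \<le> card (level F' r)" using p2 lev1 by linarith
    then show ?thesis using F'(3) by linarith
  qed
qed

section \<open>Shadows on lower levels and cross-intersecting pairs\<close>

lemma level_nsets: "finite S \<Longrightarrow> F \<subseteq> [S]\<^bsup>m\<^esup> \<Longrightarrow> level F r \<subseteq> [S]\<^bsup>r\<^esup>"
  by (auto simp: level_def nsets_def)

lemma level_self:
  assumes "F \<subseteq> [S]\<^bsup>m\<^esup>"
  shows "level F m = F"
proof -
  have F: "finite A" "card A = m" if "A \<in> F" for A using that assms by (auto simp: nsets_def)
  have "T = A" if "A \<in> F" "T \<subseteq> A" "card T = m" for T A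
    using card_subset_eq[OF F(1)[OF that(1)] that(2)] F that by simp
  then show ?thesis using F unfolding level_def by blast
qed

text \<open>The parameters of the chord do not depend on the level, so the conclusion of
  \<open>chord_shadow\<close> is again its hypothesis one level down.\<close>

lemma chord_level:
  assumes S: "finite S" and F: "F \<subseteq> [S]\<^bsup>m\<^esup>" and e: "e \<le> 1" "e \<le> r" and r: "r \<le> m"
    and ij: "m - e \<le> i" "i \<le> j" "e = 1 \<longrightarrow> j \<le> N" and t: "0 \<le> t" "t \<le> 1"
    and c: "cascade e N i j t m \<le> card F"
  shows "cascade e N i j t r \<le> card (level F r)"
  using r e(2)
proof (induction r rule: inc_induct)
  case base
  then show ?case using c level_self[OF F] by simp
next
  case (step r)
  have "card A = m" "finite A" if "A \<in> F" for A using F that by (auto simp: nsets_def)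
  then have lev: "level F r = level (level F (Suc r)) r" using step.hyps by (intro level_Suc) auto
  have "cascade e N i j t r \<le> card (level (level F (Suc r)) r)"
    by (rule chord_shadow[OF S level_nsets[OF S F]]) (use step e ij t in auto)
  then show ?case using lev by simp
qed

text \<open>Two sets are disjoint exactly when the second lies in the complement of the first. So
  the second family is disjoint from level \<open>l\<close> of the complements of the first.\<close>

lemma card_level_cross:
  assumes S: "finite S" and A: "\<A> \<subseteq> [S]\<^bsup>k\<^esup>" and B: "\<B> \<subseteq> [S]\<^bsup>l\<^esup>" and ci: "cross_intersecting \<A> \<B>"
  shows "(-) S ` \<A> \<subseteq> [S]\<^bsup>(card S - k)\<^esup>" "card ((-) S ` \<A>) = card \<A>"
    "card (level ((-) S ` \<A>) l) + card \<B> \<le> card S choose l"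
proof -
  show sub: "(-) S ` \<A> \<subseteq> [S]\<^bsup>(card S - k)\<^esup>"
    using A S by (auto simp: nsets_def card_Diff_subset finite_subset)
  have "inj_on ((-) S) \<A>"
    by (rule inj_onI) (metis (no_types, lifting) A double_diff mem_Collect_eq nsets_def order_refl subsetD)
  then show "card ((-) S ` \<A>) = card \<A>" by (rule card_image)
  have "level ((-) S ` \<A>) l \<inter> \<B> = {}"
    using ci unfolding cross_intersecting_def level_def by auto
  moreover have "level ((-) S ` \<A>) l \<union> \<B> \<subseteq> [S]\<^bsup>l\<^esup>" using level_nsets[OF S sub] B by auto
  moreover have "finite ([S]\<^bsup>l\<^esup>)" using S by (rule finite_imp_finite_nsets)
  ultimately show "card (level ((-) S ` \<A>) l) + card \<B> \<le> card S choose l"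
    by (metis card_Un_disjoint card_mono card_nsets finite_Un finite_subset)
qed

lemma cross_chord:
  assumes S: "finite S" "card S = g" and A: "\<A> \<subseteq> [S]\<^bsup>k\<^esup>" and B: "\<B> \<subseteq> [S]\<^bsup>l\<^esup>" and ci: "cross_intersecting \<A> \<B>"
    and kl: "k + l \<le> g" and e: "e \<le> 1" "e \<le> l"
    and ij: "g - k - e \<le> i" "i \<le> j" "e = 1 \<longrightarrow> j \<le> N" and t: "0 \<le> t" "t \<le> 1"
    and c: "cascade e N i j t (g - k) \<le> card \<A>"
  shows "card \<B> \<le> real (g choose l) - cascade e N i j t l"
proof -
  note lc = card_level_cross[OF S(1) A B ci]
  have "cascade e N i j t l \<le> card (level ((-) S ` \<A>) l)"
    by (rule chord_level[OF S(1) lc(1) e]) (use S kl ij t c lc in auto)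
  moreover have "real (card (level ((-) S ` \<A>) l)) + card \<B> \<le> g choose l"
    using lc(3) S by (metis of_nat_add of_nat_mono)
  ultimately show ?thesis by linarith
qed

section \<open>Feasible sizes of cross-intersecting pairs\<close>

lemma binomial_down:
  assumes "b \<le> a"
  shows "real a * real ((a - 1) choose b) = (real a - real b) * real (a choose b)"
proof -
  have "real ((a - b) * (a choose b)) = real (a * ((a - 1) choose b))"
    by (simp only: binomial_absorb_comp)
  then show ?thesis using assms by (simp add: of_nat_diff)
qed

lemma binomial_diag:
  assumes "1 \<le> b"
  shows "real a * real ((a - 1) choose (b - 1)) = real b * real (a choose b)"
proof -
  have "real (b * (a choose b)) = real (a * ((a - 1) choose (b - 1)))"
    using assms by (subst times_binomial_minus1_eq) auto
  then show ?thesis by simp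
qed

text \<open>With \<open>j = n - 2 - s\<close>, the step multiplies the left binomial coefficient by
  \<open>(k - s) / j\<close> and the right one by \<open>(j - (l - 2)) / j\<close>; the condition
  \<open>k + l \<le> n\<close> makes the first factor the smaller one.\<close>

lemma binomial_ratio_step:
  fixes c d :: real
  assumes s: "s < k" and d: "0 \<le> d" and kn: "k + l \<le> n" and l: "2 \<le> l"
    and le: "c * real ((n - 2 - s) choose (k - s)) \<le> d * real ((n - 2 - s) choose (l - 2))"
  shows "c * real ((n - 2 - Suc s) choose (k - Suc s)) \<le> d * real ((n - 2 - Suc s) choose (l - 2))"
proof -
  define j where "j = n - 2 - s"
  have j: "1 \<le> j" "l - 2 \<le> j" "k - s \<le> j - (l - 2)" "n - 2 - Suc s = j - 1" "k - Suc s = k - s - 1"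
    using s kn l by (auto simp: j_def)
  have "real j * (c * real ((j - 1) choose (k - s - 1))) = real (k - s) * (c * real (j choose (k - s)))"
    using binomial_diag[of "k - s" j] s by simp
  also have "\<dots> \<le> real (k - s) * (d * real (j choose (l - 2)))"
    using le by (intro mult_left_mono) (auto simp: j_def)
  also have "\<dots> \<le> (real j - real (l - 2)) * (d * real (j choose (l - 2)))"
    using j d by (intro mult_right_mono mult_nonneg_nonneg) (auto simp flip: of_nat_diff)
  also have "\<dots> = real j * (d * real ((j - 1) choose (l - 2)))"
    using binomial_down[OF j(2)] by (simp only: mult.left_commute)
  finally have "c * real ((j - 1) choose (k - s - 1)) \<le> d * real ((j - 1) choose (l - 2))"
    by (rule mult_left_le_imp_le) (use j in simp)
  then show ?thesis unfolding j(4,5) .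
qed

text \<open>\<open>P\<close> and \<open>Q\<close> are the sizes of the full stars, so that the extremal pairs have sizes
  \<open>(P + U, Q - V)\<close> and \<open>(P + 1, Q - w)\<close>. All other binomial coefficients are rational multiples of
  \<open>U\<close>, \<open>V\<close> and \<open>w\<close>, with factors in \<open>K\<close>, \<open>L\<close>, \<open>N\<close>.\<close>

locale sizes =
  fixes n k l :: nat
  assumes k2: "2 \<le> k" and kl: "k \<le> l" and nl: "2 * l \<le> n" and nk: "2 * k < n"
begin

definition "P = real ((n - 1) choose (k - 1))"
definition "Q = real ((n - 1) choose (l - 1))"
definition "U = real ((n - 2) choose (k - 1))"
definition "V = real ((n - 2) choose (l - 1))"
definition "w = real ((n - k - 1) choose (l - 1))"
definition "w' = real ((n - l - 1) choose (k - 1))"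
definition "U2 = real ((n - 3) choose (k - 2))"
definition "V2 = real ((n - 3) choose (l - 2))"
definition "K = real k - 1"
definition "L = real l - 1"
definition "N = real n - 1"

abbreviation "hm \<equiv> (P + 1) * (Q - w)"
abbreviation "star \<equiv> (P + U) * (Q - V)"

lemma nkl: "k + l < n" using kl nl nk by linarith

lemma KLN: "1 \<le> K" "K \<le> L" "2 * L + 1 \<le> N" "2 * K + 2 \<le> N"
  using k2 kl nl nk by (auto simp: K_def L_def N_def)

lemma PU: "(N - K) * P = N * U"
proof -
  have e: "n - 1 - 1 = n - 2" using nk by simp
  show ?thesis using binomial_down[of "k - 1" "n - 1"] nk k2 unfolding e
    by (simp add: P_def U_def K_def N_def of_nat_diff)
qed

lemma QV: "(N - L) * Q = N * V"
proof -
  have e: "n - 1 - 1 = n - 2" using nk by simp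
  show ?thesis using binomial_down[of "l - 1" "n - 1"] nl nk k2 kl unfolding e
    by (simp add: Q_def V_def L_def N_def of_nat_diff)
qed

lemma P_split: "P = U + real ((n - 2) choose (k - 2))"
proof -
  have e: "n - 1 - 1 = n - 2" "k - 1 - 1 = k - 2" by auto
  show ?thesis using choose_reduce_nat[of "n - 1" "k - 1"] k2 nk unfolding e by (simp add: P_def U_def)
qed

lemma Q_split: "Q = V + real ((n - 2) choose (l - 2))"
proof -
  have e: "n - 1 - 1 = n - 2" "l - 1 - 1 = l - 2" by auto
  show ?thesis using choose_reduce_nat[of "n - 1" "l - 1"] k2 kl nk unfolding e by (simp add: Q_def V_def)
qed

lemma U2: "(N - 1) * U2 = K * U"
proof -
  have e: "n - 2 - 1 = n - 3" "k - 1 - 1 = k - 2" by auto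
  show ?thesis using binomial_diag[of "k - 1" "n - 2"] k2 nk unfolding e
    by (simp add: U2_def U_def K_def N_def of_nat_diff)
qed

lemma V2: "(N - 1) * V2 = L * V"
proof -
  have e: "n - 2 - 1 = n - 3" "l - 1 - 1 = l - 2" by auto
  show ?thesis using binomial_diag[of "l - 1" "n - 2"] k2 kl nk unfolding e
    by (simp add: V2_def V_def L_def N_def of_nat_diff)
qed

lemma U_U2: "real ((n - 3) choose (k - 1)) = U - U2"
proof -
  have e: "n - 2 - 1 = n - 3" "k - 1 - 1 = k - 2" by auto
  show ?thesis using choose_reduce_nat[of "n - 2" "k - 1"] k2 nk unfolding e by (simp add: U2_def U_def)
qed

lemma V_V2: "real ((n - 3) choose (l - 1)) = V - V2"
proof -
  have e: "n - 2 - 1 = n - 3" "l - 1 - 1 = l - 2" by auto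
  show ?thesis using choose_reduce_nat[of "n - 2" "l - 1"] k2 kl nk unfolding e by (simp add: V2_def V_def)
qed

text \<open>Both sides count ordered pairs of disjoint sets of sizes \<open>k - 1\<close> and
  \<open>l - 1\<close> in a set of \<open>n - 2\<close> elements, choosing one or the other
  first.\<close>

lemma wU: "w * U = w' * V"
proof -
  have e: "n - 2 - (k - 1) = n - k - 1" "n - 2 - (l - 1) = n - l - 1"
    "k + l - 2 - (k - 1) = l - 1" "k + l - 2 - (l - 1) = k - 1" using k2 kl by auto
  have le: "k - 1 \<le> k + l - 2" "l - 1 \<le> k + l - 2" "k + l - 2 \<le> n - 2" using k2 kl nkl by auto
  have "(k + l - 2) choose (k - 1) = (k + l - 2) choose (l - 1)"
    using binomial_symmetric[OF le(1)] unfolding e by simp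
  then have "((n - 2) choose (k - 1)) * ((n - k - 1) choose (l - 1))
    = ((n - 2) choose (l - 1)) * ((n - l - 1) choose (k - 1))"
    using choose_mult[OF le(1,3)] choose_mult[OF le(2,3)] unfolding e by simp
  then have "real (((n - 2) choose (k - 1)) * ((n - k - 1) choose (l - 1)))
    = real (((n - 2) choose (l - 1)) * ((n - l - 1) choose (k - 1)))" by (simp only:)
  then show ?thesis by (simp add: w_def w'_def U_def V_def mult.commute)
qed

lemma w_le: "w \<le> V - V2"
  unfolding V_V2[symmetric] w_def using k2 by (intro of_nat_mono binomial_right_mono) auto

lemma U_ge: "U \<ge> N - 1"
proof -
  have "1 * (n - 2) \<le> (n - 2) choose (k - 1)"
  proof (cases "k = 2")
    case True then show ?thesis by simp
  next
    case False
    then have "2 * (k - 1) \<le> n - 2" "1 \<le> k - 1" using k2 nk by auto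
    then have "(n - 2) choose 1 \<le> (n - 2) choose (k - 1)" by (intro binomial_mono) auto
    then show ?thesis by simp
  qed
  then have "real (n - 2) \<le> real ((n - 2) choose (k - 1))" by (simp only: of_nat_le_iff mult_1)
  then show ?thesis using nk k2 by (simp add: U_def N_def of_nat_diff)
qed

lemma UV: "U \<le> V"
proof -
  have "2 * (l - 1) \<le> n - 2" "k - 1 \<le> l - 1" using nl kl k2 by auto
  then show ?thesis unfolding U_def V_def by (intro of_nat_mono binomial_mono) auto
qed

lemma w_ge: "w \<ge> 2"
proof -
  have "l choose (l - 1) \<le> (n - k - 1) choose (l - 1)" using nkl by (intro binomial_right_mono) simp
  moreover have "l choose (l - 1) = l" using k2 kl by (cases l) auto
  ultimately show ?thesis using k2 kl by (simp add: w_def)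
qed

lemma w'_ge: "w' \<ge> 2"
proof -
  have "k choose (k - 1) \<le> (n - l - 1) choose (k - 1)" using nkl by (intro binomial_right_mono) simp
  moreover have "k choose (k - 1) = k" using k2 by (cases k) auto
  ultimately show ?thesis using k2 by (simp add: w'_def)
qed

lemma pos: "0 < U" "0 < V" "0 < P" "0 < Q" "w < V" "V < Q" "U < P" "0 < V2"
proof -
  show U: "0 < U" using U_ge KLN by linarith
  then show V: "0 < V" using UV by linarith
  show "U < P" using P_split zero_less_binomial[of "k - 2" "n - 2"] nk by simp
  then show "0 < P" using U by simp
  show "V < Q" using Q_split zero_less_binomial[of "l - 2" "n - 2"] nkl by simp
  then show "0 < Q" using V by simp
  show "0 < V2" using nkl k2 by (simp add: V2_def)
  then show "w < V" using w_le by simp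
qed

end

section \<open>The region of feasible sizes\<close>

lemma convex_weight:
  fixes x c :: real
  assumes "1 \<le> x" "x \<le> c"
  obtains t where "0 \<le> t" "t \<le> 1" "x = (1 - t) + t * c"
proof (cases "c = 1")
  case True
  then show ?thesis using that[of 0] assms by simp
next
  case False
  then have c: "c > 1" using assms by simp
  have "(x - 1) / (c - 1) * (c - 1) = x - 1" using c by simp
  then have "x = (1 - (x - 1) / (c - 1)) + (x - 1) / (c - 1) * c" by (simp only: algebra_simps)
  then show ?thesis using that[of "(x - 1) / (c - 1)"] assms c by simp
qed

context sizes
begin

lemma link_link_sizes: "(N - 1) * (N - 2) * real ((n - 4) choose (k - 2)) = K * (N - K - 1) * U"
  "(N - 1) * (N - 2) * real ((n - 4) choose (l - 2)) = L * (N - L - 1) * V"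
proof -
  have e: "n - 3 - 1 = n - 4" by simp
  have "real (n - 3) * real ((n - 4) choose (k - 2)) = (real (n - 3) - real (k - 2)) * U2"
    using binomial_down[of "k - 2" "n - 3"] nk k2 unfolding e U2_def by simp
  then have "(N - 2) * real ((n - 4) choose (k - 2)) = (N - K - 1) * U2"
    using nk k2 by (simp add: N_def K_def of_nat_diff)
  then have "(N - 1) * (N - 2) * real ((n - 4) choose (k - 2)) = (N - K - 1) * ((N - 1) * U2)" by simp
  then show "(N - 1) * (N - 2) * real ((n - 4) choose (k - 2)) = K * (N - K - 1) * U"
    by (simp add: U2)
  have "real (n - 3) * real ((n - 4) choose (l - 2)) = (real (n - 3) - real (l - 2)) * V2"
    using binomial_down[of "l - 2" "n - 3"] nkl k2 unfolding e V2_def by simp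
  then have "(N - 2) * real ((n - 4) choose (l - 2)) = (N - L - 1) * V2"
    using nk k2 kl by (simp add: N_def L_def of_nat_diff)
  then have "(N - 1) * (N - 2) * real ((n - 4) choose (l - 2)) = (N - L - 1) * ((N - 1) * V2)" by simp
  then show "(N - 1) * (N - 2) * real ((n - 4) choose (l - 2)) = L * (N - L - 1) * V"
    by (simp add: V2)
qed

lemma KL_mono: "K * (N - K - 1) \<le> L * (N - L - 1)"
proof -
  have "0 \<le> (L - K) * (N - 1 - L - K)" using KLN by (intro mult_nonneg_nonneg) auto
  then show ?thesis by (simp add: algebra_simps)
qed

lemma UV_ratio:
  assumes "2 \<le> s" "s < k"
  shows "V * real ((n - 2 - s) choose (k - s)) \<le> U * real ((n - 2 - s) choose (l - 2))"
  using assms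
proof (induction s rule: dec_induct)
  case base
  have p: "0 < (N - 1) * (N - 2)" using KLN by simp
  have "(N - 1) * (N - 2) * (V * real ((n - 4) choose (k - 2))) = V * U * (K * (N - K - 1))"
    using arg_cong[OF link_link_sizes(1), of "\<lambda>x. V * x"] by (simp only: mult_ac)
  also have "\<dots> \<le> V * U * (L * (N - L - 1))" using pos KL_mono by (intro mult_left_mono) auto
  also have "\<dots> = (N - 1) * (N - 2) * (U * real ((n - 4) choose (l - 2)))"
    using arg_cong[OF link_link_sizes(2), of "\<lambda>x. U * x"] by (simp only: mult_ac)
  finally have "V * real ((n - 4) choose (k - 2)) \<le> U * real ((n - 4) choose (l - 2))"
    using p by (rule mult_left_le_imp_le)
  then show ?case by simp
next
  case (step s)
  then show ?case using binomial_ratio_step[of s k U l n V] pos nkl kl k2 by simp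
qed

lemma chain_pascal:
  assumes "s < k"
  shows "real ((n - 1 - s) choose (k - s)) = real ((n - 2 - s) choose (k - Suc s)) + real ((n - 2 - s) choose (k - s))"
    "real ((n - 1 - s) choose (l - 1)) = real ((n - 2 - s) choose (l - 2)) + real ((n - 2 - s) choose (l - 1))"
proof -
  have e: "n - 1 - s - 1 = n - 2 - s" "k - s - 1 = k - Suc s" "l - 1 - 1 = l - 2" by auto
  show "real ((n - 1 - s) choose (k - s)) = real ((n - 2 - s) choose (k - Suc s)) + real ((n - 2 - s) choose (k - s))"
    using choose_reduce_nat[of "n - 1 - s" "k - s"] assms nk unfolding e by simp
  show "real ((n - 1 - s) choose (l - 1)) = real ((n - 2 - s) choose (l - 2)) + real ((n - 2 - s) choose (l - 1))"
    using choose_reduce_nat[of "n - 1 - s" "l - 1"] assms nk k2 kl unfolding e by simp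
qed

text \<open>The boundary vertices with coordinates \<open>(n - 1 - s) choose (k - s)\<close> and
  \<open>V - ((n - 1 - s) choose (l - 1))\<close> lead from \<open>(1, V - w)\<close> at
  \<open>s = k\<close> to \<open>(U2, V2)\<close> at \<open>s = 2\<close>. By
  \<open>UV_ratio\<close> every edge falls at least as steeply as slope \<open>- V / U\<close>, so
  summing over the edges puts \<open>(U2, V2)\<close> on or below the line of that slope through
  \<open>(1, V - w)\<close>.\<close>

lemma corner: "V * U2 + U * V2 \<le> U * V - U * w + V"
proof -
  have "V * (U2 - real ((n - 1 - s) choose (k - s))) \<le> U * (V - V2 - real ((n - 1 - s) choose (l - 1)))"
    if "2 \<le> s" "s \<le> k" for s using that
  proof (induction s rule: dec_induct)
    case base
    have "n - 1 - 2 = n - 3" by simp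
    then show ?case using V_V2 by (simp add: U2_def)
  next
    case (step s)
    have e: "n - 1 - Suc s = n - 2 - s" by simp
    have "V * real ((n - 2 - s) choose (k - s)) \<le> U * real ((n - 2 - s) choose (l - 2))"
      using UV_ratio step by simp
    then show ?case using step.IH step.prems chain_pascal[of s] step.hyps unfolding e by (simp add: algebra_simps)
  qed
  from this[of k] show ?thesis using k2 by (simp add: w_def algebra_simps)
qed

text \<open>\<open>z\<close> and \<open>y\<close> stand for what the sizes of the two families exceed the leading terms of the
  cascades by; the same region arises for several choices of these leading terms.\<close>

definition chord_bound :: "nat \<Rightarrow> nat \<Rightarrow> real \<Rightarrow> real \<Rightarrow> real \<Rightarrow> bool" where
  "chord_bound a b z y c \<longleftrightarrow> (\<forall>i j t. n - a - 1 \<le> i \<longrightarrow> i \<le> j \<longrightarrow> j \<le> n - 2 \<longrightarrow> 0 \<le> t \<longrightarrow> t \<le> 1 \<longrightarrow>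
     (1 - t) * real (i choose (n - a - 1)) + t * real (j choose (n - a - 1)) \<le> z \<longrightarrow>
     y \<le> c - ((1 - t) * real (i choose (b - 1)) + t * real (j choose (b - 1))))"

definition feasible :: "real \<Rightarrow> real \<Rightarrow> bool" where
  "feasible z y \<longleftrightarrow> chord_bound k l z y V \<and> chord_bound l k y z U"

text \<open>Splitting off a leading cascade term and deleting an element of the ground set have the
  same effect on the levels of the remaining two-term chord. This is why whole pairs
  (\<open>e = 1\<close>) and links or sets avoiding an element (where \<open>e = 0\<close> occurs)
  all lead to the levels \<open>n - a - 1\<close> and \<open>b - 1\<close>.\<close>

lemma chord_cross:
  assumes S: "finite S" "card S = g" and A: "\<A> \<subseteq> [S]\<^bsup>a'\<^esup>" and B: "\<B> \<subseteq> [S]\<^bsup>b'\<^esup>" and ci: "cross_intersecting \<A> \<B>"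
    and ab: "a' + b' \<le> g" and e: "e \<le> 1" "e \<le> b'" "g - a' - e = n - a - 1" "b' - e = b - 1"
    and M: "e = 1 \<longrightarrow> n - 2 \<le> M"
    and z: "real (card \<A>) = real e * real (M choose (g - a')) + z"
    and y: "real (card \<B>) = real (g choose b') - real e * real (M choose b') - c + y"
  shows "chord_bound a b z y c"
  unfolding chord_bound_def
proof (intro allI impI)
  fix i j :: nat and t :: real
  assume h: "n - a - 1 \<le> i" "i \<le> j" "j \<le> n - 2" "0 \<le> t" "t \<le> 1"
    "(1 - t) * real (i choose (n - a - 1)) + t * real (j choose (n - a - 1)) \<le> z"
  have "card \<B> \<le> real (g choose b') - cascade e M i j t b'"
  proof (rule cross_chord[OF S A B ci ab e(1,2)])
    show "cascade e M i j t (g - a') \<le> real (card \<A>)"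
      unfolding cascade_def e(3) using h z by simp
  qed (use h e M in auto)
  then show "y \<le> c - ((1 - t) * real (i choose (b - 1)) + t * real (j choose (b - 1)))"
    using y unfolding cascade_def e(4) by simp
qed

lemma binomial_facts:
  "real ((n - 1) choose (n - k)) = P" "real ((n - 1) choose (n - l)) = Q"
  "real ((n - 2) choose (n - k)) = P - U" "real ((n - 2) choose (n - l)) = Q - V"
  "real (n choose k) - real ((n - 1) choose k) = P" "real (n choose l) - real ((n - 1) choose l) = Q"
  "real ((n - 1) choose k) - real ((n - 2) choose k) = U" "real ((n - 1) choose l) - real ((n - 2) choose l) = V"
proof -
  have s: "(n - 1) choose (n - k) = (n - 1) choose (k - 1)" "(n - 1) choose (n - l) = (n - 1) choose (l - 1)"
    "(n - 2) choose (n - k) = (n - 2) choose (k - 2)" "(n - 2) choose (n - l) = (n - 2) choose (l - 2)"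
  proof -
    have e: "n - 1 - (k - 1) = n - k" "n - 1 - (l - 1) = n - l" "n - 2 - (k - 2) = n - k" "n - 2 - (l - 2) = n - l"
      using k2 kl by auto
    show "(n - 1) choose (n - k) = (n - 1) choose (k - 1)" "(n - 1) choose (n - l) = (n - 1) choose (l - 1)"
    "(n - 2) choose (n - k) = (n - 2) choose (k - 2)" "(n - 2) choose (n - l) = (n - 2) choose (l - 2)"
      using binomial_symmetric[of "k - 1" "n - 1"] binomial_symmetric[of "l - 1" "n - 1"]
      binomial_symmetric[of "k - 2" "n - 2"] binomial_symmetric[of "l - 2" "n - 2"] nkl unfolding e by auto
  qed
  show "real ((n - 1) choose (n - k)) = P" "real ((n - 1) choose (n - l)) = Q"
  "real ((n - 2) choose (n - k)) = P - U" "real ((n - 2) choose (n - l)) = Q - V"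
    unfolding s using P_split Q_split by (auto simp: P_def Q_def)
  have e: "n - 1 - 1 = n - 2" by simp
  show "real (n choose k) - real ((n - 1) choose k) = P" "real (n choose l) - real ((n - 1) choose l) = Q"
    using choose_reduce_nat[of n k] choose_reduce_nat[of n l] k2 kl nk by (auto simp: P_def Q_def)
  show "real ((n - 1) choose k) - real ((n - 2) choose k) = U" "real ((n - 1) choose l) - real ((n - 2) choose l) = V"
    using choose_reduce_nat[of "n - 1" k] choose_reduce_nat[of "n - 1" l] k2 kl nk unfolding e
    by (auto simp: U_def V_def)
qed

text \<open>In terms of complements, \<open>P\<close> is \<open>(n - 1) choose (n - k)\<close> and
  \<open>Q - V\<close> is \<open>(n - 2) choose (n - l)\<close>; these are the leading terms split
  off from the two cascades.\<close>

lemma feasible_above_P: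
  assumes S: "finite S" "card S = n" and A: "\<A> \<subseteq> [S]\<^bsup>k\<^esup>" and B: "\<B> \<subseteq> [S]\<^bsup>l\<^esup>" and ci: "cross_intersecting \<A> \<B>"
  shows "feasible (card \<A> - P) (card \<B> - (Q - V))"
proof -
  have ic: "cross_intersecting \<B> \<A>" using ci by (auto simp: cross_intersecting_def)
  have "chord_bound k l (card \<A> - P) (card \<B> - (Q - V)) V"
    by (rule chord_cross[OF S A B ci, of 1 _ _ "n - 1"]) (use binomial_facts nkl k2 kl in \<open>(linarith | auto)+\<close>)
  moreover have "chord_bound l k (card \<B> - (Q - V)) (card \<A> - P) U"
    by (rule chord_cross[OF S B A ic, of 1 _ _ "n - 2"]) (use binomial_facts nkl k2 kl in \<open>(linarith | auto)+\<close>)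
  ultimately show ?thesis by (simp add: feasible_def)
qed

lemma feasible_above_Q:
  assumes S: "finite S" "card S = n" and A: "\<A> \<subseteq> [S]\<^bsup>k\<^esup>" and B: "\<B> \<subseteq> [S]\<^bsup>l\<^esup>" and ci: "cross_intersecting \<A> \<B>"
  shows "feasible (card \<A> - (P - U)) (card \<B> - Q)"
proof -
  have ic: "cross_intersecting \<B> \<A>" using ci by (auto simp: cross_intersecting_def)
  have "chord_bound k l (card \<A> - (P - U)) (card \<B> - Q) V"
    by (rule chord_cross[OF S A B ci, of 1 _ _ "n - 2"]) (use binomial_facts nkl k2 kl in \<open>(linarith | auto)+\<close>)
  moreover have "chord_bound l k (card \<B> - Q) (card \<A> - (P - U)) U"
    by (rule chord_cross[OF S B A ic, of 1 _ _ "n - 1"]) (use binomial_facts nkl k2 kl in \<open>(linarith | auto)+\<close>)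
  ultimately show ?thesis by (simp add: feasible_def)
qed

text \<open>For the sets avoiding an element and the link of that element. Deleting the element has
  already lowered the levels seen from the first family, so no leading term is split off there; the
  link still loses \<open>Q - V\<close>, the size of a full star on \<open>n - 1\<close>
  points.\<close>

lemma feasible_link_B:
  assumes S: "finite S" "card S = n - 1" and A: "\<A> \<subseteq> [S]\<^bsup>k\<^esup>" and B: "\<B> \<subseteq> [S]\<^bsup>(l-1)\<^esup>" and ci: "cross_intersecting \<A> \<B>"
  shows "feasible (card \<A>) (card \<B> - (Q - V))"
proof -
  have ic: "cross_intersecting \<B> \<A>" using ci by (auto simp: cross_intersecting_def)
  have "chord_bound k l (card \<A>) (card \<B> - (Q - V)) V"
    by (rule chord_cross[OF S A B ci, of 0 _ _ 0]) (use nkl k2 kl in \<open>(linarith | auto simp: Q_def)+\<close>)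
  moreover have "chord_bound l k (card \<B> - (Q - V)) (card \<A>) U"
    by (rule chord_cross[OF S B A ic, of 1 _ _ "n - 2"]) (use binomial_facts nkl k2 kl in \<open>(linarith | auto)+\<close>)
  ultimately show ?thesis by (simp add: feasible_def)
qed

lemma feasible_link_A:
  assumes S: "finite S" "card S = n - 1" and A: "\<A> \<subseteq> [S]\<^bsup>(k-1)\<^esup>" and B: "\<B> \<subseteq> [S]\<^bsup>l\<^esup>" and ci: "cross_intersecting \<A> \<B>"
  shows "feasible (card \<A> - (P - U)) (card \<B>)"
proof -
  have ic: "cross_intersecting \<B> \<A>" using ci by (auto simp: cross_intersecting_def)
  have "chord_bound k l (card \<A> - (P - U)) (card \<B>) V"
    by (rule chord_cross[OF S A B ci, of 1 _ _ "n - 2"]) (use binomial_facts nkl k2 kl in \<open>(linarith | auto)+\<close>)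
  moreover have "chord_bound l k (card \<B>) (card \<A> - (P - U)) U"
    by (rule chord_cross[OF S B A ic, of 0 _ _ 0]) (use nkl k2 kl in \<open>(linarith | auto simp: P_def)+\<close>)
  ultimately show ?thesis by (simp add: feasible_def)
qed

lemma feasible_zD:
  assumes "feasible z y" "n - k - 1 \<le> i" "i \<le> j" "j \<le> n - 2" "0 \<le> t" "t \<le> 1"
     "(1 - t) * real (i choose (n - k - 1)) + t * real (j choose (n - k - 1)) \<le> z"
   shows "y \<le> V - ((1 - t) * real (i choose (l - 1)) + t * real (j choose (l - 1)))"
  using assms unfolding feasible_def chord_bound_def by blast

lemma feasible_yD:
  assumes "feasible z y" "n - l - 1 \<le> i" "i \<le> j" "j \<le> n - 2" "0 \<le> t" "t \<le> 1"
     "(1 - t) * real (i choose (n - l - 1)) + t * real (j choose (n - l - 1)) \<le> y"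
   shows "z \<le> U - ((1 - t) * real (i choose (k - 1)) + t * real (j choose (k - 1)))"
  using assms unfolding feasible_def chord_bound_def by blast

text \<open>The chord between the smallest admissible index \<open>n - k - 1\<close>, where the
  binomial coefficient is 1, and the index \<open>n - 3\<close>, where it is
  \<open>U2\<close>.\<close>

lemma feasible_z_corner:
  assumes f: "feasible z y" and t: "0 \<le> t" "t \<le> 1" "z \<ge> (1 - t) + t * U2"
  shows "y \<le> V - ((1 - t) * w + t * (V - V2))"
proof -
  have "(n - 3) choose (n - k - 1) = (n - 3) choose (k - 2)"
  proof -
    have e: "n - 3 - (k - 2) = n - k - 1" using k2 by auto
    show ?thesis using binomial_symmetric[of "k - 2" "n - 3"] k2 nk unfolding e by simp
  qed
  moreover have "n - k - 1 \<le> n - 3" "n - 3 \<le> n - 2" using k2 by linarith+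
  ultimately show ?thesis using feasible_zD[OF f, of "n - k - 1" "n - 3" t] t V_V2
    by (simp add: U2_def w_def)
qed

lemma feasible_y_corner:
  assumes f: "feasible z y" and t: "0 \<le> t" "t \<le> 1" "y \<ge> (1 - t) + t * V2"
  shows "z \<le> U - ((1 - t) * w' + t * (U - U2))"
proof -
  have "(n - 3) choose (n - l - 1) = (n - 3) choose (l - 2)"
  proof -
    have e: "n - 3 - (l - 2) = n - l - 1" using k2 kl by auto
    show ?thesis using binomial_symmetric[of "l - 2" "n - 3"] k2 kl nkl unfolding e by simp
  qed
  moreover have "n - l - 1 \<le> n - 3" "n - 3 \<le> n - 2" using k2 kl by linarith+
  ultimately show ?thesis using feasible_yD[OF f, of "n - l - 1" "n - 3" t] t U_U2
    by (simp add: V2_def w'_def)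
qed

text \<open>Both chords ending in the corner \<open>(U2, V2)\<close> lie below the line of slope \<open>- V / U\<close> through
  the point \<open>(1, V - w)\<close>.\<close>

lemma sum_bound:
  assumes f: "feasible z y" and z: "1 \<le> z" and y: "1 \<le> y"
  shows "V * z + U * y \<le> U * V - U * w + V"
proof (cases "z \<le> U2")
  case True
  then obtain t where t: "0 \<le> t" "t \<le> 1" "z = (1 - t) + t * U2" using convex_weight z by blast
  then have "U * y \<le> U * (V - ((1 - t) * w + t * (V - V2)))"
    using feasible_z_corner[OF f] pos by (intro mult_left_mono) auto
  then have "V * z + U * y \<le> (1 - t) * (U * V - U * w + V) + t * (V * U2 + U * V2)"
    unfolding t(3) by (simp add: algebra_simps)
  also have "\<dots> \<le> (1 - t) * (U * V - U * w + V) + t * (U * V - U * w + V)"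
    using corner t by (intro add_left_mono mult_left_mono) auto
  finally show ?thesis by (simp add: algebra_simps)
next
  case False
  have "y \<le> V2"
  proof (rule ccontr)
    assume "\<not> y \<le> V2"
    then show False using feasible_y_corner[OF f, of 1] False by simp
  qed
  then obtain t where t: "0 \<le> t" "t \<le> 1" "y = (1 - t) + t * V2" using convex_weight y by blast
  then have "V * z \<le> V * (U - ((1 - t) * w' + t * (U - U2)))"
    using feasible_y_corner[OF f] pos by (intro mult_left_mono) auto
  then have "V * z + U * y \<le> (1 - t) * (U * V - V * w' + U) + t * (V * U2 + U * V2)"
    unfolding t(3) by (simp add: algebra_simps)
  also have "\<dots> \<le> (1 - t) * (U * V - U * w + V) + t * (U * V - U * w + V)"
  proof -
    \<comment> \<open>By \<open>wU\<close> the left end \<open>(U - w', 1)\<close> of this chord has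
      value \<open>U * V - U * w + U\<close>, which is within the bound because
      \<open>U \<le> V\<close>.\<close>
    have "U * V - V * w' + U \<le> U * V - U * w + V" using wU UV by (simp add: mult.commute)
    from mult_left_mono[OF this, of "1 - t"] mult_left_mono[OF corner t(1)] t
    show ?thesis by linarith
  qed
  finally show ?thesis by (simp add: algebra_simps)
qed

end

section \<open>Pairs in which a family exceeds a full star\<close>

text \<open>In slack variables for the hypotheses all coefficients are positive.\<close>

lemma cubic_poly_nonneg:
  fixes K m :: real
  assumes "2 \<le> K" "K + 1 \<le> m"
  shows "0 \<le> ((K+m)^2-1)*m*(m-2*K)^2 + ((K+m)^2-1)*(K*(K-1)*(K-2)-m*(3*m-2)) + (14*(K+m)-10)*K*m*(m-1)"
    (is "0 \<le> ?g K m")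
proof (cases "2 * K \<le> m")
  case True
  define x v where "x = K - 2" and "v = m - 2 * K"
  have xv: "0 \<le> x" "0 \<le> v" "K = 2 + x" "m = 2 * (2 + x) + v" using assms True by (auto simp: x_def v_def)
  have "?g (2 + x) (2 * (2 + x) + v) = 6*v*x^4 + 19*v^2*x^3 + 21*v^3*x^2 + 8*v^4*x + v^5 + 9*x^5 + 74*v*x^3 + 98*v^2*x^2 + 68*v^3*x +
      13*v^4 + 123*x^4 + 244*v*x^2 + 156*v^2*x + 53*v^3 + 553*x^3 + 302*v*x + 75*v^2 + 1121*x^2 + 122*v +
      1058*x + 376"
    by algebra
  also have "0 \<le> \<dots>" using xv(1,2) by (intro add_nonneg_nonneg mult_nonneg_nonneg zero_le_power) auto
  finally show ?thesis unfolding xv(3,4) .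
next
  case False
  define a b where "a = m - K - 1" and "b = 2 * K - m"
  have ab: "0 \<le> a" "0 \<le> b" "K = a + b + 1" "m = 2 * a + b + 2" using assms False by (auto simp: a_def b_def)
  have "?g (a + b + 1) (2 * a + b + 2) = 44*a*b^4 + 90*a^2*b^3 + 85*a^3*b^2 + 39*a^4*b + 9*a^5 + 8*b^5 + 218*a*b^3 + 359*a^2*b^2 + 262*a^3*b
      + 78*a^4 + 48*b^4 + 354*a*b^2 + 395*a^2*b + 151*a^3 + 104*b^3 + 208*a*b + 110*a^2 + 96*b^2 + 28*a +
      32*b"
    by algebra
  also have "0 \<le> \<dots>" using ab(1,2) by (intro add_nonneg_nonneg mult_nonneg_nonneg zero_le_power) auto
  finally show ?thesis unfolding ab(3,4) .
qed

lemma chain_poly: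
  fixes K m M N :: real
  assumes K: "2 \<le> K" "K + 1 \<le> m" and N: "N = K + m" and M: "N + 1 \<le> 2 * M"
  shows "(N^2+N*M+M^2-3*N-3*M+2) * (K*m*(m-1)) \<le> M*(M-1) * (N*(N-1)*(N-2)+K*(K-1)*m)"
proof -
  have N5: "5 \<le> N" using K N by simp
  \<comment> \<open>Four times the value of the factor \<open>N^2+N*M+M^2-3*N-3*M+2\<close> at
    \<open>M = (N + 1) / 2\<close>, where \<open>M * (M - 1)\<close> equals
    \<open>(N^2 - 1) / 4\<close>. This is the worst case for \<open>M\<close>; comparing with it
    eliminates \<open>M\<close>.\<close>
  define T where "T = 7*N^2-14*N+3"
  have pN: "0 < N^2 - 1" using N5 by (simp add: one_less_power)
  have A: "(N^2+N*M+M^2-3*N-3*M+2) * (N^2-1) \<le> T * (M*(M-1))"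
  proof -
    define d where "d = 2*M-N-1"
    have d: "0 \<le> d" "M = (N+1+d)/2" using M by (auto simp: d_def)
    define x where "x = N - 5"
    have x: "0 \<le> x" "N = 5 + x" using N5 by (auto simp: x_def)
    have "2*N*T-(4*N-4)*(N^2-1) = 10*x^3+126*x^2+520*x+696" unfolding x(2) T_def by algebra
    then have 1: "0 \<le> 2*N*T-(4*N-4)*(N^2-1)" using x(1) by simp
    have "T-(N^2-1) = 6*x^2+46*x+84" unfolding x(2) T_def by algebra
    moreover have "0 \<le> 6*x^2+46*x+84" using x(1) by (intro add_nonneg_nonneg) auto
    ultimately have 2: "0 \<le> T-(N^2-1)" by simp
    have "4*(T * (M*(M-1)) - (N^2+N*M+M^2-3*N-3*M+2) * (N^2-1))
      = d*(2*N*T-(4*N-4)*(N^2-1)) + d^2*(T-(N^2-1))"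
      unfolding d(2) T_def by (simp add: field_simps power2_eq_square)
    also have "\<dots> \<ge> 0" using 1 2 d(1) by simp
    finally show ?thesis by simp
  qed
  have B: "T * (K*m*(m-1)) \<le> (N^2-1) * (N*(N-1)*(N-2)+K*(K-1)*m)"
  proof -
    have "(N^2-1) * (N*(N-1)*(N-2)+K*(K-1)*m) - T * (K*m*(m-1))
      = ((K+m)^2-1)*m*(m-2*K)^2 + ((K+m)^2-1)*(K*(K-1)*(K-2)-m*(3*m-2)) + (14*(K+m)-10)*K*m*(m-1)"
      unfolding T_def N by algebra
    then show ?thesis using cubic_poly_nonneg[OF K] by simp
  qed
  have "(N^2-1) * ((N^2+N*M+M^2-3*N-3*M+2) * (K*m*(m-1)))
     = ((N^2+N*M+M^2-3*N-3*M+2) * (N^2-1)) * (K*m*(m-1))" by simp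
  also have "\<dots> \<le> (T * (M*(M-1))) * (K*m*(m-1))"
    using A K by (intro mult_right_mono) auto
  also have "\<dots> = (M*(M-1)) * (T * (K*m*(m-1)))" by simp
  also have "\<dots> \<le> (M*(M-1)) * ((N^2-1) * (N*(N-1)*(N-2)+K*(K-1)*m))"
    using B M N5 by (intro mult_left_mono) auto
  also have "\<dots> = (N^2-1) * (M*(M-1) * (N*(N-1)*(N-2)+K*(K-1)*m))" by simp
  finally show ?thesis by (rule mult_left_le_imp_le) (rule pN)
qed

text \<open>The numerators of the two endpoint estimates \<open>F0\<close> and \<open>F1\<close> in
  \<open>mixed_bound\<close>. Substituting the slack of each hypothesis leaves only positive
  coefficients; the two alternatives correspond to \<open>k < l\<close> and
  \<open>k = l\<close>.\<close>

lemma mix_poly_nonneg: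
  fixes K L N M m :: real
  assumes KL: "(1 \<le> K \<and> K + 1 \<le> L \<and> 2*L+1 \<le> N) \<or> (2 \<le> K \<and> K = L \<and> 2*L+2 \<le> N)"
    and M: "M = N - L" and m: "m = N - K"
  shows "0 \<le> N*M*((N-1)*(N-2)-L*(L-1)) - L*m*((N-1)*(N-2)-(m-1)*(m-2)) - L*(L-1)*m*M - 2*M*(N+m)"
    "0 \<le> N*L*(M-1)*M*(N-1) + L*m*(N-1)*((m-1)*(m-2)-L*(N-2)) - L*L*(L-1)*m*M - 2*M*(N*(N-1)+2*K*m)"
proof -
  have "0 \<le> N*M*((N-1)*(N-2)-L*(L-1)) - L*m*((N-1)*(N-2)-(m-1)*(m-2)) - L*(L-1)*m*M - 2*M*(N+m) \<and>
    0 \<le> N*L*(M-1)*M*(N-1) + L*m*(N-1)*((m-1)*(m-2)-L*(N-2)) - L*L*(L-1)*m*M - 2*M*(N*(N-1)+2*K*m)"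
    using KL
  proof
    assume h: "1 \<le> K \<and> K + 1 \<le> L \<and> 2*L+1 \<le> N"
    define a b c where "a = K - 1" and "b = L - K - 1" and "c = N - 2*L - 1"
    have abc: "0 \<le> a" "0 \<le> b" "0 \<le> c" "K = a + 1" "L = a + b + 2" "N = 2*a+2*b+c+5" "M = a+b+c+3" "m = a+2*b+c+4"
      using h M m by (auto simp: a_def b_def c_def)
    have "N*M*((N-1)*(N-2)-L*(L-1)) - L*m*((N-1)*(N-2)-(m-1)*(m-2)) - L*(L-1)*m*M - 2*M*(N+m) = 30*a*b*c^2 + 35*a*b^2*c + 9*a*b^3 + 7*a*c^3 + 31*a^2*b*c + 9*a^2*b^2 + 14*a^2*c^2 + 6*a^3*b +
      10*a^3*c + 2*a^4 + 7*b*c^3 + 16*b^2*c^2 + 14*b^3*c + 4*b^4 + c^4 + 158*a*b*c + 61*a*b^2 + 66*a*c^2 +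
      50*a^2*b + 73*a^2*c + 18*a^3 + 70*b*c^2 + 91*b^2*c + 31*b^3 + 15*c^3 + 131*a*b + 168*a*c + 61*a^2 +
      186*b*c + 88*b^2 + 71*c^2 + 81*a + 97*b + 113*c + 24"
      unfolding abc(4-) by algebra
    also have "0 \<le> \<dots>" using abc(1-3) by (intro add_nonneg_nonneg mult_nonneg_nonneg zero_le_power) auto
    finally have 1: "0 \<le> N*M*((N-1)*(N-2)-L*(L-1)) - L*m*((N-1)*(N-2)-(m-1)*(m-2)) - L*(L-1)*m*M - 2*M*(N+m)" .
    have "N*L*(M-1)*M*(N-1) + L*m*(N-1)*((m-1)*(m-2)-L*(N-2)) - L*L*(L-1)*m*M - 2*M*(N*(N-1)+2*K*m) = 23*a*b*c^3 + 73*a*b^2*c^2 + 85*a*b^3*c + 31*a*b^4 + 2*a*c^4 + 59*a^2*b*c^2 + 93*a^2*b^2*c +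
      36*a^2*b^3 + 10*a^2*c^3 + 46*a^3*b*c + 20*a^3*b^2 + 16*a^3*c^2 + 6*a^4*b + 9*a^4*c + a^5 + 2*b*c^4 +
      13*b^2*c^3 + 30*b^3*c^2 + 29*b^4*c + 10*b^5 + 284*a*b*c^2 + 481*a*b^2*c + 214*a*b^3 + 45*a*c^3 +
      362*a^2*b*c + 192*a^2*b^2 + 117*a^2*c^2 + 78*a^3*b + 94*a^3*c + 14*a^4 + 51*b*c^3 + 173*b^2*c^2 +
      215*b^3*c + 86*b^4 + 4*c^4 + 882*a*b*c + 539*a*b^2 + 265*a*c^2 + 326*a^2*b + 338*a^2*c + 71*a^3 +
      325*b*c^2 + 590*b^2*c + 292*b^3 + 48*c^3 + 536*a*b + 494*a*c + 152*a^2 + 682*b*c + 468*b^2 + 190*c^2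
      + 124*a + 308*b + 254*c + 24"
      unfolding abc(4-) by algebra
    also have "0 \<le> \<dots>" using abc(1-3) by (intro add_nonneg_nonneg mult_nonneg_nonneg zero_le_power) auto
    finally show ?thesis using 1 by simp
  next
    assume h: "2 \<le> K \<and> K = L \<and> 2*L+2 \<le> N"
    define a c where "a = K - 2" and "c = N - 2*L - 2"
    have abc: "0 \<le> a" "0 \<le> c" "K = a + 2" "L = a + 2" "N = 2*a+c+6" "M = a+c+4" "m = a+c+4"
      using h M m by (auto simp: a_def c_def)
    have "N*M*((N-1)*(N-2)-L*(L-1)) - L*m*((N-1)*(N-2)-(m-1)*(m-2)) - L*(L-1)*m*M - 2*M*(N+m) = 7*a*c^3 + 14*a^2*c^2 + 10*a^3*c + 2*a^4 + c^4 + 85*a*c^2 + 100*a^2*c + 30*a^3 + 19*c^3 + 308*a*c +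
      154*a^2 + 118*c^2 + 316*a + 284*c + 208"
      unfolding abc(3-) by algebra
    also have "0 \<le> \<dots>" using abc(1-2) by (intro add_nonneg_nonneg mult_nonneg_nonneg zero_le_power) auto
    finally have 1: "0 \<le> N*M*((N-1)*(N-2)-L*(L-1)) - L*m*((N-1)*(N-2)-(m-1)*(m-2)) - L*(L-1)*m*M - 2*M*(N+m)" .
    have "N*L*(M-1)*M*(N-1) + L*m*(N-1)*((m-1)*(m-2)-L*(N-2)) - L*L*(L-1)*m*M - 2*M*(N*(N-1)+2*K*m) = 2*a*c^4 + 10*a^2*c^3 + 16*a^3*c^2 + 9*a^4*c + a^5 + 50*a*c^3 + 136*a^2*c^2 + 116*a^3*c + 22*a^4 +
      4*c^4 + 356*a*c^2 + 509*a^2*c + 155*a^3 + 58*c^3 + 896*a*c + 462*a^2 + 286*c^2 + 572*a + 524*c + 208"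
      unfolding abc(3-) by algebra
    also have "0 \<le> \<dots>" using abc(1-2) by (intro add_nonneg_nonneg mult_nonneg_nonneg zero_le_power) auto
    finally show ?thesis using 1 by simp
  qed
  then show "0 \<le> N*M*((N-1)*(N-2)-L*(L-1)) - L*m*((N-1)*(N-2)-(m-1)*(m-2)) - L*(L-1)*m*M - 2*M*(N+m)"
    "0 \<le> N*L*(M-1)*M*(N-1) + L*m*(N-1)*((m-1)*(m-2)-L*(N-2)) - L*L*(L-1)*m*M - 2*M*(N*(N-1)+2*K*m)" by blast+
qed

section \<open>Small excess of the first family over a full star\<close>

context sizes
begin

lemma PQ_ratio_base:
  assumes "3 < k"
  shows "Q * real ((n - 5) choose (k - 3)) \<le> P * real ((n - 5) choose (l - 2))"
proof -
  have e: "n - 4 - 1 = n - 5" "k - 2 - 1 = k - 3" by auto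
  have 1: "(N - 3) * real ((n - 5) choose (k - 3)) = (K - 1) * real ((n - 4) choose (k - 2))"
    using binomial_diag[of "k - 2" "n - 4"] assms nk unfolding e by (simp add: N_def K_def of_nat_diff)
  have 2: "(N - 3) * real ((n - 5) choose (l - 2)) = (N - L - 2) * real ((n - 4) choose (l - 2))"
    using binomial_down[of "l - 2" "n - 4"] assms nkl kl unfolding e by (simp add: N_def L_def of_nat_diff)
  have p: "0 < N - 3" "0 < N - 1" "0 < N - 2" "0 < N - K" "0 < N - L" using KLN assms by (auto simp: K_def)
  define X where "X = (N - 1) * (N - 2) * (N - 3) * (N - K) * (N - L)"
  have X: "0 < X" using p by (simp add: X_def)
  have "X * (Q * real ((n - 5) choose (k - 3)))
    = (N - K) * ((N - L) * Q) * ((N - 1) * (N - 2) * ((N - 3) * real ((n - 5) choose (k - 3))))"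
    by (simp add: X_def)
  also have "\<dots> = (N - K) * (N * V) * ((K - 1) * ((N - 1) * (N - 2) * real ((n - 4) choose (k - 2))))"
    unfolding 1 QV by simp
  also have "\<dots> = (N * U * V) * ((K - 1) * (N - K) * (K * (N - K - 1)))"
    unfolding link_link_sizes(1) by simp
  also have "\<dots> \<le> (N * U * V) * ((N - L - 2) * (N - L) * (L * (N - L - 1)))"
  proof -
    have "0 \<le> (L - K) * (N + 1 - L - K - 2) + (N - L - 1 - L) * (N - L)"
      using KLN by (intro add_nonneg_nonneg mult_nonneg_nonneg) auto
    moreover have "(N - L - 2) * (N - L) - (K - 1) * (N - K) =
      (L - K) * (N + 1 - L - K) + (N - L - 1 - L) * (N - L)" by (simp add: algebra_simps)
    moreover have "(L - K) * (N + 1 - L - K - 2) \<le> (L - K) * (N + 1 - L - K)" using KLN by (intro mult_left_mono) auto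
    ultimately have 1: "(K - 1) * (N - K) \<le> (N - L - 2) * (N - L)" by linarith
    have "0 \<le> N - L - 2" using KLN assms by (simp add: K_def)
    then have "0 \<le> N * U * V" "0 \<le> K * (N - K - 1)" "0 \<le> (N - L - 2) * (N - L)" using pos KLN by auto
    then show ?thesis using mult_mono[OF 1 KL_mono] by (intro mult_left_mono) auto
  qed
  also have "\<dots> = (N - L) * (N * U) * ((N - L - 2) * ((N - 1) * (N - 2) * real ((n - 4) choose (l - 2))))"
    unfolding link_link_sizes(2) by simp
  also have "\<dots> = (N - L) * ((N - K) * P) * ((N - 1) * (N - 2) * ((N - 3) * real ((n - 5) choose (l - 2))))"
    unfolding 2 PU by simp
  also have "\<dots> = X * (P * real ((n - 5) choose (l - 2)))" by (simp add: X_def)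
  finally show ?thesis using X by (rule mult_left_le_imp_le)
qed

lemma PQ_ratio:
  assumes "3 \<le> s" "s < k"
  shows "Q * real ((n - 2 - s) choose (k - s)) \<le> P * real ((n - 2 - s) choose (l - 2))"
  using assms
proof (induction s rule: dec_induct)
  case base
  then show ?case using PQ_ratio_base by simp
next
  case (step s)
  then show ?case using binomial_ratio_step[of s k P l n Q] pos nkl kl k2 by simp
qed

text \<open>At \<open>s = 2\<close> the inequality of \<open>PQ_ratio\<close> with plain
  \<open>Q\<close> and \<open>P\<close> can fail, for example for \<open>k = 3\<close>,
  \<open>l = 4\<close>, \<open>n = 8\<close>. The corrections to \<open>Q\<close> and
  \<open>P\<close> have to be kept, which is what makes \<open>chain_poly\<close> necessary.\<close>

lemma chain_slope_base:
  assumes "3 \<le> k"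
  shows "(Q - real ((n - 4) choose (l - 1))) * real ((n - 4) choose (k - 2))
    \<le> (P + real ((n - 4) choose (k - 3))) * real ((n - 4) choose (l - 2))"
proof -
  define m M D where "m = N - K" and "M = N - L" and "D = (N - 1) * (N - 2)"
  have e: "n - 3 - 1 = n - 4" "k - 2 - 1 = k - 3" by auto
  have "(N - 2) * real ((n - 4) choose (l - 1)) = (N - L - 2) * (V - V2)"
    using binomial_down[of "l - 1" "n - 3"] nkl k2 kl unfolding e V_V2 by (simp add: N_def L_def of_nat_diff)
  then have "D * real ((n - 4) choose (l - 1)) = (N - 1) * ((N - L - 2) * (V - V2))"
    by (simp add: D_def)
  also have "\<dots> = (N - L - 2) * ((N - 1) * V - (N - 1) * V2)"
    by (simp add: algebra_simps)
  finally have "D * real ((n - 4) choose (l - 1)) = (N - L - 2) * ((N - 1) * V - (N - 1) * V2)" .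
  also have "\<dots> = (M - 1) * (M - 2) * V" unfolding V2 by (simp add: M_def algebra_simps)
  finally have w3: "D * real ((n - 4) choose (l - 1)) = (M - 1) * (M - 2) * V" .
  have "(N - 2) * real ((n - 4) choose (k - 3)) = (K - 1) * U2"
    using binomial_diag[of "k - 2" "n - 3"] nkl assms unfolding e U2_def by (simp add: N_def K_def of_nat_diff)
  then have "D * real ((n - 4) choose (k - 3)) = (K - 1) * ((N - 1) * U2)"
    by (simp add: D_def)
  then have u3: "D * real ((n - 4) choose (k - 3)) = K * (K - 1) * U" unfolding U2 by simp
  have K: "2 \<le> K" "K + 1 \<le> m" "N = K + m" "N + 1 \<le> 2 * M" "L = N - M" "m > 0" "M > 0" "D > 0"
    using KLN assms by (auto simp: m_def M_def K_def D_def)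
  have p: "m * P = N * U" "M * Q = N * V" using PU QV by (auto simp: m_def M_def)
  have f: "D * real ((n - 4) choose (k - 2)) = K * (m - 1) * U" "D * real ((n - 4) choose (l - 2)) = L * (M - 1) * V"
    using link_link_sizes by (auto simp: m_def M_def D_def)
  have DN: "N * D - M * (M - 1) * (M - 2) = L * (N^2+N*M+M^2-3*N-3*M+2)"
    unfolding D_def K(5) by algebra
  have "(D * D * (m * M)) * ((Q - real ((n - 4) choose (l - 1))) * real ((n - 4) choose (k - 2)))
    = m * (D * (M * Q) - M * (D * real ((n - 4) choose (l - 1)))) * (D * real ((n - 4) choose (k - 2)))"
    by (simp add: algebra_simps)
  also have "\<dots> = (U * V * L) * ((N^2+N*M+M^2-3*N-3*M+2) * (K * m * (m - 1)))"
  proof -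
    have "m * (D * (N * V) - M * ((M - 1) * (M - 2) * V)) * (K * (m - 1) * U)
      = U * V * ((N * D - M * (M - 1) * (M - 2)) * (K * m * (m - 1)))" by (simp add: algebra_simps)
    then show ?thesis unfolding f w3 p DN by simp
  qed
  also have "\<dots> \<le> (U * V * L) * (M*(M-1) * (N*(N-1)*(N-2)+K*(K-1)*m))"
    using chain_poly[OF K(1-4)] pos KLN by (intro mult_left_mono) auto
  also have "\<dots> = M * (D * (m * P) + m * (D * real ((n - 4) choose (k - 3)))) * (D * real ((n - 4) choose (l - 2)))"
    unfolding f u3 p by (simp add: D_def algebra_simps)
  also have "\<dots> = (D * D * (m * M)) * ((P + real ((n - 4) choose (k - 3))) * real ((n - 4) choose (l - 2)))"
    by (simp add: algebra_simps)
  finally show ?thesis by (rule mult_left_le_imp_le) (use K in simp)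
qed

text \<open>The sign of the derivative of the product at the left end of one edge: along the edge
  the first size grows by \<open>(n - 2 - s) choose (k - s)\<close> while the second falls by
  \<open>(n - 2 - s) choose (l - 2)\<close>. The product is a concave quadratic on the edge, so it
  decreases on all of it.\<close>

lemma chain_slope:
  assumes "2 \<le> s" "s < k"
  shows "(Q - real ((n - 2 - s) choose (l - 1))) * real ((n - 2 - s) choose (k - s))
    \<le> (P + real ((n - 2 - s) choose (k - Suc s))) * real ((n - 2 - s) choose (l - 2))"
proof (cases "s = 2")
  case True
  then show ?thesis using chain_slope_base assms by (simp add: numeral_3_eq_3[symmetric])
next
  case False
  have "(Q - real ((n - 2 - s) choose (l - 1))) * real ((n - 2 - s) choose (k - s))
    \<le> Q * real ((n - 2 - s) choose (k - s))" by (intro mult_right_mono) auto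
  also have "\<dots> \<le> P * real ((n - 2 - s) choose (l - 2))" using PQ_ratio assms False by simp
  also have "\<dots> \<le> (P + real ((n - 2 - s) choose (k - Suc s))) * real ((n - 2 - s) choose (l - 2))"
    by (intro mult_right_mono) auto
  finally show ?thesis .
qed

text \<open>The induction walks along the boundary vertices from \<open>s = k\<close>, where the
  excess is 1 and the product is \<open>hm\<close>, down to \<open>s = 2\<close>. Since the product
  falls strictly on every edge, the value \<open>hm\<close> is possible only with excess exactly
  1.\<close>

lemma small_excess_aux:
  assumes "2 \<le> s" "s \<le> k"
  shows "(P + real ((n - 1 - s) choose (k - s))) * (Q - real ((n - 1 - s) choose (l - 1))) \<le> hm \<and>
    (\<forall>z y. feasible z y \<longrightarrow> 1 \<le> z \<longrightarrow> z \<le> real ((n - 1 - s) choose (k - s)) \<longrightarrow>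
       (P + z) * (Q - V + y) \<le> hm \<and> (1 < z \<longrightarrow> (P + z) * (Q - V + y) < hm))"
  using assms(2,1)
proof (induction s rule: inc_induct)
  case base
  have e: "n - 1 - k = n - k - 1" by simp
  have "(P + z) * (Q - V + y) \<le> hm" if f: "feasible z y" "1 \<le> z" "z \<le> 1" for z y
  proof -
    have "y \<le> V - w" using feasible_z_corner[OF f(1), of 0] f by simp
    then have "(P + 1) * (Q - V + y) \<le> hm" using pos by (intro mult_left_mono) auto
    then show ?thesis using f by simp
  qed
  then show ?case unfolding e by (auto simp: w_def)
next
  case (step s)
  define u where "u = real ((n - 2 - s) choose (k - Suc s))"
  define \<Delta> where "\<Delta> = real ((n - 2 - s) choose (k - s))"
  define B where "B = Q - real ((n - 2 - s) choose (l - 1))"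
  define \<beta> where "\<beta> = real ((n - 2 - s) choose (l - 2))"
  have e: "n - 1 - Suc s = n - 2 - s" by simp
  have u1: "real ((n - 1 - s) choose (k - s)) = u + \<Delta>" "Q - real ((n - 1 - s) choose (l - 1)) = B - \<beta>"
    using chain_pascal[of s] step.hyps by (auto simp: u_def \<Delta>_def B_def \<beta>_def)
  have IH: "(P + u) * B \<le> hm"
    "\<And>z y. feasible z y \<Longrightarrow> 1 \<le> z \<Longrightarrow> z \<le> u \<Longrightarrow>
      (P + z) * (Q - V + y) \<le> hm \<and> (1 < z \<longrightarrow> (P + z) * (Q - V + y) < hm)"
    using step.IH step.prems unfolding e u_def B_def by auto
  have slope: "B * \<Delta> \<le> (P + u) * \<beta>"
    using chain_slope[of s] step by (simp add: u_def \<Delta>_def B_def \<beta>_def)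
  have "k - s \<le> n - 2 - s" "l - 2 \<le> n - 2 - s" "k - Suc s \<le> n - 2 - s" using step.hyps nkl k2 kl by linarith+
  then have \<Delta>: "0 < \<Delta>" "0 < \<beta>" and u0: "1 \<le> u" unfolding \<Delta>_def \<beta>_def u_def
    by (simp_all add: Suc_le_eq del: diff_diff_left)
  have prod: "(P + u + t * \<Delta>) * (B - t * \<beta>) < hm" if t: "0 < t" for t
  proof -
    have "(P + u + t * \<Delta>) * (B - t * \<beta>) = (P + u) * B + t * (B * \<Delta> - (P + u) * \<beta>) - t * t * (\<Delta> * \<beta>)"
      by (simp add: algebra_simps)
    moreover have "t * (B * \<Delta> - (P + u) * \<beta>) \<le> 0" using slope t by (simp add: mult_nonneg_nonpos)
    moreover have "0 < t * t * (\<Delta> * \<beta>)" using t \<Delta> by simp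
    ultimately show ?thesis using IH(1) by linarith
  qed
  have "(P + z) * (Q - V + y) < hm" if f: "feasible z y" "u < z" "z \<le> u + \<Delta>" for z y
  proof -
    define t where "t = (z - u) / \<Delta>"
    have t: "0 < t" "t \<le> 1" "z = u + t * \<Delta>" using f \<Delta> by (auto simp: t_def field_simps)
    have s1: "(n - 2 - s) choose (n - k - 1) = (n - 2 - s) choose (k - Suc s)"
      "(n - 1 - s) choose (n - k - 1) = (n - 1 - s) choose (k - s)"
    proof -
      have e: "n - 2 - s - (k - Suc s) = n - k - 1" "n - 1 - s - (k - s) = n - k - 1" using step.hyps by auto
      show "(n - 2 - s) choose (n - k - 1) = (n - 2 - s) choose (k - Suc s)"
        "(n - 1 - s) choose (n - k - 1) = (n - 1 - s) choose (k - s)"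
        using binomial_symmetric[of "k - Suc s" "n - 2 - s"] binomial_symmetric[of "k - s" "n - 1 - s"] nkl
        unfolding e by auto
    qed
    have "y \<le> V - ((1 - t) * real ((n - 2 - s) choose (l - 1)) + t * real ((n - 1 - s) choose (l - 1)))"
    proof (rule feasible_zD[OF f(1)])
      show "(1 - t) * real ((n - 2 - s) choose (n - k - 1)) + t * real ((n - 1 - s) choose (n - k - 1)) \<le> z"
        unfolding s1 u1 u_def[symmetric] t(3) by (simp add: algebra_simps)
    qed (use step t in \<open>(linarith | auto)+\<close>)
    also have "\<dots> = V - (Q - (B - t * \<beta>))"
    proof -
      have 1: "real ((n - 1 - s) choose (l - 1)) = Q - (B - \<beta>)" "real ((n - 2 - s) choose (l - 1)) = Q - B"
        using u1(2) by (simp_all add: B_def)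
      show ?thesis unfolding 1 by (simp add: algebra_simps)
    qed
    finally have "Q - V + y \<le> B - t * \<beta>" by simp
    then have "(P + z) * (Q - V + y) \<le> (P + z) * (B - t * \<beta>)"
      using pos f u0 by (intro mult_left_mono) auto
    also have "\<dots> < hm" using prod[OF t(1)] t(3) by (simp add: add.assoc)
    finally show ?thesis .
  qed
  then show ?case unfolding u1
    using IH(2) prod[of 1] by (smt (verit, best) mult_1)
qed

lemma small_excess:
  assumes "feasible z y" "1 \<le> z" "z \<le> U2"
  shows "(P + z) * (Q - V + y) \<le> hm" "1 < z \<Longrightarrow> (P + z) * (Q - V + y) < hm"
proof -
  have "n - 1 - 2 = n - 3" by simp
  then show "(P + z) * (Q - V + y) \<le> hm" "1 < z \<Longrightarrow> (P + z) * (Q - V + y) < hm"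
    using small_excess_aux[of 2] k2 assms by (auto simp: U2_def)
qed

lemma corner_hm: "(P + U2) * (Q - V + V2) \<le> hm"
proof -
  have "n - 1 - 2 = n - 3" by simp
  then have "(P + U2) * (Q - (V - V2)) \<le> hm" using small_excess_aux[of 2] k2 V_V2 by (simp add: U2_def)
  moreover have "Q - V + V2 = Q - (V - V2)" by simp
  ultimately show ?thesis by (simp only:)
qed

end

section \<open>Large excess of the first family over a full star\<close>

lemma slope_poly:
  fixes K m M N :: real
  assumes K: "1 \<le> K" "K + 1 \<le> m" and N: "N = K + m" and M: "N + 1 \<le> 2 * M"
  shows "K*m*(m-1)*(N+M-1) \<le> M*(M-1) * (N*(N-1)+K*m)"
proof -
  have N3: "3 \<le> N" using K N by simp
  have pN: "0 < N^2 - 1" using N3 by (simp add: one_less_power)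
  \<comment> \<open>The factor \<open>2*(3*N-1)\<close> is four times the value of
    \<open>N+M-1\<close> at the worst case \<open>M = (N + 1) / 2\<close>, where
    \<open>M*(M-1)\<close> is \<open>(N^2-1)/4\<close>.\<close>
  have A: "(N+M-1)*(N^2-1) \<le> 2*(3*N-1)*(M*(M-1))"
  proof -
    define d where "d = 2*M-N-1"
    have d: "0 \<le> d" "M = (N+1+d)/2" using M by (auto simp: d_def)
    define x where "x = N - 3"
    have x: "0 \<le> x" "N = 3 + x" using N3 by (auto simp: x_def)
    have "2*(3*N-1)*N - (N^2-1) = 5*x^2+28*x+40" unfolding x(2) by algebra
    moreover have "0 \<le> 5*x^2+28*x+40" using x(1) by (intro add_nonneg_nonneg) auto
    ultimately have 1: "0 \<le> 2*(3*N-1)*N - (N^2-1)" by simp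
    have "4*(2*(3*N-1)*(M*(M-1)) - (N+M-1)*(N^2-1)) = 2*d*(2*(3*N-1)*N - (N^2-1)) + 2*(3*N-1)*d^2"
      unfolding d(2) by (simp add: field_simps power2_eq_square)
    also have "\<dots> \<ge> 0" using 1 d(1) N3 by simp
    finally show ?thesis by simp
  qed
  have B: "2*(3*N-1)*(K*m*(m-1)) \<le> (N^2-1)*(N*(N-1)+K*m)"
  proof -
    define x v where "x = K - 1" and "v = m - K - 1"
    have xv: "0 \<le> x" "0 \<le> v" "K = 1 + x" "m = 2 + x + v" "N = 3 + 2*x + v" using K N by (auto simp: x_def v_def)
    have "(N^2-1)*(N*(N-1)+K*m) - 2*(3*N-1)*(K*m*(m-1)) = 10*v*x^3 + 5*v^2*x^2 + 3*v^3*x + v^4 + 8*x^4 + 50*v*x^2 + 21*v^2*x + 6*v^3 + 48*x^3 + 76*v*x + 18*v^2 + 104*x^2 + 36*v + 96*x + 32"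
      unfolding xv(3-) by algebra
    also have "0 \<le> \<dots>" using xv(1,2) by (intro add_nonneg_nonneg mult_nonneg_nonneg zero_le_power) auto
    finally show ?thesis by simp
  qed
  have "(N^2-1) * (K*m*(m-1)*(N+M-1)) = ((N+M-1)*(N^2-1)) * (K*m*(m-1))" by simp
  also have "\<dots> \<le> (2*(3*N-1)*(M*(M-1))) * (K*m*(m-1))"
    using A K by (intro mult_right_mono) auto
  also have "\<dots> = (M*(M-1)) * (2*(3*N-1)*(K*m*(m-1)))" by simp
  also have "\<dots> \<le> (M*(M-1)) * ((N^2-1)*(N*(N-1)+K*m))"
    using B M N3 by (intro mult_left_mono) auto
  also have "\<dots> = (N^2-1) * (M*(M-1) * (N*(N-1)+K*m))" by simp
  finally show ?thesis by (rule mult_left_le_imp_le) (rule pN)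
qed

lemma nonneg_of_mult_pos: "0 \<le> a * b \<Longrightarrow> 0 < a \<Longrightarrow> 0 \<le> (b::real)"
  by (auto simp: zero_le_mult_iff)

context sizes
begin

text \<open>\<open>(U - C4, V3)\<close> is the boundary vertex that follows \<open>(U2, V2)\<close>
  when the second family is the one whose shadow is estimated.\<close>

definition "C4 = real ((n - 4) choose (k - 1))"
definition "V3 = real ((n - 4) choose (l - 3))"

lemma C4: "(N - 1) * (N - 2) * C4 = (N - K - 1) * (N - K - 2) * U"
proof -
  have e: "n - 3 - 1 = n - 4" by simp
  have "(N - 2) * C4 = (N - K - 2) * (U - U2)"
    using binomial_down[of "k - 1" "n - 3"] nkl k2 kl unfolding e U_U2 C4_def
    by (simp add: N_def K_def of_nat_diff)
  then have "(N - 1) * ((N - 2) * C4) = (N - 1) * ((N - K - 2) * (U - U2))" by simp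
  also have "\<dots> = (N - K - 2) * ((N - 1) * U - (N - 1) * U2)" by (simp add: algebra_simps)
  also have "\<dots> = (N - K - 1) * (N - K - 2) * U" unfolding U2 by (simp add: algebra_simps)
  finally show ?thesis by simp
qed

lemma C4_step: "U - U2 = C4 + real ((n - 4) choose (k - 2))"
proof -
  have e: "n - 3 - 1 = n - 4" "k - 1 - 1 = k - 2" by auto
  show ?thesis using choose_reduce_nat[of "n - 3" "k - 1"] k2 nkl kl unfolding e U_U2[symmetric] C4_def by simp
qed

lemma V3: assumes "3 \<le> l"
  shows "(N - 1) * (N - 2) * V3 = L * (L - 1) * V" "V2 = V3 + real ((n - 4) choose (l - 2))"
proof -
  have e: "n - 3 - 1 = n - 4" "l - 2 - 1 = l - 3" by auto
  have "(N - 2) * V3 = (L - 1) * V2"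
    using binomial_diag[of "l - 2" "n - 3"] assms nkl k2 unfolding e V2_def V3_def
    by (simp add: N_def L_def of_nat_diff)
  then have "(N - 1) * (N - 2) * V3 = (L - 1) * ((N - 1) * V2)" by simp
  then show "(N - 1) * (N - 2) * V3 = L * (L - 1) * V" unfolding V2 by simp
  show "V2 = V3 + real ((n - 4) choose (l - 2))"
    using choose_reduce_nat[of "n - 3" "l - 2"] assms nkl k2 unfolding e V2_def V3_def by simp
qed

text \<open>The derivative of the product at the corner \<open>(U2, V2)\<close> towards
  \<open>(U - C4, V3)\<close> is not positive; the two binomial coefficients are the differences of
  the coordinates.\<close>

lemma upper_slope:
  "real ((n - 4) choose (k - 2)) * (Q - V + V2) \<le> (P + U2) * real ((n - 4) choose (l - 2))"
proof -
  define m M D where "m = N - K" and "M = N - L" and "D = (N - 1) * (N - 2)"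
  have K: "1 \<le> K" "K + 1 \<le> m" "N = K + m" "N + 1 \<le> 2 * M" "L = N - M" "m > 0" "M > 0" "D > 0" "N - 1 > 0"
    using KLN by (auto simp: m_def M_def K_def D_def)
  have p: "m * P = N * U" "M * Q = N * V" using PU QV by (auto simp: m_def M_def)
  have f: "D * real ((n - 4) choose (k - 2)) = K * (m - 1) * U" "D * real ((n - 4) choose (l - 2)) = L * (M - 1) * V"
    using link_link_sizes by (auto simp: m_def M_def D_def)
  have "(D * (m * M * (N - 1))) * (real ((n - 4) choose (k - 2)) * (Q - V + V2))
    = (D * real ((n - 4) choose (k - 2))) * m * ((N - 1) * (M * Q) - (N - 1) * (M * V) + M * ((N - 1) * V2))"
    by (simp add: algebra_simps)
  also have "\<dots> = (U * V * L) * (K * m * (m - 1) * (N + M - 1))"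
  proof -
    have "(N - 1) * (N * V) - (N - 1) * (M * V) + M * (L * V) = V * L * (N + M - 1)"
      unfolding K(5) by (simp add: algebra_simps)
    then show ?thesis unfolding f p V2 by (simp only: mult_ac)
  qed
  also have "\<dots> \<le> (U * V * L) * (M*(M-1) * (N*(N-1)+K*m))"
    using slope_poly[OF K(1-4)] pos KLN by (intro mult_left_mono) auto
  also have "\<dots> = M * ((N - 1) * (m * P) + m * ((N - 1) * U2)) * (D * real ((n - 4) choose (l - 2)))"
    unfolding f p U2 by (simp add: algebra_simps)
  also have "\<dots> = (D * (m * M * (N - 1))) * ((P + U2) * real ((n - 4) choose (l - 2)))"
    by (simp add: algebra_simps)
  finally show ?thesis by (rule mult_left_le_imp_le) (use K in simp)
qed

lemma V_ge: assumes "3 \<le> l" shows "(N - 1) * (N - 2) \<le> 2 * V"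
proof -
  have 1: "2 * real ((n - 2) choose 2) = (N - 1) * (N - 2)"
  proof -
    have e: "n - 2 - 1 = n - 3" by simp
    have "2 * real ((n - 2) choose 2) = real (n - 2) * real (n - 3)"
      using binomial_diag[of 2 "n - 2"] unfolding e by simp
    then show ?thesis using nkl k2 kl by (simp add: N_def of_nat_diff)
  qed
  have "(n - 2) choose 2 \<le> (n - 2) choose (l - 1)" using assms nl by (intro binomial_mono) auto
  then have "real ((n - 2) choose 2) \<le> V" by (simp add: V_def)
  then show ?thesis using 1 by simp
qed

text \<open>Along the chord from \<open>(U - w', 1)\<close> to \<open>(U - C4, V3)\<close> the product is \<open>(1 - t) E + t X + (1 - t) t M\<close>
  with end values \<open>E\<close> and \<open>X\<close>; the bound on \<open>M\<close> keeps it below the larger of the two bounds.\<close>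

lemma mixed_bound:
  assumes l: "3 \<le> l"
  shows "(P + U - w') * (Q - V + 1) + (P + U - C4) * (Q - V + V3) + (C4 - w') * (V3 - 1) \<le> hm + star"
proof -
  define m M D where "m = N - K" and "M = N - L" and "D = (N - 1) * (N - 2)"
  have cases: "(1 \<le> K \<and> K + 1 \<le> L \<and> 2*L+1 \<le> N) \<or> (2 \<le> K \<and> K = L \<and> 2*L+2 \<le> N)"
  proof (cases "k = l")
    case True
    have "K = L" "2 \<le> K" unfolding K_def L_def using True l by simp_all
    then show ?thesis using KLN by simp
  next
    case False
    then have "K + 1 \<le> L" using kl by (auto simp: K_def L_def)
    then show ?thesis using KLN by simp
  qed
  have K: "1 \<le> K" "K \<le> L" "1 \<le> m" "1 \<le> M" "D > 0" "N - 1 > 0" "K + 1 \<le> m" "m \<le> N" "2 \<le> N"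
    using KLN by (auto simp: m_def M_def D_def)
  \<comment> \<open>Normalised sizes: \<open>P / U\<close>, \<open>(Q - V) / V\<close>,
    \<open>V2 / V\<close>, \<open>V3 / V\<close>, \<open>C4 / U\<close>, and \<open>w / V\<close>,
    which equals \<open>w' / U\<close> by \<open>wU\<close>.\<close>
  define \<alpha> s q q3 \<tau> \<omega> where "\<alpha> = N / m" and "s = L / M" and "q = L / (N - 1)" and "q3 = L * (L - 1) / D"
    and "\<tau> = (m - 1) * (m - 2) / D" and "\<omega> = w / V"
  have P: "P = \<alpha> * U" using PU K by (simp add: \<alpha>_def m_def field_simps)
  have Qs: "Q - V = s * V"
  proof -
    have "M * (Q - V) = L * V" using QV by (simp add: M_def algebra_simps)
    then show ?thesis using K by (simp add: s_def field_simps)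
  qed
  have V3e: "V3 = q3 * V" using V3(1)[OF l] K by (simp add: q3_def D_def field_simps)
  have C4e: "C4 = \<tau> * U" using C4 K by (simp add: \<tau>_def D_def m_def field_simps)
  have we: "w = \<omega> * V" "w' = \<omega> * U" using wU pos by (simp_all add: \<omega>_def field_simps)
  have "(N - 1) * w \<le> (N - 1) * (V - V2)" using w_le K by (intro mult_left_mono) auto
  also have "\<dots> = (N - 1) * V - L * V" using V2 by (simp add: algebra_simps)
  finally have \<omega>: "0 \<le> \<omega>" "\<omega> \<le> 1 - q" using K pos w_ge by (auto simp: \<omega>_def q_def field_simps)
  \<comment> \<open>\<open>F \<omega>\<close> is the part of the difference of the two sides that is
    bilinear in \<open>U\<close> and \<open>V\<close>, divided by \<open>U * V\<close>;
    \<open>c\<close> is what the negative linear part costs on the same scale. As \<open>F\<close>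
    is affine and \<open>\<omega>\<close> lies between 0 and \<open>1 - q\<close>, it is enough to
    compare at these two ends.\<close>
  define F where "F x = \<alpha> * (1 - x - q3) + s * (x - (1 - \<tau>)) - (1 - x) * q3" for x
  define c where "c = (\<alpha> + (1 - \<tau>)) / V"
  have \<tau>: "0 \<le> \<tau>" "\<tau> \<le> 1" "1 - \<tau> \<le> 2 * K / (N - 1)"
  proof -
    have "0 \<le> (m - 1) * (m - 2)" using K by simp
    then show "0 \<le> \<tau>" using K by (simp add: \<tau>_def)
    have a: "(m - 1) * (m - 2) \<le> D" unfolding D_def using K by (intro mult_mono) auto
    then show "\<tau> \<le> 1" using K by (simp add: \<tau>_def)
    have "D - (m - 1) * (m - 2) \<le> 2 * K * (N - 2)"
    proof -
      have "2 * K * (N - 2) - (D - (m - 1) * (m - 2)) = K * (K - 1)" by (simp add: D_def m_def algebra_simps)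
      then show ?thesis using K by (metis diff_ge_0_iff_ge mult_nonneg_nonneg order_trans zero_le_one)
    qed
    then have "(D - (m - 1) * (m - 2)) / D \<le> 2 * K * (N - 2) / D" using K by (intro divide_right_mono) auto
    moreover have "1 - \<tau> = (D - (m - 1) * (m - 2)) / D" using K by (simp add: \<tau>_def diff_divide_distrib)
    ultimately have "1 - \<tau> \<le> 2 * K * (N - 2) / D" by simp
    also have "\<dots> = 2 * K / (N - 1)" using KLN by (simp add: D_def)
    finally show "1 - \<tau> \<le> 2 * K / (N - 1)" .
  qed
  have c: "c \<le> 2 * (\<alpha> + (1 - \<tau>)) / D"
  proof -
    have "0 \<le> \<alpha> + (1 - \<tau>)" using \<tau> K by (simp add: \<alpha>_def)
    moreover have "D \<le> 2 * V" using V_ge[OF l] by (simp add: D_def)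
    ultimately have "(\<alpha> + (1 - \<tau>)) * D \<le> (\<alpha> + (1 - \<tau>)) * (2 * V)" by (intro mult_left_mono)
    then show ?thesis using K pos by (simp add: c_def field_simps)
  qed
  note poly = mix_poly_nonneg[OF cases M_def m_def]
  have F0: "c \<le> F 0"
  proof -
    have first: "2 * (\<alpha> + (1 - \<tau>)) / D \<le> 2 * (\<alpha> + 1) / D" using \<tau> K by (intro divide_right_mono) auto
    have "m * M * D * (F 0 - 2 * (\<alpha> + 1) / D)
      = N*M*((N-1)*(N-2)-L*(L-1)) - L*m*((N-1)*(N-2)-(m-1)*(m-2)) - L*(L-1)*m*M - 2*M*(N+m)"
    proof -
      have 1: "m * \<alpha> = N" "M * s = L" "D * q3 = L * (L - 1)" "D * \<tau> = (m - 1) * (m - 2)" "D * (2 * (\<alpha> + 1) / D) = 2 * (\<alpha> + 1)"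
        using K by (simp_all add: \<alpha>_def s_def q3_def \<tau>_def)
      have "m * M * D * (F 0 - 2 * (\<alpha> + 1) / D)
        = (m * \<alpha>) * M * (D - D * q3) - (M * s) * m * (D - D * \<tau>) - (D * q3) * m * M - m * M * (D * (2 * (\<alpha> + 1) / D))"
        by (simp add: F_def algebra_simps)
      also have "\<dots> = (m * \<alpha>) * M * (D - D * q3) - (M * s) * m * (D - D * \<tau>) - (D * q3) * m * M - 2 * M * (m * \<alpha> + m)"
        unfolding 1(5) by (simp add: algebra_simps)
      finally show ?thesis unfolding 1(1-4) by (simp add: D_def)
    qed
    then have "0 \<le> m * M * D * (F 0 - 2 * (\<alpha> + 1) / D)" using poly(1) by simp
    moreover have "0 < m * M * D" using K by simp
    ultimately have "0 \<le> F 0 - 2 * (\<alpha> + 1) / D" by (rule nonneg_of_mult_pos)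
    then show ?thesis using c first by linarith
  qed
  have F1: "c \<le> F (1 - q)"
  proof -
    have first: "2 * (\<alpha> + (1 - \<tau>)) / D \<le> 2 * (\<alpha> + 2 * K / (N - 1)) / D" using \<tau> K by (intro divide_right_mono) auto
    have "m * M * D * (N - 1) * (F (1 - q) - 2 * (\<alpha> + 2 * K / (N - 1)) / D)
      = N*L*(M-1)*M*(N-1) + L*m*(N-1)*((m-1)*(m-2)-L*(N-2)) - L*L*(L-1)*m*M - 2*M*(N*(N-1)+2*K*m)"
    proof -
      define r where "r = K / (N - 1)"
      have 1: "m * \<alpha> = N" "M * s = L" "D * q3 = L * (L - 1)" "D * \<tau> = (m - 1) * (m - 2)"
        "(N - 1) * q = L" "(N - 1) * r = K" "D * (2 * (\<alpha> + 2 * r) / D) = 2 * (\<alpha> + 2 * r)"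
        using K by (simp_all add: \<alpha>_def s_def q3_def \<tau>_def q_def r_def)
      have 2: "D * q = L * (N - 2)" using K by (simp add: D_def q_def field_simps)
      have "m * M * D * (N - 1) * (F (1 - q) - 2 * (\<alpha> + 2 * r) / D)
        = (m * \<alpha>) * M * (N - 1) * (D * q - D * q3) + (M * s) * m * (N - 1) * (D * \<tau> - D * q)
          - m * M * ((N - 1) * q) * (D * q3) - m * M * (N - 1) * (D * (2 * (\<alpha> + 2 * r) / D))"
        by (simp add: F_def algebra_simps)
      also have "\<dots> = (m * \<alpha>) * M * (N - 1) * (D * q - D * q3) + (M * s) * m * (N - 1) * (D * \<tau> - D * q)
          - m * M * ((N - 1) * q) * (D * q3) - 2 * M * ((N - 1) * (m * \<alpha>) + 2 * m * ((N - 1) * r))"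
        unfolding 1(7) by (simp add: algebra_simps)
      finally have "m * M * D * (N - 1) * (F (1 - q) - 2 * (\<alpha> + 2 * r) / D) =
         N * M * (N - 1) * (L * (N - 2) - L * (L - 1)) + L * m * (N - 1) * ((m - 1) * (m - 2) - L * (N - 2))
          - m * M * L * (L * (L - 1)) - 2 * M * ((N - 1) * N + 2 * m * K)"
        unfolding 1(1-6) 2 .
      moreover have "2 * K / (N - 1) = 2 * r" by (simp add: r_def)
      ultimately show ?thesis by (simp add: M_def algebra_simps)
    qed
    then have "0 \<le> m * M * D * (N - 1) * (F (1 - q) - 2 * (\<alpha> + 2 * K / (N - 1)) / D)" using poly(2) by simp
    moreover have "0 < m * M * D * (N - 1)" using K by simp
    ultimately have "0 \<le> F (1 - q) - 2 * (\<alpha> + 2 * K / (N - 1)) / D" by (rule nonneg_of_mult_pos)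
    then show ?thesis using c first by linarith
  qed
  have q1: "q < 1" using KLN K by (simp add: q_def)
  have "c \<le> F \<omega>"
  proof -
    define \<mu> where "\<mu> = \<omega> / (1 - q)"
    have \<mu>: "0 \<le> \<mu>" "\<mu> \<le> 1" "\<omega> = \<mu> * (1 - q)" using \<omega> q1 by (auto simp: \<mu>_def)
    have "c = (1 - \<mu>) * c + \<mu> * c" by (simp add: algebra_simps)
    also have "\<dots> \<le> (1 - \<mu>) * F 0 + \<mu> * F (1 - q)" using F0 F1 \<mu> by (intro add_mono mult_left_mono) auto
    also have "\<dots> = F \<omega>" unfolding \<mu>(3) by (simp add: F_def algebra_simps)
    finally show ?thesis .
  qed
  then have "U * V * c \<le> U * V * F \<omega>" using pos by (intro mult_left_mono) auto
  moreover have "V * c = \<alpha> + (1 - \<tau>)" using pos by (simp add: c_def)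
  then have "U * (V * c) = U * (\<alpha> + (1 - \<tau>))" by simp
  then have "U * V * c = P + U - C4" unfolding P C4e by (simp add: algebra_simps)
  ultimately have main: "P + U - C4 \<le> U * V * F \<omega>" by simp
  have "Q - w \<ge> 0" using pos by simp
  moreover have "hm + star - ((P + U - w') * (Q - V + 1) + (P + U - C4) * (Q - V + V3) + (C4 - w') * (V3 - 1))
    = U * V * F \<omega> + (Q - w) - (P + U - C4)"
  proof -
    have Q': "Q = (1 + s) * V" using Qs by (simp add: algebra_simps)
    show ?thesis unfolding P C4e we V3e Q' F_def by (simp add: algebra_simps)
  qed
  ultimately show ?thesis using main by linarith
qed

text \<open>Multiplying by \<open>V * U\<close> lets \<open>wU\<close> eliminate \<open>w'\<close>.
  What remains is dominated by a positive multiple of \<open>V * P - U * (Q - V)\<close>, because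
  \<open>U * (V - w)\<close> exceeds \<open>V\<close>; this last fact uses
  \<open>3 \<le> l\<close>.\<close>

lemma steep_end_bound:
  assumes l: "3 \<le> l"
  shows "(P + U - w') * (Q - V + 1) < hm"
proof -
  have K: "1 \<le> K" "K \<le> L" "0 < N - K" "0 < N - L" "2 * L + 1 \<le> N" "2 \<le> L" using KLN l by (auto simp: L_def)
  have 1: "(N - K) * (P - U) = K * U" "(N - L) * (Q - V) = L * V" using PU QV by (simp_all add: algebra_simps)
  have a: "V * P - U * (Q - V) > 0"
  proof -
    have "P > U" using pos by simp
    then have "V * P > V * U" using pos by simp
    moreover have "U * (Q - V) \<le> U * V"
    proof -
      have "(N - L) * (Q - V) \<le> (N - L) * V" using 1(2) K pos by (simp add: mult_right_mono)
      then have "Q - V \<le> V" using K by simp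
      then show ?thesis using pos by (intro mult_left_mono) auto
    qed
    ultimately show ?thesis by (simp add: mult.commute)
  qed
  have b: "V < U * (V - w)"
  proof -
    have "(N - 1) * V2 \<le> (N - 1) * (V - w)" using w_le K by (intro mult_left_mono) auto
    then have "L * V \<le> (N - 1) * (V - w)" using V2 by simp
    also have "\<dots> \<le> U * (V - w)" using U_ge pos by (intro mult_right_mono) auto
    finally have "L * V \<le> U * (V - w)" .
    moreover have "1 * V < L * V" using K pos by (intro mult_strict_right_mono) auto
    ultimately show ?thesis by simp
  qed
  have w': "w' * V = w * U" using wU by simp
  have "V * U * (hm - (P + U - w') * (Q - V + 1))
    = U * (V * ((P + 1) * (Q - w))) - U * ((V * P + V * U - w' * V) * (Q - V + 1))"
    by (simp add: algebra_simps)
  also have "\<dots> = U * ((V - w) * (V * P - U * (Q - V)) + V * (Q - w) - V * P - U * (V - w))"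
    unfolding w' by (simp add: algebra_simps)
  also have "\<dots> > 0"
  proof -
    have c: "U * (V * (Q - w)) - U * (V * P) - U * (U * (V - w)) \<ge> - (V * (V * P - U * (Q - V)))"
    proof -
      have "U * (V * (Q - w)) - U * (U * (V - w)) - (V * U) * P + V * (V * P - U * (Q - V))
         = (V - U) * (V * P) + U * (V - w) * (V - U)"
        by (simp add: algebra_simps)
      moreover have "\<dots> \<ge> 0" using pos UV by (intro add_nonneg_nonneg mult_nonneg_nonneg) auto
      ultimately show ?thesis by (simp add: mult_ac)
    qed
    have "U * (V - w) * (V * P - U * (Q - V)) > V * (V * P - U * (Q - V))"
      using a b by (intro mult_strict_right_mono) auto
    then show ?thesis using c by (simp add: algebra_simps)
  qed
  finally have "0 < V * U * (hm - (P + U - w') * (Q - V + 1))" .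
  moreover have "0 < V * U" using pos by simp
  ultimately have "0 < hm - (P + U - w') * (Q - V + 1)" by (rule zero_less_mult_pos)
  then show ?thesis by simp
qed

text \<open>Beyond the corner \<open>(U2, V2)\<close> the first size is bounded through the second.
  For \<open>y\<close> between \<open>V3\<close> and \<open>V2\<close> the product only falls from
  its value at the corner. The chord from \<open>V3\<close> down to 1 is the place where it may rise
  again and where \<open>star\<close> is needed besides \<open>hm\<close>.\<close>

lemma large_excess:
  assumes f: "feasible z y" and z: "U2 < z" and y: "1 \<le> y"
  shows "(P + z) * (Q - V + y) < max hm star"
proof -
  have yV2: "y < V2"
  proof (rule ccontr)
    assume "\<not> y < V2"
    then show False using feasible_y_corner[OF f, of 1] z by simp
  qed
  have l: "3 \<le> l"
  proof (rule ccontr)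
    assume "\<not> 3 \<le> l"
    then have "l = 2" using k2 kl by simp
    then have "V2 = 1" unfolding V2_def by simp
    then show False using yV2 y by simp
  qed
  define \<delta> \<epsilon> where "\<delta> = real ((n - 4) choose (k - 2))" and "\<epsilon> = real ((n - 4) choose (l - 2))"
  have \<delta>: "0 < \<delta>" "0 < \<epsilon>" using nkl k2 kl l by (auto simp: \<delta>_def \<epsilon>_def)
  have eU: "U - C4 = U2 + \<delta>" and eV: "V2 = V3 + \<epsilon>"
    using C4_step V3(2)[OF l] by (auto simp: \<delta>_def \<epsilon>_def)
  have slope: "\<delta> * (Q - V + V2) \<le> (P + U2) * \<epsilon>" using upper_slope by (simp add: \<delta>_def \<epsilon>_def)
  have falling: "(P + U2 + r * \<delta>) * (Q - V + V2 - r * \<epsilon>) < hm" if r: "0 < r" for r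
  proof -
    have "(P + U2 + r * \<delta>) * (Q - V + V2 - r * \<epsilon>)
      = (P + U2) * (Q - V + V2) + r * (\<delta> * (Q - V + V2) - (P + U2) * \<epsilon>) - r * r * (\<delta> * \<epsilon>)"
      by (simp add: algebra_simps)
    moreover have "r * (\<delta> * (Q - V + V2) - (P + U2) * \<epsilon>) \<le> 0" using slope r by (simp add: mult_nonneg_nonpos)
    moreover have "0 < r * r * (\<delta> * \<epsilon>)" using r \<delta> by simp
    ultimately show ?thesis using corner_hm by linarith
  qed
  have s: "(n - 4) choose (n - l - 1) = (n - 4) choose (l - 3)" "(n - 3) choose (n - l - 1) = (n - 3) choose (l - 2)"
  proof -
    have e: "n - 4 - (l - 3) = n - l - 1" "n - 3 - (l - 2) = n - l - 1" using l by auto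
    show "(n - 4) choose (n - l - 1) = (n - 4) choose (l - 3)" "(n - 3) choose (n - l - 1) = (n - 3) choose (l - 2)"
      using binomial_symmetric[of "l - 3" "n - 4"] binomial_symmetric[of "l - 2" "n - 3"] nkl k2 l
      unfolding e by auto
  qed
  have n1: "n - l - 1 \<le> n - 4" "n - 4 \<le> n - 3" "n - 3 \<le> n - 2" "n - 4 \<le> n - 2" using l by linarith+
  have y0: "0 < Q - V + y" using pos y by simp
  show ?thesis
  proof (cases "V3 \<le> y")
    case True
    define r where "r = (V2 - y) / \<epsilon>"
    have r: "0 < r" "r \<le> 1" "y = V2 - r * \<epsilon>" using \<delta> True yV2 eV by (auto simp: r_def field_simps)
    have "z \<le> U - ((1 - (1 - r)) * C4 + (1 - r) * (U - U2))"
      unfolding C4_def U_U2[symmetric]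
    proof (rule feasible_yD[OF f])
      show "(1 - (1 - r)) * real ((n - 4) choose (n - l - 1)) + (1 - r) * real ((n - 3) choose (n - l - 1)) \<le> y"
        unfolding s V3_def[symmetric] V2_def[symmetric] r(3) eV by (simp add: algebra_simps)
    qed (use n1 r in auto)
    also have "\<dots> = U2 + r * (U - C4 - U2)" by (simp add: algebra_simps)
    also have "\<dots> = U2 + r * \<delta>" unfolding eU by simp
    finally have "(P + z) * (Q - V + y) \<le> (P + (U2 + r * \<delta>)) * (Q - V + y)"
      using y0 by (intro mult_right_mono) auto
    also have "\<dots> = (P + U2 + r * \<delta>) * (Q - V + V2 - r * \<epsilon>)" using r(3) by (simp add: add.assoc)
    also have "\<dots> < hm" using falling[OF r(1)] .
    finally show ?thesis by simp
  next
    case False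
    then obtain t where t: "0 \<le> t" "t \<le> 1" "y = (1 - t) + t * V3" using convex_weight[of y V3] y by auto
    have "z \<le> U - ((1 - t) * w' + t * C4)"
      unfolding C4_def w'_def
    proof (rule feasible_yD[OF f])
      show "(1 - t) * real ((n - l - 1) choose (n - l - 1)) + t * real ((n - 4) choose (n - l - 1)) \<le> y"
        unfolding s V3_def[symmetric] t(3) by simp
    qed (use n1 t in auto)
    then have "(P + z) * (Q - V + y) \<le> (P + (U - ((1 - t) * w' + t * C4))) * (Q - V + y)"
      using y0 by (intro mult_right_mono) auto
    also have "\<dots> = (1 - t) * ((P + U - w') * (Q - V + 1)) + t * ((P + U - C4) * (Q - V + V3))
        + (1 - t) * t * ((C4 - w') * (V3 - 1))"
      unfolding t(3) by (simp add: algebra_simps)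
    also have "\<dots> < max hm star"
    proof -
      define E where "E = (P + U - w') * (Q - V + 1)"
      define X where "X = (P + U - C4) * (Q - V + V3)"
      define Z where "Z = max hm star"
      have E: "E < Z" using steep_end_bound[OF l] by (simp add: E_def Z_def)
      have e: "P + U2 + 1 * \<delta> = P + U - C4" "Q - V + V2 - 1 * \<epsilon> = Q - V + V3" using eU eV by auto
      have "X < hm" using falling[of 1] unfolding e X_def by simp
      then have X: "X < Z" by (simp add: Z_def)
      \<comment> \<open>The mixed term is at most the sum of the two deficits at the ends, which
        leaves \<open>(1 - t) * (1 - t) * (Z - E) + t * t * (Z - X)\<close> as a lower bound for the
        deficit at \<open>t\<close>.\<close>
      have "(C4 - w') * (V3 - 1) \<le> (Z - E) + (Z - X)"
        using mixed_bound[OF l] by (simp add: E_def X_def Z_def)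
      then have "(1 - t) * t * ((C4 - w') * (V3 - 1)) \<le> (1 - t) * t * ((Z - E) + (Z - X))"
        using t by (intro mult_left_mono) auto
      moreover have "Z - ((1 - t) * E + t * X + (1 - t) * t * ((Z - E) + (Z - X)))
         = (1 - t) * (1 - t) * (Z - E) + t * t * (Z - X)"
        by (simp add: algebra_simps)
      moreover have "(1 - t) * (1 - t) * (Z - E) + t * t * (Z - X) > 0"
      proof (cases "t = 0")
        case True then show ?thesis using E by simp
      next
        case False
        then have "t * t * (Z - X) > 0" using t X by simp
        moreover have "(1 - t) * (1 - t) * (Z - E) \<ge> 0" using t E by simp
        ultimately show ?thesis by linarith
      qed
      ultimately show ?thesis unfolding E_def X_def Z_def by linarith
    qed
    finally show ?thesis .
  qed
qed

end

text \<open>The assumption \<open>slope\<close> makes the right-hand side increasing in \<open>j\<close> up to \<open>J\<close>.\<close>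

lemma product_chain:
  assumes S: "finite S" "card S = g" and A: "\<A> \<subseteq> [S]\<^bsup>a\<^esup>" and B: "\<B> \<subseteq> [S]\<^bsup>b\<^esup>" and ci: "cross_intersecting \<A> \<B>"
    and ab: "1 \<le> a" "1 \<le> b" "a + b \<le> g" and m: "m = g - a"
    and slope: "real (m + b) * real (J choose b) \<le> real m * real (g choose b)"
    and j: "m \<le> j" "j \<le> J" and le: "card \<A> \<le> j choose m"
  shows "card \<A> * card \<B> \<le> real (j choose m) * (real (g choose b) - real (j choose b)) \<and>
    (card \<A> < j choose m \<longrightarrow> card \<A> * card \<B> < real (j choose m) * (real (g choose b) - real (j choose b)))"
  using j le
proof (induction j rule: nat_induct_at_least)
  case base
  have "m choose b < g choose b"
  proof -
    have "Suc m choose b \<le> g choose b" using m ab by (intro binomial_right_mono) auto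
    moreover have "0 < m choose (b - 1)" using ab m by simp
    moreover have "Suc m choose b = (m choose (b - 1)) + (m choose b)" using choose_reduce_nat[of "Suc m" b] ab by simp
    ultimately show ?thesis by linarith
  qed
  then have pos: "0 < real (g choose b) - real (m choose b)" by simp
  show ?case
  proof (cases "card \<A> = 0")
    case True
    then show ?thesis using pos by simp
  next
    case False
    then have 1: "card \<A> = 1" using base by simp
    have "card \<B> \<le> real (g choose b) - cascade 0 0 m m 0 b"
      by (rule cross_chord[OF S A B ci ab(3)]) (use m 1 in \<open>auto simp: cascade_def\<close>)
    then show ?thesis using 1 by (simp add: cascade_def)
  qed
next
  case (Suc j)
  define x \<Delta> y \<delta> where "x = real (j choose m)" and "\<Delta> = real (j choose (m - 1))"
    and "y = real (g choose b) - real (j choose b)" and "\<delta> = real (j choose (b - 1))"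
  have m0: "1 \<le> m" using m ab by simp
  have ex: "real (Suc j choose m) = x + \<Delta>" "real (g choose b) - real (Suc j choose b) = y - \<delta>"
    "real (Suc j choose b) = real (j choose b) + \<delta>"
    using choose_reduce_nat[of "Suc j" m] choose_reduce_nat[of "Suc j" b] ab m0
    by (auto simp: x_def \<Delta>_def y_def \<delta>_def)
  have p: "0 < \<Delta>" "0 < \<delta>" using Suc.hyps m ab by (auto simp: \<Delta>_def \<delta>_def)
  have d: "real (Suc j) * \<Delta> = real m * (x + \<Delta>)" "real (Suc j) * \<delta> = real b * (real (j choose b) + \<delta>)"
    using binomial_diag[OF m0, of "Suc j"] binomial_diag[OF ab(2), of "Suc j"] unfolding ex
    by (auto simp: \<Delta>_def \<delta>_def)
  \<comment> \<open>The derivative of the product at the right end of the edge is nonnegative; by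
    concavity the product then increases along the whole edge, which is \<open>inc\<close>.\<close>
  have sl: "(x + \<Delta>) * \<delta> \<le> \<Delta> * (y - \<delta>)"
  proof -
    have "real (m + b) * real (Suc j choose b) \<le> real (m + b) * real (J choose b)"
      using Suc.prems by (intro mult_left_mono of_nat_mono binomial_right_mono) auto
    then have "real b * (real (j choose b) + \<delta>) \<le> real m * (y - \<delta>)"
      using slope unfolding ex(2)[symmetric] ex(3)[symmetric] by (simp add: algebra_simps)
    then have "(x + \<Delta>) * (real b * (real (j choose b) + \<delta>)) \<le> (x + \<Delta>) * (real m * (y - \<delta>))"
      using p by (intro mult_left_mono) (auto simp: x_def)
    moreover have "real (Suc j) * ((x + \<Delta>) * \<delta>) = (x + \<Delta>) * (real b * (real (j choose b) + \<delta>))"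
      unfolding d(2)[symmetric] by (simp only: mult_ac)
    moreover have "real (Suc j) * (\<Delta> * (y - \<delta>)) = (x + \<Delta>) * (real m * (y - \<delta>))"
    proof -
      have "real (Suc j) * (\<Delta> * (y - \<delta>)) = (real (Suc j) * \<Delta>) * (y - \<delta>)" by (simp only: mult.assoc)
      then show ?thesis unfolding d(1) by (simp only: mult_ac)
    qed
    ultimately have "real (Suc j) * ((x + \<Delta>) * \<delta>) \<le> real (Suc j) * (\<Delta> * (y - \<delta>))" by linarith
    then show ?thesis by (rule mult_left_le_imp_le) simp
  qed
  have inc: "(x + t * \<Delta>) * (y - t * \<delta>) < (x + \<Delta>) * (y - \<delta>)" if t: "0 \<le> t" "t < 1" for t
  proof -
    have "(x + \<Delta>) * (y - \<delta>) - (x + t * \<Delta>) * (y - t * \<delta>)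
      = (1 - t) * (\<Delta> * (y - \<delta>) - (x + \<Delta>) * \<delta>) + (1 - t) * (1 - t) * (\<Delta> * \<delta>)"
      by (simp add: algebra_simps)
    moreover have "0 \<le> (1 - t) * (\<Delta> * (y - \<delta>) - (x + \<Delta>) * \<delta>)" using sl t by simp
    moreover have "0 < (1 - t) * (1 - t) * (\<Delta> * \<delta>)" using t p by simp
    ultimately show ?thesis by linarith
  qed
  show ?case
  proof (cases "card \<A> \<le> j choose m")
    case True
    then have "card \<A> * card \<B> \<le> x * y" using Suc by (simp add: x_def y_def)
    also have "\<dots> < (x + \<Delta>) * (y - \<delta>)" using inc[of 0] by simp
    finally show ?thesis unfolding ex(1,2) by simp
  next
    case False
    define t where "t = (card \<A> - x) / \<Delta>"
    have c1: "x < card \<A>" using False by (simp add: x_def)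
    have c2: "card \<A> \<le> x + \<Delta>" using Suc.prems(2) unfolding ex(1)[symmetric] by simp
    have t: "0 \<le> t" "t \<le> 1" "card \<A> = x + t * \<Delta>"
      using p c1 c2 by (auto simp: t_def field_simps)
    have "card \<B> \<le> real (g choose b) - cascade 0 0 j (Suc j) t b"
    proof (rule cross_chord[OF S A B ci ab(3)])
      show "cascade 0 0 j (Suc j) t (g - a) \<le> real (card \<A>)"
        unfolding t(3) m[symmetric] cascade_def by (simp only: diff_zero ex x_def[symmetric]) (simp add: algebra_simps)
    qed (use m Suc.hyps t in auto)
    also have "\<dots> = y - t * \<delta>" unfolding cascade_def by (simp only: diff_zero ex) (simp add: y_def algebra_simps)
    finally have b: "card \<B> \<le> y - t * \<delta>" .
    have "real (card \<A>) * real (card \<B>) \<le> (x + t * \<Delta>) * (y - t * \<delta>)"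
      unfolding t(3)[symmetric] by (rule mult_left_mono[OF b]) simp
    moreover have "(x + t * \<Delta>) * (y - t * \<delta>) \<le> (x + \<Delta>) * (y - \<delta>)" using inc[of t] t by (cases "t = 1") auto
    moreover have "t < 1" if "card \<A> < Suc j choose m"
    proof -
      have "real (card \<A>) < x + \<Delta>" using that unfolding ex(1)[symmetric] by simp
      then show ?thesis using p unfolding t_def by (simp add: field_simps)
    qed
    ultimately show ?thesis unfolding ex(1,2) of_nat_mult using inc[OF t(1)] by force
  qed
qed

section \<open>Pairs with a family no larger than a double star\<close>

context sizes
begin

text \<open>The hypothesis \<open>slope\<close> of \<open>product_chain\<close> at
  \<open>J = n - 2\<close>, for either family in the leading role.\<close>

lemma star_side_slope:
  "real (n - l + k) * real ((n - 2) choose k) \<le> real (n - l) * real (n choose k)"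
  "real (n - k + l) * real ((n - 2) choose l) \<le> real (n - k) * real (n choose l)"
proof -
  have e: "n - 1 - 1 = n - 2" by simp
  define x y z where "x = real n" and "y = real k" and "z = real l"
  have xyz: "2 \<le> y" "y \<le> z" "2 * z \<le> x" "y + z + 1 \<le> x" using k2 kl nl nkl by (auto simp: x_def y_def z_def)
  have c: "real (n - 1) = x - 1" "real (n - l + k) = x - z + y" "real (n - k + l) = x - y + z" "real (n - l) = x - z" "real (n - k) = x - y"
    using nkl by (auto simp: x_def y_def z_def of_nat_diff)
  have 1: "x * (x - 1) * real ((n - 2) choose k) = (x - y) * (x - y - 1) * real (n choose k)"
    and 2: "x * (x - 1) * real ((n - 2) choose l) = (x - z) * (x - z - 1) * real (n choose l)"
  proof -
    have "x * ((x - 1) * real ((n - 2) choose k)) = (x - 1 - y) * (x * real ((n - 1) choose k))"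
      using binomial_down[of k "n - 1"] nkl unfolding e c by (simp add: x_def y_def)
    also have "\<dots> = (x - 1 - y) * ((x - y) * real (n choose k))"
      using binomial_down[of k n] nkl by (simp add: x_def y_def)
    finally show "x * (x - 1) * real ((n - 2) choose k) = (x - y) * (x - y - 1) * real (n choose k)"
      by (simp add: mult_ac)
    have "x * ((x - 1) * real ((n - 2) choose l)) = (x - 1 - z) * (x * real ((n - 1) choose l))"
      using binomial_down[of l "n - 1"] nkl k2 unfolding e c by (simp add: x_def z_def)
    also have "\<dots> = (x - 1 - z) * ((x - z) * real (n choose l))"
      using binomial_down[of l n] nkl by (simp add: x_def z_def)
    finally show "x * (x - 1) * real ((n - 2) choose l) = (x - z) * (x - z - 1) * real (n choose l)"
      by (simp add: mult_ac)
  qed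
  have X: "0 < x * (x - 1)" using xyz by simp
  have i1: "(x - z + y) * ((x - y) * (x - y - 1)) \<le> (x - z) * (x * (x - 1))"
  proof -
    have "(x - z) * (x * (x - 1)) - (x - z + y) * ((x - y) * (x - y - 1))
      = y * ((x - z) * x - (z - y) * (x - y - 1))" by (simp add: algebra_simps)
    moreover have "(z - y) * (x - y - 1) \<le> (x - z) * x" using xyz by (intro mult_mono) auto
    ultimately show ?thesis using xyz by (smt (verit) mult_nonneg_nonneg)
  qed
  have i2: "(x - y + z) * ((x - z) * (x - z - 1)) \<le> (x - y) * (x * (x - 1))"
  proof -
    have "(x - y + z) * (x - z) \<le> (x - y) * x"
    proof -
      have "(x - y) * x - (x - y + z) * (x - z) = z * (z - y)" by (simp add: algebra_simps)
      then show ?thesis using xyz by (smt (verit) mult_nonneg_nonneg)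
    qed
    from mult_mono[OF this, of "x - z - 1" "x - 1"]
    have "((x - y + z) * (x - z)) * (x - z - 1) \<le> ((x - y) * x) * (x - 1)" using xyz by simp
    then show ?thesis by (simp only: mult.assoc)
  qed
  have "x * (x - 1) * ((x - z + y) * real ((n - 2) choose k)) = (x - z + y) * ((x - y) * (x - y - 1)) * real (n choose k)"
    using 1 by (simp only: mult_ac)
  also have "\<dots> \<le> (x - z) * (x * (x - 1)) * real (n choose k)" using i1 by (intro mult_right_mono) auto
  also have "\<dots> = x * (x - 1) * ((x - z) * real (n choose k))" by (simp only: mult_ac)
  finally show "real (n - l + k) * real ((n - 2) choose k) \<le> real (n - l) * real (n choose k)"
    unfolding c by (rule mult_left_le_imp_le) (rule X)
  have "x * (x - 1) * ((x - y + z) * real ((n - 2) choose l)) = (x - y + z) * ((x - z) * (x - z - 1)) * real (n choose l)"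
    using 2 by (simp only: mult_ac)
  also have "\<dots> \<le> (x - y) * (x * (x - 1)) * real (n choose l)" using i2 by (intro mult_right_mono) auto
  also have "\<dots> = x * (x - 1) * ((x - y) * real (n choose l))" by (simp only: mult_ac)
  finally show "real (n - k + l) * real ((n - 2) choose l) \<le> real (n - k) * real (n choose l)"
    unfolding c by (rule mult_left_le_imp_le) (rule X)
qed

lemma UQ_PV: "(N - K) * (N - L) * (U * Q - P * V) = N * (L - K) * (U * V)"
proof -
  have "(N - K) * (N - L) * (U * Q - P * V) = (N - K) * U * ((N - L) * Q) - (N - L) * V * ((N - K) * P)"
    by (simp add: algebra_simps)
  then show ?thesis unfolding PU QV by (simp add: algebra_simps)
qed

text \<open>The ratios \<open>P / U = N / (N - K)\<close> and \<open>Q / V = N / (N - L)\<close>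
  increase with the size of the sets.\<close>

lemma PV_le_UQ: "P * V \<le> U * Q"
proof -
  have "0 \<le> (N - K) * (N - L) * (U * Q - P * V)" unfolding UQ_PV using KLN pos by simp
  moreover have "0 < (N - K) * (N - L)" using KLN by simp
  ultimately have "0 \<le> U * Q - P * V" by (rule nonneg_of_mult_pos)
  then show ?thesis by simp
qed

lemma PV_less_UQ: assumes "k < l" shows "P * V + V \<le> U * Q"
proof -
  have d: "1 \<le> L - K" using assms by (simp add: L_def K_def)
  have X: "0 < (N - K) * (N - L)" using KLN by simp
  have "(N - K) * (N - L) * V \<le> N * (N - 1) * V" using KLN pos by (intro mult_right_mono mult_mono) auto
  also have "\<dots> \<le> N * U * V" using KLN pos U_ge by (intro mult_right_mono mult_left_mono) auto
  also have "\<dots> \<le> N * (L - K) * (U * V)"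
  proof -
    have "1 * (N * U * V) \<le> (L - K) * (N * U * V)" using d KLN pos by (intro mult_right_mono) auto
    then show ?thesis by (simp add: mult_ac)
  qed
  finally have "(N - K) * (N - L) * V \<le> (N - K) * (N - L) * (U * Q - P * V)" unfolding UQ_PV .
  then have "V \<le> U * Q - P * V" using X by (rule mult_left_le_imp_le)
  then show ?thesis by simp
qed

text \<open>The chain of increasing products from \<open>product_chain\<close> ends exactly at the
  sizes of the two-star pair.\<close>

lemma small_B:
  assumes S: "finite S" "card S = n" and A: "\<A> \<subseteq> [S]\<^bsup>k\<^esup>" and B: "\<B> \<subseteq> [S]\<^bsup>l\<^esup>" and ci: "cross_intersecting \<A> \<B>"
    and b: "card \<B> \<le> Q - V"
  shows "card \<A> * card \<B> \<le> star" "card \<B> < Q - V \<Longrightarrow> card \<A> * card \<B> < star"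
proof -
  have ic: "cross_intersecting \<B> \<A>" using ci by (auto simp: cross_intersecting_def)
  have c: "real (card \<B>) \<le> real ((n - 2) choose (n - l))" using b unfolding binomial_facts .
  have v: "real ((n - 2) choose (n - l)) * (real (n choose k) - real ((n - 2) choose k)) = star"
    using binomial_facts by (simp add: mult.commute)
  have *: "card \<B> * card \<A> \<le> real ((n - 2) choose (n - l)) * (real (n choose k) - real ((n - 2) choose k)) \<and>
    (card \<B> < (n - 2) choose (n - l) \<longrightarrow> card \<B> * card \<A> < real ((n - 2) choose (n - l)) * (real (n choose k) - real ((n - 2) choose k)))"
    by (rule product_chain[OF S B A ic _ _ _ refl, of "n - 2"]) (use star_side_slope(1) nkl k2 kl c in auto)
  show "card \<A> * card \<B> \<le> star" using * unfolding v by (simp add: mult.commute)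
  show "card \<A> * card \<B> < star" if "card \<B> < Q - V"
  proof -
    have "real (card \<B>) < real ((n - 2) choose (n - l))" using that unfolding binomial_facts .
    then show ?thesis using * unfolding v by (simp add: mult.commute)
  qed
qed

text \<open>With the families exchanged the chain ends at the exchanged two-star pair, whose product
  \<open>(P - U) * (Q + V)\<close> is smaller than \<open>star\<close> by twice
  \<open>U * Q - P * V\<close>.\<close>

lemma small_A:
  assumes S: "finite S" "card S = n" and A: "\<A> \<subseteq> [S]\<^bsup>k\<^esup>" and B: "\<B> \<subseteq> [S]\<^bsup>l\<^esup>" and ci: "cross_intersecting \<A> \<B>"
    and a: "card \<A> \<le> P - U" and kl': "k < l"
  shows "card \<A> * card \<B> < star"
proof -
  have c: "real (card \<A>) \<le> real ((n - 2) choose (n - k))" using a unfolding binomial_facts .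
  have v: "real ((n - 2) choose (n - k)) * (real (n choose l) - real ((n - 2) choose l)) = (P - U) * (Q + V)"
    using binomial_facts by simp
  have "card \<A> * card \<B> \<le> real ((n - 2) choose (n - k)) * (real (n choose l) - real ((n - 2) choose l)) \<and>
    (card \<A> < (n - 2) choose (n - k) \<longrightarrow> card \<A> * card \<B> < real ((n - 2) choose (n - k)) * (real (n choose l) - real ((n - 2) choose l)))"
    by (rule product_chain[OF S A B ci _ _ _ refl, of "n - 2"]) (use star_side_slope(2) nkl k2 kl c in auto)
  then have "card \<A> * card \<B> \<le> (P - U) * (Q + V)" unfolding v by simp
  also have "\<dots> < star" using PV_less_UQ[OF kl'] pos by (simp add: algebra_simps)
  finally show ?thesis .
qed

end

section \<open>Pairs close to full stars\<close>

context sizes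
begin

text \<open>The value of \<open>w\<close> for the parameters \<open>n - 1\<close>, \<open>k\<close>,
  \<open>l - 1\<close>, which arise by deleting an element from the second family.\<close>

definition "w2 = real ((n - 2 - k) choose (l - 2))"

lemma UQw: "V < U * (Q - w)"
proof -
  have K: "1 \<le> K" "K \<le> L" "2 * L + 1 \<le> N" using KLN by auto
  have "(N - 1) * V2 \<le> (N - 1) * (V - w)" using w_le K by (intro mult_left_mono) auto
  then have "L * V \<le> (N - 1) * (V - w)" using V2 by simp
  also have "\<dots> \<le> U * (V - w)" using U_ge pos by (intro mult_right_mono) auto
  also have "\<dots> < U * (Q - w)" using pos by simp
  finally have "L * V < U * (Q - w)" .
  moreover have "1 * V \<le> L * V" using K pos by (intro mult_right_mono) auto
  ultimately show ?thesis by simp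
qed

text \<open>For an element whose degrees in both families exceed those of a second element in a full
  star. Adding the two instances of \<open>sum_bound\<close> places the pair of sizes strictly below
  the line of slope \<open>- V / U\<close> through \<open>(P + 1, Q - w)\<close>, by the margin
  \<open>\<delta>\<close>; the limits \<open>P + 1\<close> and \<open>Q\<close> on the sizes then
  keep the product below \<open>hm\<close>.\<close>

lemma both_links_large:
  assumes s1: "V * a0 + U * y \<le> U * V - U * w + V" and s2: "V * z + U * b0 \<le> U * V - U * w + V"
    and a: "a0 + (P - U + z) \<le> P + 1" and b: "b0 + (Q - V + y) \<le> Q" and p: "1 \<le> b0" "1 \<le> y"
  shows "(a0 + (P - U + z)) * (b0 + (Q - V + y)) < hm"
proof -
  define X Y where "X = a0 + (P - U + z)" and "Y = b0 + (Q - V + y)"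
  define \<delta> where "\<delta> = U * w - V"
  have \<delta>: "V \<le> \<delta>"
  proof -
    have "2 * V \<le> w' * V" using w'_ge pos by (intro mult_right_mono) auto
    then show ?thesis using wU by (simp add: \<delta>_def mult.commute)
  qed
  have Y0: "0 < Y" using p pos by (simp add: Y_def)
  have sum: "V * X + U * Y \<le> V * (P + 1) + U * (Q - w) - \<delta>"
    using s1 s2 by (simp add: X_def Y_def \<delta>_def algebra_simps)
  have X: "X \<le> P + 1" and Y: "Y \<le> Q" using a b by (simp_all add: X_def Y_def)
  have \<beta>: "0 < Q - w" using pos by simp
  show ?thesis unfolding X_def[symmetric] Y_def[symmetric]
  proof (cases "Y \<le> Q - w")
    case True
    show "X * Y < hm"
    proof (cases "X = P + 1")
      case eq: True
      then have "V * X = V * (P + 1)" by simp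
      then have "U * Y < U * (Q - w)" using sum \<delta> pos by linarith
      then have "Y < Q - w" using pos by simp
      then show ?thesis using eq pos by simp
    next
      case False
      then have "X * Y < (P + 1) * Y" using X Y0 by simp
      also have "\<dots> \<le> hm" using True pos by (intro mult_left_mono) auto
      finally show ?thesis .
    qed
  next
    case False
    define e where "e = Y - (Q - w)"
    have e: "0 < e" "Y = (Q - w) + e" using False by (auto simp: e_def)
    have "V * X \<le> V * (P + 1) - \<delta> - U * e" using sum unfolding e(2) by (simp add: algebra_simps)
    then have "V * X * Y \<le> (V * (P + 1) - \<delta> - U * e) * Y" using Y0 by (intro mult_right_mono) auto
    also have "\<dots> = V * hm + e * ((V * P - U * Q) + V + U * w - \<delta> - U * e) - \<delta> * (Q - w)"
      unfolding e(2) by (simp add: algebra_simps)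
    also have "\<dots> \<le> V * hm + e * (2 * V - U * e) - V * (Q - w)"
    proof -
      have "e * ((V * P - U * Q) + V + U * w - \<delta> - U * e) \<le> e * (2 * V - U * e)"
        using PV_le_UQ e by (intro mult_left_mono) (auto simp: \<delta>_def mult.commute)
      moreover have "V * (Q - w) \<le> \<delta> * (Q - w)" using \<delta> \<beta> by (intro mult_right_mono) auto
      ultimately show ?thesis by linarith
    qed
    also have "\<dots> < V * hm"
    proof -
      \<comment> \<open>Completing the square bounds the gain from exceeding \<open>Q - w\<close> by
        \<open>V * V / U\<close>; \<open>UQw\<close> makes this less than the loss
        \<open>V * (Q - w)\<close> caused by the margin.\<close>
      have "U * (e * (2 * V - U * e)) = V * V - (U * e - V) * (U * e - V)" by (simp add: algebra_simps)
      then have "U * (e * (2 * V - U * e)) \<le> V * V" using zero_le_square[of "U * e - V"] by linarith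
      also have "\<dots> < V * (U * (Q - w))" using UQw pos by simp
      finally have "U * (e * (2 * V - U * e)) < U * (V * (Q - w))" by (simp add: mult_ac)
      then have "e * (2 * V - U * e) < V * (Q - w)" using pos by simp
      then show ?thesis by simp
    qed
    finally have "V * (X * Y) < V * hm" by (simp add: mult.assoc)
    then show "X * Y < hm" using pos by simp
  qed
qed

text \<open>The degree in the first family being small, nearly all of it avoids the element, and the
  linear bound pushes \<open>a\<close> so far below \<open>P\<close> that even \<open>b = Q\<close>
  cannot restore the product \<open>hm\<close>.\<close>

lemma large_B_small_A_link:
  assumes s: "V * a0 + U * y \<le> U * V - U * w + V" and a0: "a - (P - U) \<le> a0" and y: "1 \<le> y"
    and hm: "hm \<le> a * b" and b: "b \<le> Q" and a: "0 \<le> a"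
  shows False
proof -
  have 1: "V * (a - (P - U)) \<le> V * a0" using a0 pos by (intro mult_left_mono) auto
  have 2: "U * 1 \<le> U * y" using y pos by (intro mult_left_mono) auto
  have "V * a \<le> V * P - U * w + V - U" using s 1 2 by (simp add: algebra_simps)
  then have "V * a * Q \<le> (V * P - U * w + V - U) * Q" using pos by (intro mult_right_mono) auto
  moreover have "V * hm \<le> V * (a * Q)"
    using hm mult_left_mono[OF b a] pos by (intro mult_left_mono) auto
  ultimately have "V * hm \<le> (V * P - U * w + V - U) * Q" by (simp add: mult.assoc)
  then have A: "w * (U * Q - P * V) + U * Q \<le> V * w" by (simp add: algebra_simps)
  show False
  proof (cases "k = l")
    case True
    then have "U = V" unfolding U_def V_def by simp
    then have "U * Q \<le> U * w" using A PV_le_UQ w_ge by (smt (verit) mult_nonneg_nonneg)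
    then show False using pos by simp
  next
    case False
    then have "P * V + V \<le> U * Q" using PV_less_UQ kl by simp
    then have "w * V \<le> w * (U * Q - P * V)" using w_ge by (intro mult_left_mono) auto
    then show False using A pos by (smt (verit) mult.commute mult_pos_pos)
  qed
qed

text \<open>The product forces \<open>b \<ge> Q - w\<close>, so at least \<open>V - w\<close>
  members of the second family avoid the element. With \<open>1 \<le> z\<close> this uses up all of
  the linear bound and leaves only its extreme point.\<close>

lemma large_A_link:
  assumes s: "V * z + U * b0 \<le> U * V - U * w + V" and b0: "b - (Q - V) \<le> b0" and z: "1 \<le> z"
    and hm: "hm \<le> a * b" and a: "a \<le> P + 1" and b: "0 \<le> b"
  shows "z = 1" "a = P + 1"
proof -
  have "hm \<le> (P + 1) * b" using hm mult_right_mono[OF a b] by simp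
  then have bw: "Q - w \<le> b" using pos by simp
  have "U * (b - (Q - V)) \<le> U * b0" using b0 pos by (intro mult_left_mono) auto
  then have A: "V * z + U * (b - (Q - w)) \<le> V" using s by (simp add: algebra_simps)
  have "0 \<le> U * (b - (Q - w))" using bw pos by simp
  then have "V * z \<le> V * 1" using A by simp
  then show z1: "z = 1" using z pos by simp
  then have "U * (b - (Q - w)) \<le> 0" using A by simp
  then have "b \<le> Q - w" using pos by (simp add: mult_le_0_iff)
  then have "b = Q - w" using bw by simp
  then show "a = P + 1" using hm a pos by simp
qed

text \<open>If every member of the first family contains one of two elements, then
  \<open>a \<le> 2 * (P - U)\<close>: the exceptional degrees \<open>P - U + 1\<close> come with
  \<open>a = P + 1\<close> and would need \<open>2 * U \<le> P + 1\<close>. But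
  \<open>2 * (P - U) * Q\<close> is at most \<open>P * (Q - w)\<close>, which is less than
  \<open>hm\<close>.\<close>

lemma no_double_star:
  assumes i: "ai \<le> P - U \<or> (ai = P - U + 1 \<and> a = P + 1)" and j: "aj \<le> P - U \<or> (aj = P - U + 1 \<and> a = P + 1)"
    and a: "a \<le> ai + aj" and hm: "hm \<le> a * b" and b: "0 \<le> b" "b \<le> Q"
  shows False
proof -
  have KU: "(N - K) * (P - U) = K * U" using PU by (simp add: algebra_simps)
  have q: "0 < N - K" "0 < N - L" using KLN by auto
  have "2 * U > P + 1"
  proof -
    have "(N - K) * (2 * U - P) = (N - 2 * K) * U" using PU by (simp add: algebra_simps)
    moreover have "(N - 2 * K) * U \<ge> 2 * (N - 1)"
    proof -
      have "2 * (N - 1) \<le> (N - 2 * K) * (N - 1)" using KLN by (intro mult_right_mono) auto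
      also have "\<dots> \<le> (N - 2 * K) * U" using KLN U_ge by (intro mult_left_mono) auto
      finally show ?thesis .
    qed
    moreover have "2 * (N - 1) > (N - K) * 1" using KLN by simp
    ultimately have "(N - K) * 1 < (N - K) * (2 * U - P)" by linarith
    then have "1 < 2 * U - P" using q by (simp only: mult_less_cancel_left_pos)
    then show ?thesis by simp
  qed
  then have c: "\<not> 2 * U \<le> P + 1" by simp
  have a2: "a \<le> 2 * (P - U)"
  proof (cases "ai \<le> P - U \<and> aj \<le> P - U")
    case True
    then show ?thesis using a by simp
  next
    case False
    then have "a = P + 1" "ai \<le> P - U + 1" "aj \<le> P - U + 1" using i j by auto
    then show ?thesis using a c by simp
  qed
  have "(N - L) * w \<le> (N - 2 * K) * V"
  proof -
    have "real (n - l) * w' = (real (n - l) - real (k - 1)) * real ((n - l) choose (k - 1))"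
      unfolding w'_def using binomial_down[of "k - 1" "n - l"] nkl by simp
    also have "\<dots> \<le> (N - 2 * K) * U"
    proof (rule mult_mono)
      show "real (n - l) - real (k - 1) \<le> N - 2 * K"
        using nkl kl k2 by (simp add: N_def K_def of_nat_diff)
      show "real ((n - l) choose (k - 1)) \<le> U" unfolding U_def
        using k2 kl by (intro of_nat_mono binomial_right_mono) auto
    qed (use KLN in auto)
    finally have "(N - L) * w' \<le> (N - 2 * K) * U" using nkl by (simp add: N_def L_def of_nat_diff)
    then have "(N - L) * w' * V \<le> (N - 2 * K) * U * V" using pos by (intro mult_right_mono) auto
    moreover have "(N - L) * w' * V = (N - L) * w * U" using wU by simp
    ultimately have "(N - L) * w * U \<le> (N - 2 * K) * U * V" by (simp only:)
    then have "U * ((N - L) * w) \<le> U * ((N - 2 * K) * V)" by (simp only: mult_ac)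
    then show ?thesis using pos by simp
  qed
  then have "(N * U) * ((N - L) * w) \<le> (N * U) * ((N - 2 * K) * V)" using KLN pos by (intro mult_left_mono) auto
  moreover have "(N - K) * (N - L) * (P * (Q - w)) = (N * U) * (N * V - (N - L) * w)"
  proof -
    have "(N - K) * (N - L) * (P * (Q - w)) = ((N - K) * P) * ((N - L) * Q - (N - L) * w)" by (simp add: algebra_simps)
    then show ?thesis unfolding PU QV .
  qed
  moreover have "(N - K) * (N - L) * (2 * (P - U) * Q) = 2 * (K * U) * (N * V)"
  proof -
    have "(N - K) * (N - L) * (2 * (P - U) * Q) = 2 * ((N - K) * (P - U)) * ((N - L) * Q)" by (simp add: algebra_simps)
    then show ?thesis unfolding KU QV .
  qed
  ultimately have "(N - K) * (N - L) * (2 * (P - U) * Q) \<le> (N - K) * (N - L) * (P * (Q - w))"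
    by (simp add: algebra_simps)
  then have "2 * (P - U) * Q \<le> P * (Q - w)" by (rule mult_left_le_imp_le) (use q in simp)
  moreover have "a * b \<le> 2 * (P - U) * Q" using a2 b pos by (intro mult_mono) auto
  ultimately have "hm \<le> P * (Q - w)" using hm by linarith
  then show False using pos by (simp add: algebra_simps)
qed

lemma w2: "(N - K - 1) * w2 = L * w"
proof -
  have e: "n - k - 1 - 1 = n - 2 - k" "l - 1 - 1 = l - 2" by auto
  have r: "real (n - k - 1) = N - K - 1" "real (l - 1) = L"
    using nkl kl k2 by (simp_all add: N_def K_def L_def of_nat_diff)
  have "real (n - k - 1) * real ((n - 2 - k) choose (l - 2)) = real (l - 1) * real ((n - k - 1) choose (l - 1))"
    using binomial_diag[of "l - 1" "n - k - 1"] kl k2 unfolding e by simp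
  then show ?thesis unfolding r w2_def w_def .
qed

text \<open>Here \<open>bi\<close> is the largest degree in the second family and \<open>a'\<close>
  the (truncated) number of members of the first avoiding that element. The first two inequalities
  are the product hypothesis of \<open>one_family_is_star\<close> on \<open>n - 1\<close> points,
  for the sizes \<open>k\<close>, \<open>l - 1\<close> and, when \<open>k = l\<close>, for the
  exchanged sizes \<open>k - 1\<close>, \<open>l\<close>. The last two exceed what is possible if a
  set on one side misses an element common to the other side.\<close>

lemma thresholds:
  assumes a': "0 \<le> a'" "U \<le> a' \<or> a - (P - U) \<le> a'" and bi: "real l * b \<le> real n * bi"
    and a: "a \<le> P + 1" and b: "0 \<le> b" "b \<le> Q" and hm: "hm \<le> a * b"
  shows "k < l \<Longrightarrow> (U + 1) * (Q - V - w2) \<le> a' * bi"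
    "k = l \<Longrightarrow> (Q - V + 1) * (U - w) \<le> a' * bi"
    "U * (Q - V - w2) < a' * bi" "(U - w') * (Q - V) < a' * bi"
proof -
  have l1: "real l = L + 1" "real n = N + 1" by (auto simp: L_def N_def)
  have K: "1 \<le> K" "K \<le> L" "2 * L + 1 \<le> N" "0 < N - K" "0 < N - L" "0 < N - K - 1" using KLN by auto
  have n0: "0 < N + 1" using K by simp
  have "a' * (real l * b) \<le> a' * (real n * bi)" using a'(1) bi by (rule mult_left_mono[rotated])
  then have T0: "(L + 1) * (a' * b) \<le> (N + 1) * (a' * bi)" unfolding l1 by (simp add: mult_ac)
  have "hm \<le> (P + 1) * b" using hm mult_right_mono[OF a b(1)] by simp
  then have bw: "Q - w \<le> b" using pos by simp
  \<comment> \<open>Either \<open>a'\<close> reaches \<open>U\<close> and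
    \<open>b \<ge> Q - w\<close> is used, or the sets containing the chosen element cost at most
    \<open>(P - U) * Q\<close> of the product \<open>hm\<close>.\<close>
  have T1: "U * (Q - w) \<le> a' * b \<or> U * Q + Q - (P + 1) * w \<le> a' * b"
  proof (cases "U \<le> a'")
    case True
    then have "U * (Q - w) \<le> a' * b" using bw pos b by (intro mult_mono) auto
    then show ?thesis by simp
  next
    case False
    then have "(a - (P - U)) * b \<le> a' * b" using a'(2) b by (intro mult_right_mono) auto
    moreover have "(P - U) * b \<le> (P - U) * Q" using b pos by (intro mult_left_mono) auto
    ultimately show ?thesis using hm by (simp add: algebra_simps)
  qed
  define G where "G = (N - K) * V - (N - L) * w"
  define G' where "G' = (N - K - 1) * V - (N - L) * w"
  define g where "g = V - (N - L) / (N - K) * w"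
  have gw: "V - w \<le> g"
  proof -
    have "(N - L) / (N - K) * w \<le> 1 * w" using K w_ge by (intro mult_right_mono) auto
    then show ?thesis by (simp add: g_def)
  qed
  have g0: "0 < g" using gw pos by simp
  have E: "(N - L) * (U * Q - P * w) = N * U * g"
  proof -
    have "P = N * U / (N - K)" using PU K by (simp add: field_simps)
    then have "(N - L) * (U * Q - P * w) = U * ((N - L) * Q) - (N - L) * (N * U / (N - K)) * w" by (simp add: algebra_simps)
    also have "\<dots> = N * U * g" unfolding QV by (simp add: g_def algebra_simps)
    finally show ?thesis .
  qed
  have T2: "U * Q - P * w \<le> a' * b"
  proof -
    have "U * Q - P * w \<le> U * (Q - w)" using pos w_ge by (simp add: algebra_simps)
    then show ?thesis using T1 pos by (auto simp: algebra_simps)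
  qed
  have T3: "(L + 1) * (N * U * g) \<le> (N - L) * ((N + 1) * (a' * bi))"
  proof -
    have "(L + 1) * (U * Q - P * w) \<le> (L + 1) * (a' * b)" using T2 K by (intro mult_left_mono) auto
    then have "(L + 1) * (U * Q - P * w) \<le> (N + 1) * (a' * bi)" using T0 by linarith
    then have "(N - L) * ((L + 1) * (U * Q - P * w)) \<le> (N - L) * ((N + 1) * (a' * bi))"
      using K by (intro mult_left_mono) auto
    moreover have "(N - L) * ((L + 1) * (U * Q - P * w)) = (L + 1) * ((N - L) * (U * Q - P * w))" by simp
    ultimately show ?thesis unfolding E by simp
  qed
  have Q': "(N - L) * (Q - V) = L * V" using QV by (simp add: algebra_simps)
  have W: "(N - L) * (Q - V - w2) \<le> L * g"
  proof -
    have "w2 = L * w / (N - K - 1)" using w2 K by (simp add: field_simps)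
    then have "(N - L) * (Q - V - w2) = L * (V - (N - L) / (N - K - 1) * w)" using Q' by (simp add: algebra_simps)
    also have "\<dots> \<le> L * g"
    proof -
      have "(N - L) / (N - K) * w \<le> (N - L) / (N - K - 1) * w"
        using K w_ge by (intro mult_right_mono divide_left_mono) auto
      then show ?thesis using K by (simp add: g_def)
    qed
    finally show ?thesis .
  qed
  \<comment> \<open>The share \<open>l / n\<close> from averaging against the share
    \<open>(l - 1) / (n - 1)\<close> of a full star that contains a given second element. This
    strict gap pays for all four inequalities.\<close>
  have LN: "(N + 1) * L < (L + 1) * N" using K by (simp add: algebra_simps)
  have cancel: "X \<le> a' * bi" if "(N - L) * ((N + 1) * X) \<le> (L + 1) * (N * U * g)" for X
  proof -
    have "((N - L) * (N + 1)) * X \<le> ((N - L) * (N + 1)) * (a' * bi)" using that T3 by (simp add: mult.assoc)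
    then show ?thesis by (rule mult_left_le_imp_le) (use K in simp)
  qed
  have cancel': "X < a' * bi" if "(N - L) * ((N + 1) * X) < (L + 1) * (N * U * g)" for X
  proof -
    have "((N - L) * (N + 1)) * X < ((N - L) * (N + 1)) * (a' * bi)" using that T3 by (simp add: mult.assoc)
    then show ?thesis using K by (simp add: mult_less_cancel_left_pos)
  qed
  have sLN: "(N + 1) * L * (U * g) < (L + 1) * N * (U * g)" using LN pos g0 by simp
  show "U * (Q - V - w2) < a' * bi"
  proof (rule cancel')
    have "(N - L) * ((N + 1) * (U * (Q - V - w2))) = (N + 1) * U * ((N - L) * (Q - V - w2))" by simp
    also have "\<dots> \<le> (N + 1) * U * (L * g)" using W K pos by (intro mult_left_mono) auto
    also have "\<dots> < (L + 1) * (N * U * g)" using sLN by (simp add: mult_ac)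
    finally show "(N - L) * ((N + 1) * (U * (Q - V - w2))) < (L + 1) * (N * U * g)" .
  qed
  show "(U - w') * (Q - V) < a' * bi"
  proof (rule cancel')
    have w'e: "w' = w * U / V" using wU pos by (simp add: field_simps)
    have "(N - L) * ((N + 1) * ((U - w') * (Q - V))) = (N + 1) * (U - w') * ((N - L) * (Q - V))" by simp
    also have "\<dots> = (N + 1) * L * (U * (V - w))"
      unfolding Q' w'e using pos by (simp add: field_simps)
    also have "\<dots> \<le> (N + 1) * L * (U * g)" using gw K pos by (intro mult_left_mono) auto
    also have "\<dots> < (L + 1) * (N * U * g)" using sLN by (simp add: mult_ac)
    finally show "(N - L) * ((N + 1) * ((U - w') * (Q - V))) < (L + 1) * (N * U * g)" .
  qed
  show "(U + 1) * (Q - V - w2) \<le> a' * bi" if "k < l"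
  proof (rule cancel)
    have c: "(N + 1) * L * (U + 1) \<le> (L + 1) * N * U"
    proof -
      have "(N + 1) * L \<le> (N - L) * (N - 1)"
      proof -
        have "(N - L) * (N - 1) - (N + 1) * L = N * (N - 1 - 2 * L)" by (simp add: algebra_simps)
        then show ?thesis using K by (smt (verit) mult_nonneg_nonneg)
      qed
      also have "\<dots> \<le> (N - L) * U" using U_ge K by (intro mult_left_mono) auto
      finally show ?thesis by (simp add: algebra_simps)
    qed
    have "(N - L) * ((N + 1) * ((U + 1) * (Q - V - w2))) = (N + 1) * (U + 1) * ((N - L) * (Q - V - w2))" by simp
    also have "\<dots> \<le> (N + 1) * (U + 1) * (L * g)" using W K pos by (intro mult_left_mono) auto
    also have "\<dots> = (N + 1) * L * (U + 1) * g" by simp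
    also have "\<dots> \<le> (L + 1) * N * U * g" using c g0 by (intro mult_right_mono) auto
    finally show "(N - L) * ((N + 1) * ((U + 1) * (Q - V - w2))) \<le> (L + 1) * (N * U * g)" by (simp add: mult.assoc)
  qed
  show "(Q - V + 1) * (U - w) \<le> a' * bi" if eq: "k = l"
  proof -
    have e: "P = Q" "U = V" unfolding P_def Q_def U_def V_def using eq by simp_all
    have x: "(L + 1) * Q - (N + 1) * (Q - U) = U"
    proof -
      have "(N - L) * ((L + 1) * Q - (N + 1) * (Q - U)) = (N - L) * U"
        using QV unfolding e by (simp add: algebra_simps)
      then show ?thesis using K by simp
    qed
    have "(N + 1) * ((Q - V + 1) * (U - w)) \<le> (L + 1) * (a' * b)"
      using T1
    proof
      assume h: "U * Q + Q - (P + 1) * w \<le> a' * b"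
      have "(L + 1) * (U * Q + Q - (P + 1) * w) - (N + 1) * ((Q - U + 1) * (U - w))
        = (U - w) * (((L + 1) * Q - (N + 1) * (Q - U)) + (L - N)) + (L + 1) * (Q - U)"
        unfolding e by (simp add: algebra_simps)
      moreover have "0 \<le> (U - w) * (U + (L - N))" using U_ge K pos e by (intro mult_nonneg_nonneg) auto
      moreover have "0 \<le> (L + 1) * (Q - U)" using K pos e by simp
      ultimately have "(N + 1) * ((Q - U + 1) * (U - w)) \<le> (L + 1) * (U * Q + Q - (P + 1) * w)" unfolding x by linarith
      also have "\<dots> \<le> (L + 1) * (a' * b)" using h K by (intro mult_left_mono) auto
      finally show ?thesis using e by simp
    next
      assume h: "U * (Q - w) \<le> a' * b"
      have "(L + 1) * (U * (Q - w)) - (N + 1) * ((Q - U + 1) * (U - w))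
        = ((L + 1) * Q - (N + 1) * (Q - U)) * (U - w) - (N + 1) * (U - w) + (L + 1) * w * (Q - U)"
        by (simp add: algebra_simps)
      then have d: "(L + 1) * (U * (Q - w)) - (N + 1) * ((Q - U + 1) * (U - w))
        = (U - (N + 1)) * (U - w) + (L + 1) * w * (Q - U)" unfolding x by (simp add: algebra_simps)
      have "0 \<le> (U - (N + 1)) * (U - w) + (L + 1) * w * (Q - U)"
      proof (cases "k = 2")
        \<comment> \<open>For \<open>k = 2\<close> the factor \<open>U - (N + 1)\<close> is
          \<open>-2\<close>, and the second summand has to outweigh it.\<close>
        case True
        have "U = N - 1" "Q = N" "w = N - 2"
          unfolding U_def Q_def w_def N_def using True eq nkl by (simp_all add: of_nat_diff)
        moreover have "2 * 1 \<le> (L + 1) * (N - 2)" using K by (intro mult_mono) auto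
        ultimately show ?thesis by simp
      next
        case False
        then have "3 \<le> l" using k2 eq by simp
        then have "(N - 1) * (N - 2) \<le> 2 * U" using V_ge e by simp
        moreover have "2 * (N + 1) \<le> (N - 1) * (N - 2)"
        proof -
          have "5 \<le> N" using \<open>3 \<le> l\<close> K by (simp add: L_def)
          then have "0 \<le> N * (N - 5)" by simp
          then show ?thesis by (simp add: algebra_simps)
        qed
        ultimately have "2 * (N + 1) \<le> 2 * U" by (rule order_trans[rotated])
        then have "N + 1 \<le> U" by simp
        then show ?thesis using pos e K w_ge by (intro add_nonneg_nonneg mult_nonneg_nonneg) auto
      qed
      then have "(N + 1) * ((Q - U + 1) * (U - w)) \<le> (L + 1) * (U * (Q - w))" using d by linarith
      also have "\<dots> \<le> (L + 1) * (a' * b)" using h K by (intro mult_left_mono) auto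
      finally show ?thesis using e by simp
    qed
    then have "(N + 1) * ((Q - V + 1) * (U - w)) \<le> (N + 1) * (a' * bi)" using T0 by linarith
    then show ?thesis by (rule mult_left_le_imp_le) (rule n0)
  qed
qed

end

section \<open>Links, degrees and the star theorem\<close>

definition link :: "nat \<Rightarrow> nat set set \<Rightarrow> nat set set" where
  "link i F = (\<lambda>A. A - {i}) ` {A\<in>F. i \<in> A}"

definition avoid :: "nat \<Rightarrow> nat set set \<Rightarrow> nat set set" where
  "avoid i F = {A\<in>F. i \<notin> A}"

lemma card_link: "card (link i F) = card {A\<in>F. i \<in> A}"
proof -
  have "inj_on (\<lambda>A. A - {i}) {A\<in>F. i \<in> A}"
    by (rule inj_onI) (metis (mono_tags, lifting) insert_Diff mem_Collect_eq)
  then show ?thesis unfolding link_def by (rule card_image)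
qed

lemma card_link_avoid:
  assumes "finite F"
  shows "card F = card (link i F) + card (avoid i F)"
proof -
  have "F = {A\<in>F. i \<in> A} \<union> avoid i F" by (auto simp: avoid_def)
  moreover have "{A\<in>F. i \<in> A} \<inter> avoid i F = {}" by (auto simp: avoid_def)
  moreover have "finite {A\<in>F. i \<in> A}" "finite (avoid i F)" using assms by (auto simp: avoid_def)
  ultimately show ?thesis unfolding card_link by (metis card_Un_disjoint)
qed

lemma link_nsets: "F \<subseteq> [S]\<^bsup>m\<^esup> \<Longrightarrow> link i F \<subseteq> [S - {i}]\<^bsup>(m - 1)\<^esup>"
  by (auto simp: link_def nsets_def)

lemma avoid_nsets: "F \<subseteq> [S]\<^bsup>m\<^esup> \<Longrightarrow> avoid i F \<subseteq> [S - {i}]\<^bsup>m\<^esup>"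
  by (auto simp: avoid_def nsets_def)

lemma cross_link:
  assumes "cross_intersecting \<A> \<B>"
  shows "cross_intersecting (link i \<A>) (avoid i \<B>)" "cross_intersecting (avoid i \<A>) (link i \<B>)"
proof -
  have *: "A \<inter> B \<noteq> {}" if "A \<in> \<A>" "B \<in> \<B>" for A B using assms that by (auto simp: cross_intersecting_def)
  have "(A - {i}) \<inter> B \<noteq> {}" if "A \<in> \<A>" "B \<in> \<B>" "i \<notin> B" for A B using *[OF that(1,2)] that(3) by auto
  then show "cross_intersecting (link i \<A>) (avoid i \<B>)"
    unfolding cross_intersecting_def link_def avoid_def by blast
  have "A \<inter> (B - {i}) \<noteq> {}" if "A \<in> \<A>" "B \<in> \<B>" "i \<notin> A" for A B using *[OF that(1,2)] that(3) by auto
  then show "cross_intersecting (avoid i \<A>) (link i \<B>)"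
    unfolding cross_intersecting_def link_def avoid_def by blast
qed

lemma card_star_meeting:
  fixes S A :: "nat set"
  assumes S: "finite S" "card S = g" and j: "j \<in> S" "j \<notin> A" and A: "A \<subseteq> S" "card A = c" and m: "1 \<le> m"
  shows "card {B\<in>[S]\<^bsup>m\<^esup>. j \<in> B \<and> A \<inter> B \<noteq> {}} = ((g - 1) choose (m - 1)) - ((g - 1 - c) choose (m - 1))"
proof -
  let ?F = "{B\<in>[S]\<^bsup>m\<^esup>. j \<in> B \<and> A \<inter> B \<noteq> {}}"
  have eq: "link j ?F = [S - {j}]\<^bsup>(m - 1)\<^esup> - [S - {j} - A]\<^bsup>(m - 1)\<^esup>"
  proof
    show "link j ?F \<subseteq> [S - {j}]\<^bsup>(m - 1)\<^esup> - [S - {j} - A]\<^bsup>(m - 1)\<^esup>"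
      using j by (auto simp: link_def nsets_def)
    show "[S - {j}]\<^bsup>(m - 1)\<^esup> - [S - {j} - A]\<^bsup>(m - 1)\<^esup> \<subseteq> link j ?F"
    proof
      fix T assume T: "T \<in> [S - {j}]\<^bsup>(m - 1)\<^esup> - [S - {j} - A]\<^bsup>(m - 1)\<^esup>"
      then have "finite T" "card T = m - 1" "j \<notin> T" by (auto simp: nsets_def)
      then have "card (insert j T) = m" using m by simp
      then have "insert j T \<in> ?F" using T j by (auto simp: nsets_def)
      moreover have "insert j T - {j} = T" using T by (auto simp: nsets_def)
      ultimately show "T \<in> link j ?F" unfolding link_def by (intro image_eqI[of _ _ "insert j T"]) auto
    qed
  qed
  have "{B\<in>?F. j \<in> B} = ?F" by auto
  then have "card ?F = card (link j ?F)" using card_link[of j ?F] by simp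
  also have "\<dots> = card ([S - {j}]\<^bsup>(m - 1)\<^esup>) - card ([S - {j} - A]\<^bsup>(m - 1)\<^esup>)"
    unfolding eq using S by (intro card_Diff_subset) (auto simp: finite_imp_finite_nsets nsets_def)
  also have "card (S - {j}) = g - 1" using S j by simp
  moreover have "card (S - {j} - A) = g - 1 - c"
  proof -
    have "A \<subseteq> S - {j}" using A j by auto
    then show ?thesis using S j A by (simp add: card_Diff_subset finite_subset)
  qed
  ultimately show ?thesis by (simp add: card_nsets)
qed

lemma card_star_meeting_le:
  fixes S A :: "nat set"
  assumes S: "finite S" "card S = g" and j: "j \<in> S" "j \<notin> A" and A: "A \<subseteq> S" "card A = c" and m: "1 \<le> m"
    and F: "F \<subseteq> [S]\<^bsup>m\<^esup>" "\<And>B. B \<in> F \<Longrightarrow> j \<in> B \<and> A \<inter> B \<noteq> {}"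
  shows "card F \<le> ((g - 1) choose (m - 1)) - ((g - 1 - c) choose (m - 1))"
proof -
  have "card F \<le> card {B\<in>[S]\<^bsup>m\<^esup>. j \<in> B \<and> A \<inter> B \<noteq> {}}"
    using F S by (intro card_mono) (auto simp: finite_imp_finite_nsets)
  then show ?thesis using card_star_meeting[OF S j A m] by simp
qed

lemma sum_degrees:
  assumes S: "finite S" and F: "F \<subseteq> [S]\<^bsup>m\<^esup>"
  shows "(\<Sum>i\<in>S. card (link i F)) = m * card F"
proof -
  have fin: "finite F" using F S by (meson finite_imp_finite_nsets finite_subset)
  have "(\<Sum>i\<in>S. card {A\<in>F. i \<in> A}) = sum (\<lambda>_. m) F"
  proof (rule sum_multicount_gen[OF S fin], intro ballI)
    fix A assume "A \<in> F"
    then have "A \<subseteq> S" "card A = m" using F by (auto simp: nsets_def)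
    moreover have "{i\<in>S. i \<in> A} = A" using calculation by auto
    ultimately show "card {i\<in>S. i \<in> A} = m" by simp
  qed
  then show ?thesis by (simp add: card_link mult.commute)
qed

lemma max_degree:
  assumes S: "finite S" "S \<noteq> {}" and F: "F \<subseteq> [S]\<^bsup>m\<^esup>"
  obtains i where "i \<in> S" "m * card F \<le> card S * card (link i F)"
proof -
  have "Max ((\<lambda>i. card (link i F)) ` S) \<in> (\<lambda>i. card (link i F)) ` S" using S by (intro Max_in) auto
  then obtain i where i: "i \<in> S" "card (link i F) = Max ((\<lambda>i. card (link i F)) ` S)" by auto
  have mx: "card (link j F) \<le> card (link i F)" if "j \<in> S" for j
    unfolding i(2) using S that by (intro Max_ge) auto
  have "(\<Sum>i\<in>S. card (link i F)) \<le> card S * card (link i F)"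
    using sum_bounded_above[of S "\<lambda>j. card (link j F)" "card (link i F)"] mx by simp
  then show ?thesis using that[OF i(1)] sum_degrees[OF S(1) F] by simp
qed

lemma nat_gap: "real x \<le> real y \<or> 1 \<le> real x - real y"
proof (cases "x \<le> y")
  case False
  then have "real (Suc y) \<le> real x" by (intro of_nat_mono) simp
  then show ?thesis by simp
qed simp

text \<open>For an element \<open>i\<close> of largest degree in \<open>\<B>\<close>,
  the pair (sets of \<open>\<A>\<close> avoiding \<open>i\<close>, link of \<open>i\<close> in \<open>\<B>\<close>) again has a large product, so by induction
  it has a common element \<open>j\<close>, and then both \<open>i\<close> and \<open>j\<close> have too small a degree in \<open>\<A>\<close>.\<close>

theorem one_family_is_star:
  assumes "finite S" "card S = n" "1 \<le> k" "k \<le> l" "2 * l \<le> n" "2 * k < n"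
    "\<A> \<subseteq> [S]\<^bsup>k\<^esup>" "\<B> \<subseteq> [S]\<^bsup>l\<^esup>" "cross_intersecting \<A> \<B>"
    "card \<A> \<le> ((n - 1) choose (k - 1)) + 1" "card \<B> \<le> (n - 1) choose (l - 1)"
    "(((n - 1) choose (k - 1)) + 1) * (((n - 1) choose (l - 1)) - ((n - k - 1) choose (l - 1))) \<le> card \<A> * card \<B>"
  shows "\<exists>i. (\<forall>A\<in>\<A>. i \<in> A) \<or> (\<forall>B\<in>\<B>. i \<in> B)"
  using assms
proof (induction n arbitrary: S k l \<A> \<B> rule: less_induct)
  case (less n)
  note S = less.prems(1,2) and A = less.prems(7) and B = less.prems(8) and ci = less.prems(9)
  have finA: "finite \<A>" and finB: "finite \<B>" using A B S by (meson finite_imp_finite_nsets finite_subset)+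
  have AD: "A \<subseteq> S" "finite A" "card A = k" if "A \<in> \<A>" for A using that A by (auto simp: nsets_def)
  have meet: "A \<inter> B \<noteq> {}" if "A \<in> \<A>" "B \<in> \<B>" for A B using ci that by (auto simp: cross_intersecting_def)
  show ?case
  proof (cases "k = 1")
    case True
    show ?thesis
    proof (cases "\<A> = {}")
      case False
      then obtain A where A1: "A \<in> \<A>" by blast
      then obtain x where "A = {x}" using AD[OF A1] True by (auto simp: card_1_singleton_iff)
      then show ?thesis using meet[OF A1] by auto
    qed simp
  next
    case False
    then interpret sizes n k l using less.prems by unfold_locales auto
    show ?thesis
    proof (rule ccontr)
      assume nostar: "\<not> ?thesis"
      define a b where "a = real (card \<A>)" and "b = real (card \<B>)"
      have wQ: "(n - k - 1) choose (l - 1) \<le> (n - 1) choose (l - 1)" by (intro binomial_right_mono) simp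
      have ab: "a \<le> P + 1" "b \<le> Q" "hm \<le> a * b" "0 \<le> a" "0 \<le> b"
      proof -
        show "a \<le> P + 1" unfolding a_def P_def using less.prems(10) by linarith
        show "b \<le> Q" unfolding b_def Q_def using less.prems(11) by simp
        have "real ((((n - 1) choose (k - 1)) + 1) * (((n - 1) choose (l - 1)) - ((n - k - 1) choose (l - 1)))) \<le> real (card \<A> * card \<B>)"
          using less.prems(12) by (simp only: of_nat_le_iff)
        then show "hm \<le> a * b"
          unfolding a_def b_def P_def Q_def w_def of_nat_mult of_nat_diff[OF wQ] of_nat_add of_nat_1 .
      qed (auto simp: a_def b_def)
      define aL aN bL bN where "aL i = real (card (link i \<A>))" and "aN i = real (card (avoid i \<A>))"
        and "bL i = real (card (link i \<B>))" and "bN i = real (card (avoid i \<B>))" for i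
      have split: "a = aL i + aN i" "b = bL i + bN i" for i
        using card_link_avoid[OF finA, of i] card_link_avoid[OF finB, of i]
        by (auto simp: a_def b_def aL_def bL_def aN_def bN_def)
      have nonempty: "1 \<le> aN i" "1 \<le> bN i" for i
      proof -
        have "avoid i \<A> \<noteq> {}" "avoid i \<B> \<noteq> {}" using nostar by (auto simp: avoid_def)
        moreover have "finite (avoid i \<A>)" "finite (avoid i \<B>)" using finA finB by (auto simp: avoid_def)
        ultimately show "1 \<le> aN i" "1 \<le> bN i" by (auto simp: aN_def bN_def Suc_le_eq card_gt_0_iff)
      qed
      have Si: "finite (S - {i})" "card (S - {i}) = n - 1" if "i \<in> S" for i using that S by auto
      have feas: "feasible (aN i) (bL i - (Q - V))" "feasible (aL i - (P - U)) (bN i)" if "i \<in> S" for i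
        unfolding aL_def aN_def bL_def bN_def
        using feasible_link_B[OF Si[OF that] avoid_nsets[OF A] link_nsets[OF B] cross_link(2)[OF ci]]
          feasible_link_A[OF Si[OF that] link_nsets[OF A] avoid_nsets[OF B] cross_link(1)[OF ci]] by auto
      have PUn: "P - U = real ((n - 2) choose (k - 2))" "Q - V = real ((n - 2) choose (l - 2))"
        using P_split Q_split by auto
      have gapA: "aL i \<le> P - U \<or> 1 \<le> aL i - (P - U)" for i
        unfolding PUn aL_def by (rule nat_gap)
      have gapB: "bL i \<le> Q - V \<or> 1 \<le> bL i - (Q - V)" for i
        unfolding PUn bL_def by (rule nat_gap)
      \<comment> \<open>A degree above \<open>Q - V\<close> in the second family or above
        \<open>P - U\<close> in the first puts one of the two smaller pairs within reach of
        \<open>sum_bound\<close>. The numerical lemmas exclude the former and allow the latter only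
        with excess exactly 1 and \<open>a = P + 1\<close>.\<close>
      have local: "bL i \<le> Q - V" "aL i \<le> P - U \<or> (aL i = P - U + 1 \<and> a = P + 1)" if i: "i \<in> S" for i
      proof -
        show bi: "bL i \<le> Q - V"
        proof (rule ccontr)
          assume "\<not> bL i \<le> Q - V"
          then have y: "1 \<le> bL i - (Q - V)" using gapB by auto
          have s1: "V * aN i + U * (bL i - (Q - V)) \<le> U * V - U * w + V"
            using sum_bound[OF feas(1)[OF i] nonempty(1) y] .
          show False
          proof (cases "aL i \<le> P - U")
            case True
            then have "a - (P - U) \<le> aN i" using split(1)[of i] by simp
            then show False using large_B_small_A_link[OF s1 _ y ab(3,2,4)] by simp
          next
            case False
            then have z: "1 \<le> aL i - (P - U)" using gapA by auto
            have s2: "V * (aL i - (P - U)) + U * bN i \<le> U * V - U * w + V"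
              using sum_bound[OF feas(2)[OF i] z nonempty(2)] .
            have "(aN i + (P - U + (aL i - (P - U)))) * (bN i + (Q - V + (bL i - (Q - V)))) < hm"
              by (rule both_links_large[OF s1 s2 _ _ nonempty(2) y]) (use split[of i] ab in auto)
            then have "a * b < hm" using split[of i] by (simp add: add.commute)
            then show False using ab(3) by simp
          qed
        qed
        show "aL i \<le> P - U \<or> (aL i = P - U + 1 \<and> a = P + 1)"
        proof (cases "aL i \<le> P - U")
          case False
          then have z: "1 \<le> aL i - (P - U)" using gapA by auto
          have s2: "V * (aL i - (P - U)) + U * bN i \<le> U * V - U * w + V"
            using sum_bound[OF feas(2)[OF i] z nonempty(2)] .
          have "b - (Q - V) \<le> bN i" using split(2)[of i] bi by simp
          then have "aL i - (P - U) = 1" "a = P + 1" using large_A_link[OF s2 _ z ab(3,1,5)] by auto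
          then show ?thesis by simp
        qed simp
      qed
      have "S \<noteq> {}" using S nk by auto
      then obtain i where i: "i \<in> S"
        and deg: "l * card \<B> \<le> card S * card (link i \<B>)" using max_degree[OF S(1) _ B] by blast
      define u where "u = (n - 2) choose (k - 1)"
      have u: "U = real u" by (simp add: u_def U_def)
      \<comment> \<open>The induction hypothesis limits the number of members of the first family.
        Truncating at \<open>U\<close> respects this limit and keeps what \<open>thresholds\<close>
        needs.\<close>
      define c where "c = min (card (avoid i \<A>)) u"
      have c: "0 \<le> real c" "U \<le> real c \<or> a - (P - U) \<le> real c" "real c \<le> U"
      proof -
        have "U \<le> aN i \<or> a - (P - U) \<le> aN i" using local(2)[OF i] split(1)[of i] by auto
        then show "U \<le> real c \<or> a - (P - U) \<le> real c" unfolding aN_def c_def u by (auto simp: min_def)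
        show "real c \<le> U" by (simp add: u c_def)
      qed simp
      have bi: "real l * b \<le> real n * bL i"
      proof -
        have "real (l * card \<B>) \<le> real (n * card (link i \<B>))" using deg S by (simp only: of_nat_le_iff)
        then show ?thesis by (simp add: b_def bL_def)
      qed
      note thr = thresholds[OF c(1,2) bi ab(1,5,2,3)]
      have "c \<le> card (avoid i \<A>)" by (simp add: c_def)
      then obtain \<A>' where A': "\<A>' \<subseteq> avoid i \<A>" "card \<A>' = c"
        by (metis obtain_subset_with_card_n)
      have A'n: "\<A>' \<subseteq> [S - {i}]\<^bsup>k\<^esup>" using A' avoid_nsets[OF A] by blast
      have Ln: "link i \<B> \<subseteq> [S - {i}]\<^bsup>(l - 1)\<^esup>" using link_nsets[OF B] .
      have ci': "cross_intersecting \<A>' (link i \<B>)"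
        using cross_link(2)[OF ci, of i] A'(1) by (auto simp: cross_intersecting_def)
      have cLnat: "card (link i \<B>) \<le> (n - 2) choose (l - 2)"
        using local(1)[OF i] unfolding PUn bL_def by simp
      have cu: "c \<le> (n - 2) choose (k - 1)" by (simp add: c_def u_def)
      have e1: "n - 1 - 1 = n - 2" "l - 1 - 1 = l - 2" "k - 1 - 1 = k - 2" "n - 1 - k - 1 = n - 2 - k"
        "n - 1 - (k - 1) - 1 = n - k - 1" using k2 by auto
      have "\<exists>j. (\<forall>A\<in>\<A>'. j \<in> A) \<or> (\<forall>B\<in>link i \<B>. j \<in> B)"
      proof (cases "k = l")
        case False
        then have kl': "k < l" using kl by simp
        have w2le: "(n - 2 - k) choose (l - 2) \<le> (n - 2) choose (l - 2)" by (intro binomial_right_mono) simp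
        have "real ((((n - 2) choose (k - 1)) + 1) * (((n - 2) choose (l - 2)) - ((n - 2 - k) choose (l - 2)))) \<le> real (c * card (link i \<B>))"
          using thr(1)[OF kl']
          unfolding U_def PUn w2_def bL_def of_nat_mult of_nat_diff[OF w2le] of_nat_add of_nat_1 .
        then have prod: "(((n - 2) choose (k - 1)) + 1) * (((n - 2) choose (l - 2)) - ((n - 2 - k) choose (l - 2))) \<le> c * card (link i \<B>)"
          by (simp only: of_nat_le_iff)
        show ?thesis
        proof (rule less.IH[of "n - 1" "S - {i}" k "l - 1", OF _ Si[OF i] _ _ _ _ A'n Ln ci'])
          show "card \<A>' \<le> ((n - 1 - 1) choose (k - 1)) + 1" unfolding e1 A'(2) using cu by simp
          show "card (link i \<B>) \<le> (n - 1 - 1) choose (l - 1 - 1)" unfolding e1 using cLnat .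
          show "(((n - 1 - 1) choose (k - 1)) + 1) * (((n - 1 - 1) choose (l - 1 - 1)) - ((n - 1 - k - 1) choose (l - 1 - 1)))
            \<le> card \<A>' * card (link i \<B>)" unfolding e1 A'(2) using prod .
        qed (use kl' k2 nl nk in linarith)+
      next
        \<comment> \<open>When \<open>k = l\<close>, the link in the second family has the smaller
          sets, so the two families change places in the induction hypothesis.\<close>
        case True
        have wle: "(n - k - 1) choose (l - 1) \<le> (n - 2) choose (k - 1)" using True k2 by (auto intro: binomial_right_mono)
        have "real ((((n - 2) choose (l - 2)) + 1) * (((n - 2) choose (k - 1)) - ((n - k - 1) choose (l - 1)))) \<le> real (card (link i \<B>) * c)"
          using thr(2)[OF True]
          unfolding U_def PUn w_def bL_def of_nat_mult of_nat_diff[OF wle] of_nat_add of_nat_1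
          by (simp only: mult.commute)
        then have prod: "(((n - 2) choose (l - 2)) + 1) * (((n - 2) choose (k - 1)) - ((n - k - 1) choose (l - 1))) \<le> card (link i \<B>) * c"
          by (simp only: of_nat_le_iff)
        have ci'': "cross_intersecting (link i \<B>) \<A>'" using ci' by (auto simp: cross_intersecting_def)
        have "\<exists>j. (\<forall>B\<in>link i \<B>. j \<in> B) \<or> (\<forall>A\<in>\<A>'. j \<in> A)"
        proof (rule less.IH[of "n - 1" "S - {i}" "k - 1" l, OF _ Si[OF i] _ _ _ _ _ _ ci''])
          show "link i \<B> \<subseteq> [S - {i}]\<^bsup>(k - 1)\<^esup>" "\<A>' \<subseteq> [S - {i}]\<^bsup>l\<^esup>" using Ln A'n True by simp_all
          show "card (link i \<B>) \<le> ((n - 1 - 1) choose (k - 1 - 1)) + 1" unfolding e1 using cLnat True by simp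
          show "card \<A>' \<le> (n - 1 - 1) choose (l - 1)" unfolding e1 A'(2) using cu True by simp
          show "(((n - 1 - 1) choose (k - 1 - 1)) + 1) * (((n - 1 - 1) choose (l - 1)) - ((n - 1 - (k - 1) - 1) choose (l - 1)))
            \<le> card (link i \<B>) * card \<A>'" unfolding e1 A'(2) using prod True by simp
        qed (use True k2 nl nk in linarith)+
        then show ?thesis by blast
      qed
      then obtain j where j: "(\<forall>A\<in>\<A>'. j \<in> A) \<or> (\<forall>B\<in>link i \<B>. j \<in> B)" by blast
      have "0 < real c * bL i"
      proof -
        have "0 \<le> (U - w') * (Q - V)"
        proof -
          have "w' \<le> U" unfolding w'_def U_def using kl k2 by (intro of_nat_mono binomial_right_mono) auto
          then show ?thesis using pos by simp
        qed
        then show ?thesis using thr(4) by linarith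
      qed
      then have ne: "\<A>' \<noteq> {}" "link i \<B> \<noteq> {}" using A'(2) by (auto simp: bL_def)
      \<comment> \<open>If some member of the link missed \<open>j\<close>, then
        \<open>\<A>'\<close> would consist of sets through \<open>j\<close> meeting that member, at
        most \<open>U - w'\<close> of them, against the last threshold.\<close>
      have linkj: "\<forall>B\<in>link i \<B>. j \<in> B"
      proof (rule ccontr)
        assume n: "\<not> (\<forall>B\<in>link i \<B>. j \<in> B)"
        then have jA: "\<forall>A\<in>\<A>'. j \<in> A" using j by blast
        obtain B where Bl: "B \<in> link i \<B>" "j \<notin> B" using n by blast
        then have BS: "B \<subseteq> S - {i}" "card B = l - 1" using Ln by (auto simp: nsets_def)
        have jS: "j \<in> S - {i}" using ne(1) jA A'n by (auto simp: nsets_def)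
        have "card \<A>' \<le> ((n - 1 - 1) choose (k - 1)) - ((n - 1 - 1 - (l - 1)) choose (k - 1))"
          by (rule card_star_meeting_le[OF Si[OF i] jS Bl(2) BS _ A'n])
            (use k2 jA ci' Bl(1) in \<open>auto simp: cross_intersecting_def\<close>)
        moreover have e3: "n - 2 - (l - 1) = n - l - 1" using k2 kl by auto
        ultimately have "c \<le> u - ((n - l - 1) choose (k - 1))" unfolding A'(2) u_def e1(1) e3 by blast
        moreover have "(n - l - 1) choose (k - 1) \<le> u" unfolding u_def using kl k2 by (intro binomial_right_mono) auto
        ultimately have "real c \<le> U - w'" unfolding u w'_def by (metis of_nat_diff of_nat_mono)
        moreover have "0 \<le> bL i" by (simp add: bL_def)
        ultimately have "real c * bL i \<le> (U - w') * (Q - V)" using local(1)[OF i] c(1) pos by (intro mult_mono) auto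
        then show False using thr(4) by simp
      qed
      have jS: "j \<in> S - {i}" using ne(2) linkj Ln by (auto simp: nsets_def)
      \<comment> \<open>This holds for all members avoiding \<open>i\<close>, not only for the
        truncated family that produced \<open>j\<close>: one such member missing \<open>j\<close>
        would limit the link to \<open>Q - V - w2\<close> sets, against the third threshold.\<close>
      have avoidj: "j \<in> A" if A1: "A \<in> avoid i \<A>" for A
      proof (rule ccontr)
        assume jA: "j \<notin> A"
        have AS: "A \<subseteq> S - {i}" "card A = k" using A1 AD by (auto simp: avoid_def)
        have "card (link i \<B>) \<le> ((n - 1 - 1) choose (l - 1 - 1)) - ((n - 1 - 1 - k) choose (l - 1 - 1))"
          by (rule card_star_meeting_le[OF Si[OF i] jS jA AS _ Ln])
            (use k2 kl linkj cross_link(2)[OF ci, of i] A1 in \<open>auto simp: cross_intersecting_def\<close>)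
        moreover have "(n - 2 - k) choose (l - 2) \<le> (n - 2) choose (l - 2)" by (intro binomial_right_mono) auto
        ultimately have "bL i \<le> Q - V - w2" unfolding e1 PUn w2_def bL_def by (metis of_nat_diff of_nat_mono)
        moreover have "0 \<le> bL i" by (simp add: bL_def)
        ultimately have "real c * bL i \<le> U * (Q - V - w2)" using c by (intro mult_mono) auto
        then show False using thr(3) by simp
      qed
      have "a \<le> aL i + aL j"
      proof -
        have "\<A> \<subseteq> {A\<in>\<A>. i \<in> A} \<union> {A\<in>\<A>. j \<in> A}" using avoidj by (auto simp: avoid_def)
        then have "card \<A> \<le> card ({A\<in>\<A>. i \<in> A} \<union> {A\<in>\<A>. j \<in> A})"
          using finA by (intro card_mono) auto
        also have "\<dots> \<le> card {A\<in>\<A>. i \<in> A} + card {A\<in>\<A>. j \<in> A}" by (rule card_Un_le)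
        finally have "card \<A> \<le> card {A\<in>\<A>. i \<in> A} + card {A\<in>\<A>. j \<in> A}" .
        then show ?thesis unfolding a_def aL_def card_link by simp
      qed
      then show False using no_double_star[OF local(2)[OF i] local(2)[of j] _ ab(3,5,2)] jS by blast
    qed
  qed
qed

section \<open>Extremal pairs\<close>

lemma link_star:
  assumes "i \<in> S" "1 \<le> m"
  shows "link i {B\<in>[S]\<^bsup>m\<^esup>. i \<in> B \<and> R (B - {i})} = {T\<in>[S - {i}]\<^bsup>(m - 1)\<^esup>. R T}"
proof
  show "link i {B\<in>[S]\<^bsup>m\<^esup>. i \<in> B \<and> R (B - {i})} \<subseteq> {T\<in>[S - {i}]\<^bsup>(m - 1)\<^esup>. R T}"
    by (auto simp: link_def nsets_def)
  show "{T\<in>[S - {i}]\<^bsup>(m - 1)\<^esup>. R T} \<subseteq> link i {B\<in>[S]\<^bsup>m\<^esup>. i \<in> B \<and> R (B - {i})}"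
  proof
    fix T assume "T \<in> {T\<in>[S - {i}]\<^bsup>(m - 1)\<^esup>. R T}"
    then have T: "T \<subseteq> S - {i}" "finite T" "card T = m - 1" "R T" "i \<notin> T" by (auto simp: nsets_def)
    then have "insert i T - {i} = T" "card (insert i T) = m" using assms by auto
    then show "T \<in> link i {B\<in>[S]\<^bsup>m\<^esup>. i \<in> B \<and> R (B - {i})}"
      unfolding link_def using T assms by (intro image_eqI[of _ _ "insert i T"]) (auto simp: nsets_def)
  qed
qed

lemma card_star:
  fixes S :: "nat set"
  assumes "finite S" "i \<in> S" "1 \<le> m"
  shows "card {B\<in>[S]\<^bsup>m\<^esup>. i \<in> B} = (card S - 1) choose (m - 1)"
proof -
  have "{A\<in>{B\<in>[S]\<^bsup>m\<^esup>. i \<in> B}. i \<in> A} = {B\<in>[S]\<^bsup>m\<^esup>. i \<in> B}" by auto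
  then have "card {B\<in>[S]\<^bsup>m\<^esup>. i \<in> B} = card (link i {B\<in>[S]\<^bsup>m\<^esup>. i \<in> B})" by (simp add: card_link)
  also have "link i {B\<in>[S]\<^bsup>m\<^esup>. i \<in> B} = [S - {i}]\<^bsup>(m - 1)\<^esup>" using link_star[of i S m "\<lambda>_. True"] assms by simp
  finally show ?thesis using assms by (simp add: card_nsets)
qed

lemma card_double_star:
  fixes S :: "nat set"
  assumes S: "finite S" and xy: "x \<in> S" "y \<in> S" "x \<noteq> y" and m: "2 \<le> m"
  shows "card {B\<in>[S]\<^bsup>m\<^esup>. x \<in> B \<and> y \<in> B} = (card S - 2) choose (m - 2)"
proof -
  let ?F = "{B\<in>[S]\<^bsup>m\<^esup>. x \<in> B \<and> y \<in> B}"
  have "{A\<in>?F. x \<in> A} = ?F" by auto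
  then have "card ?F = card (link x ?F)" using card_link[of x ?F] by simp
  also have "link x ?F = {T\<in>[S - {x}]\<^bsup>(m - 1)\<^esup>. y \<in> T}"
  proof -
    have "?F = {B\<in>[S]\<^bsup>m\<^esup>. x \<in> B \<and> y \<in> B - {x}}" using xy by auto
    then show ?thesis using link_star[of x S m "\<lambda>T. y \<in> T"] xy m by simp
  qed
  also have "card \<dots> = (card S - 1 - 1) choose (m - 1 - 1)" using card_star[of "S - {x}" y "m - 1"] S xy m by simp
  finally show ?thesis by (simp add: numeral_2_eq_2)
qed

lemma card_two_cover:
  fixes S :: "nat set"
  assumes S: "finite S" and xy: "x \<in> S" "y \<in> S" "x \<noteq> y"
  shows "card {B\<in>[S]\<^bsup>m\<^esup>. x \<in> B \<or> y \<in> B} = (card S choose m) - ((card S - 2) choose m)"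
proof -
  have "{B\<in>[S]\<^bsup>m\<^esup>. x \<in> B \<or> y \<in> B} = [S]\<^bsup>m\<^esup> - [S - {x, y}]\<^bsup>m\<^esup>" by (auto simp: nsets_def)
  moreover have "[S - {x, y}]\<^bsup>m\<^esup> \<subseteq> [S]\<^bsup>m\<^esup>" by (auto simp: nsets_def)
  moreover have "card (S - {x, y}) = card S - 2" using S xy by simp
  ultimately show ?thesis using S by (simp add: card_Diff_subset finite_imp_finite_nsets card_nsets)
qed

text \<open>The members of the shadow that contain \<open>v\<close> include the raised shadow of the
  link. Those missing \<open>v\<close> include both the link itself and the shadow of the sets
  avoiding \<open>v\<close>; either may be counted.\<close>

lemma card_level_split:
  assumes S: "finite S" and F: "F \<subseteq> [S]\<^bsup>m\<^esup>" and m: "2 \<le> m"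
  shows "card (level (link v F) (m - 2)) + card (link v F) \<le> card (level F (m - 1))"
    "card (level (link v F) (m - 2)) + card (level (avoid v F) (m - 1)) \<le> card (level F (m - 1))"
proof -
  note link = link_nsets[OF F, of v] and avoid = avoid_nsets[OF F, of v]
  have finl: "finite (level F (m - 1))" using finite_level[OF S, of F] F unfolding nsets_def by blast
  have v1: "v \<notin> T" "finite T" "card T = m - 2" if "T \<in> level (link v F) (m - 2)" for T
    using that link by (auto simp: level_def nsets_def)
  have "inj_on (insert v) (level (link v F) (m - 2))" by (rule inj_onI) (metis v1(1) insert_ident)
  then have c: "card (insert v ` level (link v F) (m - 2)) = card (level (link v F) (m - 2))" by (rule card_image)
  have i: "insert v ` level (link v F) (m - 2) \<subseteq> {T\<in>level F (m - 1). v \<in> T}"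
  proof
    fix X assume "X \<in> insert v ` level (link v F) (m - 2)"
    then obtain T A where T: "X = insert v T" "T \<in> level (link v F) (m - 2)" "A \<in> F" "v \<in> A" "T \<subseteq> A - {v}"
      by (auto simp: level_def link_def)
    have "card X = m - 1" using v1[OF T(2)] T(1) m by simp
    then show "X \<in> {T\<in>level F (m - 1). v \<in> T}" using T v1[OF T(2)] by (auto simp: level_def)
  qed
  have j: "link v F \<subseteq> {T\<in>level F (m - 1). v \<notin> T}"
  proof
    fix T assume T: "T \<in> link v F"
    then obtain A where "A \<in> F" "T = A - {v}" by (auto simp: link_def)
    then show "T \<in> {T\<in>level F (m - 1). v \<notin> T}" using T link by (auto simp: level_def nsets_def)
  qed
  have k: "level (avoid v F) (m - 1) \<subseteq> {T\<in>level F (m - 1). v \<notin> T}"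
    by (auto simp: level_def avoid_def)
  have s: "card {T\<in>level F (m - 1). v \<in> T} + card {T\<in>level F (m - 1). v \<notin> T} = card (level F (m - 1))"
  proof -
    have "{T\<in>level F (m - 1). v \<in> T} \<union> {T\<in>level F (m - 1). v \<notin> T} = level F (m - 1)"
      "{T\<in>level F (m - 1). v \<in> T} \<inter> {T\<in>level F (m - 1). v \<notin> T} = {}" by auto
    then show ?thesis using finl by (metis card_Un_disjoint finite_Un)
  qed
  have fl: "finite {T\<in>level F (m - 1). v \<in> T}" "finite {T\<in>level F (m - 1). v \<notin> T}" using finl by auto
  show "card (level (link v F) (m - 2)) + card (link v F) \<le> card (level F (m - 1))"
    using card_mono[OF fl(1) i] card_mono[OF fl(2) j] s c by linarith
  show "card (level (link v F) (m - 2)) + card (level (avoid v F) (m - 1)) \<le> card (level F (m - 1))"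
    using card_mono[OF fl(1) i] card_mono[OF fl(2) k] s c by linarith
qed

text \<open>If a vertex had too small a degree, the shadows of its link and of the sets avoiding it would
  exceed the bound, by strict concavity.\<close>

lemma clique_degree:
  assumes S: "finite S" and F: "F \<subseteq> [S]\<^bsup>m\<^esup>" and m: "2 \<le> m" "m \<le> N"
    and c: "card F = N choose m" and s: "card (level F (m - 1)) \<le> N choose (m - 1)" and v: "v \<in> \<Union>F"
  shows "card (link v F) = (N - 1) choose (m - 1)"
proof -
  define f where "f = real (card (link v F))"
  define d where "d = real ((N - 1) choose (m - 1))"
  define d' where "d' = real ((N - 1) choose (m - 2))"
  have finF: "finite F" using F S by (meson finite_imp_finite_nsets finite_subset)
  have e: "m - 1 - 1 = m - 2" by simp
  have pas: "real (N choose m) = real ((N - 1) choose m) + d" "real (N choose (m - 1)) = d' + d"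
    using choose_reduce_nat[of N m] choose_reduce_nat[of N "m - 1"] m unfolding e by (auto simp: d_def d'_def)
  have sr: "real (card (level F (m - 1))) \<le> d' + d" using s unfolding pas(2)[symmetric] by simp
  have ls: "real (card (level (link v F) (m - 2))) + f \<le> d' + d"
    "real (card (level (link v F) (m - 2))) + real (card (level (avoid v F) (m - 1))) \<le> d' + d"
    using card_level_split[OF S F m(1), of v] sr unfolding f_def by linarith+
  have f1: "1 \<le> f"
  proof -
    obtain A where "A \<in> F" "v \<in> A" using v by auto
    then have "link v F \<noteq> {}" by (auto simp: link_def)
    moreover have "finite (link v F)" using finF by (simp add: link_def)
    ultimately show ?thesis by (auto simp: f_def Suc_le_eq card_gt_0_iff)
  qed
  have Lk: "cascade 0 0 i j t (m - 2) \<le> card (level (link v F) (m - 2))"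
    if "m - 1 \<le> i" "i \<le> j" "0 \<le> t" "t \<le> 1" "cascade 0 0 i j t (m - 1) \<le> f" for i j t
    by (rule chord_level[OF _ link_nsets[OF F]]) (use S that m in \<open>auto simp: f_def\<close>)
  have unit: "real ((m - 1) choose (m - 2)) = real m - 1"
  proof -
    obtain m' where "m = Suc (Suc m')" using m by (metis add_2_eq_Suc le_Suc_ex)
    then show ?thesis by simp
  qed
  have "f \<le> d"
  proof (rule ccontr)
    assume "\<not> f \<le> d"
    then have "d' \<le> card (level (link v F) (m - 2))"
      using Lk[of "N - 1" "N - 1" 0] m by (simp add: cascade_def d_def d'_def)
    then show False using ls(1) \<open>\<not> f \<le> d\<close> by simp
  qed
  moreover have "\<not> f < d"
  proof
    assume lt: "f < d"
    then have "card (link v F) < (N - 1) choose (m - 1)" unfolding f_def d_def of_nat_less_iff .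
    then have "real (Suc (card (link v F))) \<le> d" unfolding d_def by (intro of_nat_mono) simp
    then have "f + 1 \<le> d" by (simp add: f_def)
    then have d2: "2 \<le> d" using f1 by simp
    have mN: "m < N"
    proof (rule ccontr)
      assume "\<not> m < N"
      then show False using m d2 by (simp add: d_def)
    qed
    have "f \<le> d" using lt by simp
    obtain t where t: "0 \<le> t" "t \<le> 1" "f = (1 - t) + t * d" using convex_weight[OF f1 \<open>f \<le> d\<close>] .
    \<comment> \<open>Both \<open>f\<close> and the excess \<open>d - f\<close> of the sets avoiding
      \<open>v\<close> over their leading term lie on the chord from 1 to \<open>d\<close>. Their
      weights add up to slightly less than 1, namely \<open>(t + u) * (d - 1) = d - 2\<close>, so
      the constant parts of the two chords are counted once too often.\<close>
    have g1: "1 \<le> d - f" "d - f \<le> d" using \<open>f + 1 \<le> d\<close> f1 by auto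
    obtain u where u: "0 \<le> u" "u \<le> 1" "d - f = (1 - u) + u * d" using convex_weight[OF g1] .
    have "cascade 0 0 (m - 1) (N - 1) t (m - 2) \<le> card (level (link v F) (m - 2))"
      using Lk[of "m - 1" "N - 1" t] m t mN by (simp add: cascade_def d_def)
    then have L1: "(1 - t) * (real m - 1) + t * d' \<le> card (level (link v F) (m - 2))"
      using unit by (simp add: cascade_def d'_def)
    have "real (card (avoid v F)) = real ((N - 1) choose m) + (d - f)"
      using card_link_avoid[OF finF, of v] c pas(1) unfolding f_def by simp
    then have "cascade 1 (N - 1) (m - 1) (N - 1) u m \<le> card (avoid v F)"
      using u(3) by (simp add: cascade_def d_def)
    then have "cascade 1 (N - 1) (m - 1) (N - 1) u (m - 1) \<le> card (level (avoid v F) (m - 1))"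
      by (intro chord_level[OF _ avoid_nsets[OF F]]) (use S m u mN in auto)
    then have L2: "d + (1 - u) * (real m - 1) + u * d' \<le> card (level (avoid v F) (m - 1))"
      using unit by (simp add: cascade_def d_def d'_def numeral_2_eq_2)
    have "(1 - t) * (real m - 1) + t * d' + ((1 - u) * (real m - 1) + u * d') \<le> d'"
      using L1 L2 ls(2) by linarith
    then have A: "(2 - (t + u)) * (real m - 1) + (t + u) * d' \<le> d'" by (simp add: algebra_simps)
    have tu: "(t + u) * (d - 1) = d - 2" using t(3) u(3) by (simp add: algebra_simps)
    have "(d - 1) * ((2 - (t + u)) * (real m - 1) + (t + u) * d') \<le> (d - 1) * d'"
      using A d2 by (intro mult_left_mono) auto
    moreover have "(d - 1) * ((2 - (t + u)) * (real m - 1) + (t + u) * d')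
      = (2 * (d - 1) - (t + u) * (d - 1)) * (real m - 1) + ((t + u) * (d - 1)) * d'" by (simp add: algebra_simps)
    ultimately have "d * (real m - 1) \<le> d'" unfolding tu by (simp add: algebra_simps)
    moreover have "d' * (real N - real m + 1) = d * (real m - 1)"
    proof -
      have "real (N - 1) * real ((N - 2) choose (m - 2)) = real (m - 1) * d"
        using binomial_diag[of "m - 1" "N - 1"] m unfolding e d_def by (simp add: numeral_2_eq_2)
      moreover have "real (N - 1) * real ((N - 2) choose (m - 2)) = (real (N - 1) - real (m - 2)) * d'"
        using binomial_down[of "m - 2" "N - 1"] m unfolding d'_def by (simp add: numeral_2_eq_2)
      ultimately show ?thesis using m by (simp add: of_nat_diff mult.commute algebra_simps)
    qed
    moreover have "0 < d'" using m by (simp add: d'_def)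
    then have "d' * 1 < d' * (real N - real m + 1)" using mN by (intro mult_strict_left_mono) auto
    ultimately show False by simp
  qed
  ultimately have "f = d" by simp
  then show ?thesis unfolding f_def d_def by simp
qed

text \<open>One set too many on level \<open>m - 1\<close> would, by the chord with leading index
  \<open>N\<close>, give at least one too many on level \<open>r\<close>. So the hypothesis moves up
  to level \<open>m - 1\<close>, where \<open>clique_degree\<close> makes all degrees equal; the
  degree sum then yields exactly \<open>N\<close> vertices.\<close>

lemma clique_of_small_level:
  assumes S: "finite S" and F: "F \<subseteq> [S]\<^bsup>m\<^esup>" and m: "m \<le> N" and r: "1 \<le> r" "r < m"
    and c: "card F = N choose m" and s: "card (level F r) \<le> N choose r"
  obtains T where "T \<subseteq> S" "card T = N" "F = [T]\<^bsup>m\<^esup>"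
proof -
  have m2: "2 \<le> m" using r by simp
  have step: "level F r = level (level F (m - 1)) r"
  proof (rule set_eqI)
    fix X
    have "\<exists>Y. card Y = m - 1 \<and> finite Y \<and> X \<subseteq> Y \<and> Y \<subseteq> A" if A: "A \<in> F" "X \<subseteq> A" "card X = r" for A
    proof -
      have "finite A" "card A = m" using F A(1) by (auto simp: nsets_def)
      moreover have le: "r \<le> m - 1" using r by simp
      ultimately obtain Y where "X \<subseteq> Y" "Y \<subseteq> A" "card Y = m - 1"
        using exists_subset_between[of X "m - 1" A] A le by auto
      then show ?thesis using \<open>finite A\<close> finite_subset by blast
    qed
    then show "X \<in> level F r \<longleftrightarrow> X \<in> level (level F (m - 1)) r"
      unfolding level_def by (smt (verit, best) mem_Collect_eq subset_trans)
  qed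
  have s1: "card (level F (m - 1)) \<le> N choose (m - 1)"
  proof (rule ccontr)
    assume "\<not> ?thesis"
    then have big: "real (N choose (m - 1)) + 1 \<le> card (level F (m - 1))" by simp
    have "cascade 1 N (m - 2) (m - 2) 0 r \<le> card (level (level F (m - 1)) r)"
      by (rule chord_level[OF S level_nsets[OF S F]]) (use r m big in \<open>auto simp: cascade_def numeral_2_eq_2\<close>)
    moreover have "1 \<le> (m - 2) choose (r - 1)" using r by (simp add: Suc_le_eq)
    ultimately have "real (N choose r) + 1 \<le> card (level F r)" unfolding step by (simp add: cascade_def)
    then show False using s by simp
  qed
  define T where "T = \<Union>F"
  have TS: "T \<subseteq> S" using F by (auto simp: T_def nsets_def)
  have finT: "finite T" using TS S by (rule finite_subset)
  have FT: "F \<subseteq> [T]\<^bsup>m\<^esup>" using F by (auto simp: T_def nsets_def)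
  have "m * (N choose m) = (\<Sum>v\<in>T. card (link v F))" using sum_degrees[OF finT FT] c by simp
  also have "\<dots> = card T * ((N - 1) choose (m - 1))"
    using clique_degree[OF S F m2 m c s1] by (simp add: T_def)
  finally have "N * ((N - 1) choose (m - 1)) = card T * ((N - 1) choose (m - 1))"
    using times_binomial_minus1_eq[of m N] m2 by simp
  then have cT: "card T = N" using m m2 by (auto simp: binomial_eq_0_iff)
  have "F = [T]\<^bsup>m\<^esup>"
    using FT finT c cT by (intro card_subset_eq) (auto simp: finite_imp_finite_nsets card_nsets)
  then show ?thesis using that TS cT by blast
qed

section \<open>Permutations and label-free extremal pairs\<close>

lemma exists_permutes:
  assumes S: "finite S" and X: "X \<subseteq> S" "X' \<subseteq> S" "X \<inter> X' = {}" and Y: "Y \<subseteq> S" "Y' \<subseteq> S" "Y \<inter> Y' = {}"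
    and c: "card X = card Y" "card X' = card Y'"
  obtains \<sigma> where "\<sigma> permutes S" "\<sigma> ` X = Y" "\<sigma> ` X' = Y'"
proof -
  have fin: "finite X" "finite X'" "finite Y" "finite Y'" using S X Y finite_subset by blast+
  obtain f where f: "bij_betw f X Y" using finite_same_card_bij[OF fin(1,3) c(1)] by blast
  obtain f' where f': "bij_betw f' X' Y'" using finite_same_card_bij[OF fin(2,4) c(2)] by blast
  have "card (S - (X \<union> X')) = card (S - (Y \<union> Y'))"
    using S X Y c fin by (simp add: card_Diff_subset card_Un_disjoint)
  then obtain h where h: "bij_betw h (S - (X \<union> X')) (S - (Y \<union> Y'))"
    using finite_same_card_bij[of "S - (X \<union> X')" "S - (Y \<union> Y')"] S by auto
  define \<sigma> where "\<sigma> x = (if x \<in> X then f x else if x \<in> X' then f' x else if x \<in> S then h x else x)" for x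
  have b1: "bij_betw \<sigma> X Y" using f by (rule bij_betw_cong[THEN iffD1, rotated]) (simp add: \<sigma>_def)
  have b2: "bij_betw \<sigma> X' Y'" using f' by (rule bij_betw_cong[THEN iffD1, rotated]) (use X in \<open>auto simp: \<sigma>_def\<close>)
  have b3: "bij_betw \<sigma> (S - (X \<union> X')) (S - (Y \<union> Y'))"
    using h by (rule bij_betw_cong[THEN iffD1, rotated]) (auto simp: \<sigma>_def)
  have "bij_betw \<sigma> (X \<union> X') (Y \<union> Y')" using b1 b2 Y(3) by (rule bij_betw_combine)
  then have "bij_betw \<sigma> ((X \<union> X') \<union> (S - (X \<union> X'))) ((Y \<union> Y') \<union> (S - (Y \<union> Y')))"
    using b3 by (rule bij_betw_combine) auto
  moreover have "(X \<union> X') \<union> (S - (X \<union> X')) = S" "(Y \<union> Y') \<union> (S - (Y \<union> Y')) = S" using X Y by auto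
  ultimately have "bij_betw \<sigma> S S" by simp
  then have "\<sigma> permutes S" by (rule bij_imp_permutes) (use X in \<open>auto simp: \<sigma>_def\<close>)
  then show ?thesis using that b1 b2 by (simp add: bij_betw_def)
qed

lemma permutes_image_nsets:
  assumes p: "\<sigma> permutes S" and R: "\<And>A. A \<subseteq> S \<Longrightarrow> R' (\<sigma> ` A) \<longleftrightarrow> R A"
  shows "(\<lambda>A. \<sigma> ` A) ` {A\<in>[S]\<^bsup>m\<^esup>. R A} = {A\<in>[S]\<^bsup>m\<^esup>. R' A}"
proof -
  have inj: "inj \<sigma>" using p by (rule permutes_inj)
  have im: "\<sigma> ` S = S" using p by (rule permutes_image)
  have ci: "card (\<sigma> ` A) = card A" for A using inj by (intro card_image) (auto intro: inj_on_subset)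
  show ?thesis
  proof (intro equalityI subsetI)
    fix B assume "B \<in> (\<lambda>A. \<sigma> ` A) ` {A\<in>[S]\<^bsup>m\<^esup>. R A}"
    then obtain A where A: "B = \<sigma> ` A" "A \<subseteq> S" "finite A" "card A = m" "R A" by (auto simp: nsets_def)
    have "B \<subseteq> S" using A im by blast
    then show "B \<in> {A\<in>[S]\<^bsup>m\<^esup>. R' A}" using A ci R[OF A(2)] by (auto simp: nsets_def)
  next
    fix B assume "B \<in> {A\<in>[S]\<^bsup>m\<^esup>. R' A}"
    then have B: "B \<subseteq> S" "finite B" "card B = m" "R' B" by (auto simp: nsets_def)
    define A where "A = inv \<sigma> ` B"
    have BA: "B = \<sigma> ` A" unfolding A_def using p by (simp add: image_image permutes_inverses)
    have AS: "A \<subseteq> S" unfolding A_def using B(1) permutes_image[OF permutes_inv[OF p]] by blast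
    have "finite A" using B(2) by (simp add: A_def)
    moreover have "card A = m" using B(3) BA ci by simp
    moreover have "R A" using B(4) R[OF AS] BA by simp
    ultimately show "B \<in> (\<lambda>A. \<sigma> ` A) ` {A\<in>[S]\<^bsup>m\<^esup>. R A}" using AS BA by (auto simp: nsets_def)
  qed
qed

text \<open>The extremal pairs on an arbitrary ground set and without labels, so that permutations
  are needed only once, at the end.\<close>

definition two_star_pair :: "nat set \<Rightarrow> nat \<Rightarrow> nat \<Rightarrow> nat set set \<Rightarrow> nat set set \<Rightarrow> bool" where
  "two_star_pair S k l \<A> \<B> \<longleftrightarrow> (\<exists>x y. x \<in> S \<and> y \<in> S \<and> x \<noteq> y \<and>
     \<A> = {A\<in>[S]\<^bsup>k\<^esup>. x \<in> A \<or> y \<in> A} \<and> \<B> = {B\<in>[S]\<^bsup>l\<^esup>. x \<in> B \<and> y \<in> B})"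

definition near_star_pair :: "nat set \<Rightarrow> nat \<Rightarrow> nat \<Rightarrow> nat set set \<Rightarrow> nat set set \<Rightarrow> bool" where
  "near_star_pair S k l \<A> \<B> \<longleftrightarrow> (\<exists>i A\<^sub>0. i \<in> S \<and> A\<^sub>0 \<subseteq> S - {i} \<and> card A\<^sub>0 = k \<and>
     \<A> = {A\<in>[S]\<^bsup>k\<^esup>. i \<in> A} \<union> {A\<^sub>0} \<and> \<B> = {B\<in>[S]\<^bsup>l\<^esup>. i \<in> B \<and> A\<^sub>0 \<inter> B \<noteq> {}})"

lemma subset_avoiding:
  assumes S: "finite S" "card S = n" and A: "A \<subseteq> S" "card A = k" and Z: "Z \<subseteq> S" "Z \<inter> A = {}" "card Z \<le> l"
    and kl: "k + l \<le> n"
  obtains B where "B \<in> [S]\<^bsup>l\<^esup>" "Z \<subseteq> B" "A \<inter> B = {}"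
proof -
  have "l \<le> n - k" using kl by simp
  have "card (S - A) = n - k" using S A by (simp add: card_Diff_subset finite_subset)
  moreover have "Z \<subseteq> S - A" using Z by auto
  ultimately obtain B where "Z \<subseteq> B" "B \<subseteq> S - A" "card B = l"
    using exists_subset_between[of Z l "S - A"] S(1) Z(3) \<open>l \<le> n - k\<close> by auto
  then show ?thesis using that[of B] S finite_subset[of B S] by (auto simp: nsets_def)
qed

context sizes
begin

text \<open>The complements of the second family attain the shadow bound at a binomial size, hence
  are all \<open>(n - l)\<close>-subsets of a set \<open>T\<close> with \<open>n - 2\<close>
  elements. The two elements outside \<open>T\<close> are the centres, and the size of the first
  family leaves it no choice.\<close>

lemma two_star_equality:
  assumes S: "finite S" "card S = n" and A: "\<A> \<subseteq> [S]\<^bsup>k\<^esup>" and B: "\<B> \<subseteq> [S]\<^bsup>l\<^esup>" and ci: "cross_intersecting \<A> \<B>"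
    and b: "card \<B> = Q - V" and a: "card \<A> = P + U"
  shows "two_star_pair S k l \<A> \<B>"
proof -
  have ic: "cross_intersecting \<B> \<A>" using ci by (auto simp: cross_intersecting_def)
  note lc = card_level_cross[OF S(1) B A ic]
  have a': "real (card \<A>) = real (n choose k) - real ((n - 2) choose k)" using a binomial_facts by linarith
  then have an: "card \<A> = (n choose k) - ((n - 2) choose k)" by linarith
  have "real (card (level ((-) S ` \<B>) k)) + real (card \<A>) \<le> real (n choose k)"
    using lc(3) unfolding S(2) of_nat_add[symmetric] of_nat_le_iff .
  then have "real (card (level ((-) S ` \<B>) k)) \<le> real ((n - 2) choose k)" using a' by linarith
  then have lev: "card (level ((-) S ` \<B>) k) \<le> (n - 2) choose k" by simp
  have "real (card \<B>) = real ((n - 2) choose (n - l))" using b binomial_facts by simp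
  then have cF: "card ((-) S ` \<B>) = (n - 2) choose (n - l)" using lc(2) by simp
  have Fn: "(-) S ` \<B> \<subseteq> [S]\<^bsup>(n - l)\<^esup>" using lc(1) S by simp
  have arith: "n - l \<le> n - 2" "1 \<le> k" "k < n - l" using k2 kl nkl by linarith+
  obtain T where T: "T \<subseteq> S" "card T = n - 2" "(-) S ` \<B> = [T]\<^bsup>(n - l)\<^esup>"
    using clique_of_small_level[OF S(1) Fn arith cF lev] by blast
  have "card (S - T) = 2"
    using S T nk k2 by (simp add: card_Diff_subset finite_subset)
  then obtain x y where xy: "S - T = {x, y}" "x \<noteq> y" by (auto simp: card_2_iff)
  then have xyS: "x \<in> S" "y \<in> S" "x \<notin> T" "y \<notin> T" by auto
  have BE: "\<B> = {B\<in>[S]\<^bsup>l\<^esup>. x \<in> B \<and> y \<in> B}"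
  proof (intro equalityI subsetI)
    fix X assume X: "X \<in> \<B>"
    then have "S - X \<in> [T]\<^bsup>(n - l)\<^esup>" using T(3) by blast
    then have "S - X \<subseteq> T" by (simp add: nsets_def)
    then show "X \<in> {B\<in>[S]\<^bsup>l\<^esup>. x \<in> B \<and> y \<in> B}" using X B xyS by auto
  next
    fix X assume X: "X \<in> {B\<in>[S]\<^bsup>l\<^esup>. x \<in> B \<and> y \<in> B}"
    then have XS: "X \<subseteq> S" "card X = l" "finite X" by (auto simp: nsets_def)
    have "S - X \<subseteq> T" using X xy by auto
    moreover have "card (S - X) = n - l" using XS S by (simp add: card_Diff_subset)
    ultimately have "S - X \<in> (-) S ` \<B>" using T(3) S by (simp add: nsets_def)
    then obtain Y where Y: "Y \<in> \<B>" "S - X = S - Y" by auto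
    have "Y \<subseteq> S" using Y(1) B by (auto simp: nsets_def)
    then have "X = Y" using Y(2) XS(1) by blast
    then show "X \<in> \<B>" using Y(1) by simp
  qed
  have "\<A> \<subseteq> {A\<in>[S]\<^bsup>k\<^esup>. x \<in> A \<or> y \<in> A}"
  proof
    fix X assume X: "X \<in> \<A>"
    then have XS: "X \<subseteq> S" "card X = k" using A by (auto simp: nsets_def)
    have "x \<in> X \<or> y \<in> X"
    proof (rule ccontr)
      assume n: "\<not> (x \<in> X \<or> y \<in> X)"
      have "{x, y} \<subseteq> S" "{x, y} \<inter> X = {}" "card {x, y} \<le> l" using n xyS xy(2) k2 kl by auto
      then obtain Y where "Y \<in> [S]\<^bsup>l\<^esup>" "{x, y} \<subseteq> Y" "X \<inter> Y = {}"
        using subset_avoiding[OF S XS _ _ _ less_imp_le[OF nkl]] by blast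
      then show False using ci X BE by (auto simp: cross_intersecting_def)
    qed
    then show "X \<in> {A\<in>[S]\<^bsup>k\<^esup>. x \<in> A \<or> y \<in> A}" using X A by auto
  qed
  moreover have "card {A\<in>[S]\<^bsup>k\<^esup>. x \<in> A \<or> y \<in> A} = card \<A>"
    using card_two_cover[OF S(1) xyS(1,2) xy(2), of k] an S by simp
  moreover have "finite {A\<in>[S]\<^bsup>k\<^esup>. x \<in> A \<or> y \<in> A}" using S by (simp add: finite_imp_finite_nsets)
  ultimately have "\<A> = {A\<in>[S]\<^bsup>k\<^esup>. x \<in> A \<or> y \<in> A}" by (metis (lifting) card_subset_eq)
  then show ?thesis unfolding two_star_pair_def using BE xyS xy(2) by blast
qed

lemma star_meeting_bound:
  fixes S :: "nat set"
  assumes S: "finite S" "card S = n" and i: "i \<in> S" and A0: "A\<^sub>0 \<subseteq> S" "card A\<^sub>0 = k" "i \<notin> A\<^sub>0"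
  shows "real (card {B\<in>[S]\<^bsup>l\<^esup>. i \<in> B \<and> A\<^sub>0 \<inter> B \<noteq> {}}) = Q - w"
proof -
  have "card {B\<in>[S]\<^bsup>l\<^esup>. i \<in> B \<and> A\<^sub>0 \<inter> B \<noteq> {}} = ((n - 1) choose (l - 1)) - ((n - 1 - k) choose (l - 1))"
    using card_star_meeting[OF S i A0(3,1,2)] k2 kl by simp
  moreover have "(n - 1 - k) choose (l - 1) \<le> (n - 1) choose (l - 1)" by (intro binomial_right_mono) simp
  moreover have "n - 1 - k = n - k - 1" by simp
  ultimately show ?thesis by (simp add: Q_def w_def of_nat_diff)
qed

lemma star_B_bound:
  assumes S: "finite S" "card S = n" and A: "\<A> \<subseteq> [S]\<^bsup>k\<^esup>" and B: "\<B> \<subseteq> [S]\<^bsup>l\<^esup>" and ci: "cross_intersecting \<A> \<B>"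
    and i: "\<forall>B\<in>\<B>. i \<in> B" "i \<in> S" and A0: "A\<^sub>0 \<in> \<A>" "i \<notin> A\<^sub>0"
  shows "card \<B> \<le> Q - w" "card \<B> = Q - w \<Longrightarrow> \<B> = {B\<in>[S]\<^bsup>l\<^esup>. i \<in> B \<and> A\<^sub>0 \<inter> B \<noteq> {}}"
proof -
  have AS: "A\<^sub>0 \<subseteq> S" "card A\<^sub>0 = k" using A0 A by (auto simp: nsets_def)
  note c = star_meeting_bound[OF S i(2) AS A0(2)]
  have sub: "\<B> \<subseteq> {B\<in>[S]\<^bsup>l\<^esup>. i \<in> B \<and> A\<^sub>0 \<inter> B \<noteq> {}}"
    using B i A0 ci by (auto simp: cross_intersecting_def)
  have fin: "finite {B\<in>[S]\<^bsup>l\<^esup>. i \<in> B \<and> A\<^sub>0 \<inter> B \<noteq> {}}" using S by (simp add: finite_imp_finite_nsets)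
  show "card \<B> \<le> Q - w" unfolding c[symmetric] using card_mono[OF fin sub] by simp
  show "\<B> = {B\<in>[S]\<^bsup>l\<^esup>. i \<in> B \<and> A\<^sub>0 \<inter> B \<noteq> {}}" if "card \<B> = Q - w"
    using card_subset_eq[OF fin sub] that unfolding c[symmetric] by simp
qed

text \<open>Equality makes the second family consist of all \<open>l\<close>-sets through
  \<open>i\<close> that meet \<open>A\<^sub>0\<close>. A further member of the first family avoiding
  \<open>i\<close> would miss some \<open>x\<close> in \<open>A\<^sub>0\<close>, and a set
  containing \<open>i\<close> and \<open>x\<close> can be chosen disjoint from it.\<close>

lemma near_star_equality:
  assumes S: "finite S" "card S = n" and A: "\<A> \<subseteq> [S]\<^bsup>k\<^esup>" and B: "\<B> \<subseteq> [S]\<^bsup>l\<^esup>" and ci: "cross_intersecting \<A> \<B>"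
    and a: "card \<A> = P + 1" and b: "card \<B> = Q - w"
    and i: "\<forall>B\<in>\<B>. i \<in> B" "i \<in> S" and A0: "A\<^sub>0 \<in> \<A>" "i \<notin> A\<^sub>0"
  shows "near_star_pair S k l \<A> \<B>"
proof -
  note BE = star_B_bound(2)[OF S A B ci i A0 b]
  have AS: "A\<^sub>0 \<subseteq> S" "card A\<^sub>0 = k" "finite A\<^sub>0" using A0 A by (auto simp: nsets_def)
  have fin: "finite {A\<in>[S]\<^bsup>k\<^esup>. i \<in> A}" using S by (simp add: finite_imp_finite_nsets)
  have sub: "\<A> \<subseteq> {A\<in>[S]\<^bsup>k\<^esup>. i \<in> A} \<union> {A\<^sub>0}"
  proof
    fix X assume X: "X \<in> \<A>"
    then have XS: "X \<subseteq> S" "card X = k" "finite X" using A by (auto simp: nsets_def)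
    have "i \<in> X \<or> X = A\<^sub>0"
    proof (rule ccontr)
      assume n: "\<not> (i \<in> X \<or> X = A\<^sub>0)"
      have "\<not> A\<^sub>0 \<subseteq> X" using card_subset_eq[OF XS(3), of A\<^sub>0] XS AS n by auto
      then obtain x where x: "x \<in> A\<^sub>0" "x \<notin> X" by blast
      have "{i, x} \<subseteq> S" "{i, x} \<inter> X = {}" using i x AS n by auto
      moreover have "card {i, x} \<le> l" using k2 kl card_insert_le_m1[of 2 "{x}" i] by (simp add: card_insert_if)
      ultimately obtain Y where "Y \<in> [S]\<^bsup>l\<^esup>" "{i, x} \<subseteq> Y" "X \<inter> Y = {}"
        using subset_avoiding[OF S XS(1,2) _ _ _ less_imp_le[OF nkl]] by blast
      then show False using ci X BE x by (auto simp: cross_intersecting_def)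
    qed
    then show "X \<in> {A\<in>[S]\<^bsup>k\<^esup>. i \<in> A} \<union> {A\<^sub>0}" using X A by auto
  qed
  have "card ({A\<in>[S]\<^bsup>k\<^esup>. i \<in> A} \<union> {A\<^sub>0}) = ((n - 1) choose (k - 1)) + 1"
    using card_star[OF S(1) i(2), of k] A0(2) fin k2 S by simp
  moreover have "real (card \<A>) = real (((n - 1) choose (k - 1)) + 1)" using a by (simp add: P_def)
  then have "card \<A> = ((n - 1) choose (k - 1)) + 1" by (simp only: of_nat_eq_iff)
  ultimately have "\<A> = {A\<in>[S]\<^bsup>k\<^esup>. i \<in> A} \<union> {A\<^sub>0}"
    using card_subset_eq[OF _ sub] fin by simp
  then show ?thesis unfolding near_star_pair_def using BE AS i A0 by blast
qed

text \<open>Here the sizes are \<open>P - U + z\<close> and \<open>Q + y\<close>. Multiplying the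
  linear bound by \<open>Q + y\<close> yields \<open>V * hm\<close> minus two terms that
  \<open>PV_less_UQ\<close> makes nonnegative, the one with the factor \<open>y\<close> even
  positive.\<close>

lemma excess_over_Q:
  assumes s: "V * z + U * y \<le> U * V - U * w + V" and y: "1 \<le> y" and kl': "k < l"
  shows "(P - U + z) * (Q + y) < hm"
proof -
  have "V * (P - U + z) \<le> V * P - U * w + V - U * y" using s by (simp add: algebra_simps)
  then have "V * (P - U + z) * (Q + y) \<le> (V * P - U * w + V - U * y) * (Q + y)"
    using pos y by (intro mult_right_mono) auto
  also have "\<dots> = V * hm - w * (U * Q - P * V - V) - y * (U * Q - P * V - V + U * w + U * y)"
    by (simp add: algebra_simps)
  also have "\<dots> < V * hm"
  proof -
    have c: "0 \<le> U * Q - P * V - V" using PV_less_UQ[OF kl'] by simp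
    have "0 \<le> w * (U * Q - P * V - V)" using c w_ge by simp
    moreover have "0 < U * Q - P * V - V + U * w + U * y" using c w_ge pos y by (simp add: add_nonneg_pos)
    then have "0 < y * (U * Q - P * V - V + U * w + U * y)" using y by simp
    ultimately show ?thesis by linarith
  qed
  finally have "V * ((P - U + z) * (Q + y)) < V * hm" by (simp add: mult.assoc)
  then show ?thesis using pos by simp
qed

text \<open>The hypothesis \<open>case_\<close> leaves out only \<open>k = l\<close> with a second
  family above a full star and a first one not above it; exchanging the families turns that case
  into one covered here.\<close>

theorem product_trichotomy:
  assumes S: "finite S" "card S = n" and A: "\<A> \<subseteq> [S]\<^bsup>k\<^esup>" and B: "\<B> \<subseteq> [S]\<^bsup>l\<^esup>" and ci: "cross_intersecting \<A> \<B>"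
    and nontriv: "\<Inter> (\<A> \<union> \<B>) = {}" and case_: "k < l \<or> card \<B> \<le> Q \<or> P < card \<A>"
  shows "card \<A> * card \<B> < max hm star \<or> (card \<A> * card \<B> = star \<and> two_star_pair S k l \<A> \<B>) \<or>
    (card \<A> * card \<B> = hm \<and> near_star_pair S k l \<A> \<B>)"
proof -
  define a b where "a = real (card \<A>)" and "b = real (card \<B>)"
  have ab: "real (card \<A> * card \<B>) = a * b" by (simp add: a_def b_def)
  have PQn: "P = real ((n - 1) choose (k - 1))" "Q = real ((n - 1) choose (l - 1))" "Q - V = real ((n - 2) choose (l - 2))"
    "P - U = real ((n - 2) choose (k - 2))" using P_split Q_split by (auto simp: P_def Q_def)
  have wQ: "(n - k - 1) choose (l - 1) \<le> (n - 1) choose (l - 1)" by (intro binomial_right_mono) simp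
  have hm_pos: "0 < hm" using pos by simp
  have one: "\<exists>i. (\<forall>A\<in>\<A>. i \<in> A) \<or> (\<forall>B\<in>\<B>. i \<in> B)" if h: "a \<le> P + 1" "b \<le> Q" "hm \<le> a * b"
  proof (rule one_family_is_star[OF S _ kl nl nk A B ci])
    show "1 \<le> k" using k2 by simp
    show "card \<A> \<le> ((n - 1) choose (k - 1)) + 1" using h(1) unfolding a_def PQn by linarith
    show "card \<B> \<le> (n - 1) choose (l - 1)" using h(2) unfolding b_def PQn by simp
    have "real ((((n - 1) choose (k - 1)) + 1) * (((n - 1) choose (l - 1)) - ((n - k - 1) choose (l - 1)))) \<le> real (card \<A> * card \<B>)"
      using h(3) unfolding of_nat_mult of_nat_diff[OF wQ] of_nat_add of_nat_1 P_def Q_def w_def a_def b_def .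
    then show "(((n - 1) choose (k - 1)) + 1) * (((n - 1) choose (l - 1)) - ((n - k - 1) choose (l - 1))) \<le> card \<A> * card \<B>"
      by (simp only: of_nat_le_iff)
  qed
  have starA: "a \<le> P - w'" if i: "\<forall>A\<in>\<A>. i \<in> A" and pr: "hm \<le> a * b" for i
  proof -
    have "\<A> \<noteq> {}" using pr hm_pos by (auto simp: a_def)
    then have iS: "i \<in> S" using i A by (auto simp: nsets_def)
    obtain B\<^sub>0 where B0: "B\<^sub>0 \<in> \<B>" "i \<notin> B\<^sub>0" using nontriv i by blast
    have BS: "B\<^sub>0 \<subseteq> S" "card B\<^sub>0 = l" using B0 B by (auto simp: nsets_def)
    have "card \<A> \<le> ((n - 1) choose (k - 1)) - ((n - 1 - l) choose (k - 1))"
      by (rule card_star_meeting_le[OF S iS B0(2) BS _ A])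
        (use k2 i ci B0(1) in \<open>auto simp: cross_intersecting_def\<close>)
    moreover have "(n - 1 - l) choose (k - 1) \<le> (n - 1) choose (k - 1)" by (intro binomial_right_mono) simp
    moreover have "n - 1 - l = n - l - 1" by simp
    ultimately show ?thesis unfolding a_def P_def w'_def by (metis of_nat_diff of_nat_mono)
  qed
  have starB: "b \<le> Q - w \<and> (a = P + 1 \<longrightarrow> b = Q - w \<longrightarrow> near_star_pair S k l \<A> \<B>)"
    if i: "\<forall>B\<in>\<B>. i \<in> B" and pr: "hm \<le> a * b" for i
  proof -
    have "\<B> \<noteq> {}" using pr hm_pos by (auto simp: b_def)
    then have iS: "i \<in> S" using i B by (auto simp: nsets_def)
    obtain A\<^sub>0 where A0: "A\<^sub>0 \<in> \<A>" "i \<notin> A\<^sub>0" using nontriv i by blast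
    show ?thesis using star_B_bound(1)[OF S A B ci i iS A0] near_star_equality[OF S A B ci _ _ i iS A0]
      unfolding a_def b_def by blast
  qed
  \<comment> \<open>If the first family is a star, some member of the second avoids the centre, and
    \<open>P - w'\<close> sets remain at most. This is too few even against a full star.\<close>
  have w'_strict: "(P - w') * Q < hm"
  proof -
    have "V * (w * P) \<le> V * (w' * Q)"
    proof -
      have "w * (P * V) \<le> w * (U * Q)" using PV_le_UQ w_ge by (intro mult_left_mono) auto
      also have "\<dots> = (w * U) * Q" by simp
      also have "\<dots> = V * (w' * Q)" unfolding wU by simp
      finally show ?thesis by (simp add: mult_ac)
    qed
    then have "w * P \<le> w' * Q" using pos by simp
    then show ?thesis using pos by (simp add: algebra_simps)
  qed
  consider (bigA) "P < a" | (small) "a \<le> P" "b \<le> Q" | (bigB) "a \<le> P" "Q < b" by linarith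
  then have "a * b < max hm star \<or> (a * b = star \<and> two_star_pair S k l \<A> \<B>) \<or> (a * b = hm \<and> near_star_pair S k l \<A> \<B>)"
  proof cases
    case bigA
    then have z: "1 \<le> a - P" using nat_gap[of "card \<A>" "(n - 1) choose (k - 1)"] unfolding a_def P_def by auto
    have f: "feasible (a - P) (b - (Q - V))" using feasible_above_P[OF S A B ci] by (simp add: a_def b_def)
    have prod: "(P + (a - P)) * (Q - V + (b - (Q - V))) = a * b" by simp
    show ?thesis
    proof (cases "b \<le> Q - V")
      case True
      then have le: "a * b \<le> star" "b < Q - V \<Longrightarrow> a * b < star"
        using small_B[OF S A B ci] by (auto simp: a_def b_def)
      show ?thesis
      proof (cases "a * b = star")
        case eq: True
        then have bQ: "b = Q - V" using le(2) True by (cases "b < Q - V") auto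
        then have "a = P + U" using eq pos by simp
        then have "two_star_pair S k l \<A> \<B>" using two_star_equality[OF S A B ci] bQ by (simp add: a_def b_def)
        then show ?thesis using eq by simp
      next
        case False
        then show ?thesis using le(1) by (auto simp: less_max_iff_disj)
      qed
    next
      case False
      then have y: "1 \<le> b - (Q - V)" using nat_gap[of "card \<B>" "(n - 2) choose (l - 2)"] unfolding b_def PQn(3)[symmetric] by auto
      show ?thesis
      proof (cases "a - P \<le> U2")
        case True
        note se = small_excess[OF f z True, unfolded prod]
        show ?thesis
        proof (cases "a * b = hm")
          case eq: True
          then have a1: "a = P + 1" using se(2) z by (cases "1 < a - P") auto
          then have b1: "b = Q - w" using eq pos by simp
          then have bQ: "b \<le> Q" using w_ge by simp
          have "a \<le> P + 1" "hm \<le> a * b" using a1 eq by auto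
          \<comment> \<open>The sizes \<open>(P + 1, Q - w)\<close> do not by themselves reveal the
            structure. The star theorem does, and the centre cannot belong to the first family, as
            that would leave it at most \<open>P - w'\<close> members.\<close>
          then obtain i where "(\<forall>A\<in>\<A>. i \<in> A) \<or> (\<forall>B\<in>\<B>. i \<in> B)" using one bQ by blast
          then have "\<forall>B\<in>\<B>. i \<in> B" using starA[of i] eq a1 w'_ge by auto
          then have "near_star_pair S k l \<A> \<B>" using starB[of i] a1 b1 eq by simp
          then show ?thesis using eq by simp
        next
          case False
          then show ?thesis using se(1) by (auto simp: less_max_iff_disj)
        qed
      next
        case False
        then show ?thesis using large_excess[OF f _ y, unfolded prod] by (simp add: less_max_iff_disj)
      qed
    qed
  next
    case small
    have "a * b < hm"
    proof (rule ccontr)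
      assume "\<not> a * b < hm"
      then have pr: "hm \<le> a * b" by simp
      obtain i where "(\<forall>A\<in>\<A>. i \<in> A) \<or> (\<forall>B\<in>\<B>. i \<in> B)" using one[OF _ small(2) pr] small by auto
      then show False
      proof
        assume "\<forall>A\<in>\<A>. i \<in> A"
        then have "a \<le> P - w'" using starA pr by blast
        then have "a * b \<le> (P - w') * Q" using small(2) pos by (intro mult_mono) (auto simp: a_def b_def)
        then show False using w'_strict pr by simp
      next
        assume "\<forall>B\<in>\<B>. i \<in> B"
        then have "b \<le> Q - w" using starB pr by blast
        then have "a * b \<le> P * (Q - w)" using small(1) pos by (intro mult_mono) (auto simp: a_def b_def)
        then show False using pr pos by (simp add: algebra_simps)
      qed
    qed
    then show ?thesis by (simp add: less_max_iff_disj)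
  next
    case bigB
    then have kl': "k < l" using case_ by (auto simp: a_def b_def)
    show ?thesis
    proof (cases "a \<le> P - U")
      case True
      then show ?thesis using small_A[OF S A B ci _ kl'] by (simp add: a_def b_def less_max_iff_disj)
    next
      case False
      then have z: "1 \<le> a - (P - U)" using nat_gap[of "card \<A>" "(n - 2) choose (k - 2)"] unfolding a_def PQn(4)[symmetric] by auto
      have y: "1 \<le> b - Q" using bigB nat_gap[of "card \<B>" "(n - 1) choose (l - 1)"] unfolding b_def PQn(2)[symmetric] by auto
      have f: "feasible (a - (P - U)) (b - Q)" using feasible_above_Q[OF S A B ci] by (simp add: a_def b_def)
      have "(P - U + (a - (P - U))) * (Q + (b - Q)) < hm"
        using excess_over_Q[OF sum_bound[OF f z y] y kl'] .
      then show ?thesis by (simp add: less_max_iff_disj)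
    qed
  qed
  then show ?thesis unfolding ab .
qed

lemma bounds_real: "hm = real (hm_bound n k l)" "star = real (star_bound n k l)"
proof -
  have wQ: "(n - k - 1) choose (l - 1) \<le> (n - 1) choose (l - 1)" by (intro binomial_right_mono) simp
  show "hm = real (hm_bound n k l)"
    unfolding hm_bound_def of_nat_mult of_nat_diff[OF wQ] of_nat_add of_nat_1 P_def Q_def w_def ..
  show "star = real (star_bound n k l)"
    unfolding star_bound_def using k2 kl Q_split by (simp add: P_def U_def)
qed

end

text \<open>For \<open>k = 1\<close> both bounds have the same value and both extremal pairs
  coincide, so a single alternative is enough. The empty intersection supplies two distinct
  singletons, whose elements then lie in every member of the second family.\<close>

lemma singleton_case:
  assumes S: "finite S" "card S = n" and A: "\<A> \<subseteq> [S]\<^bsup>1\<^esup>" and B: "\<B> \<subseteq> [S]\<^bsup>l\<^esup>" and ci: "cross_intersecting \<A> \<B>"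
    and nontriv: "\<Inter> (\<A> \<union> \<B>) = {}" and l: "2 \<le> l" "2 * l \<le> n"
  shows "card \<A> * card \<B> < star_bound n 1 l \<or> (card \<A> * card \<B> = star_bound n 1 l \<and> two_star_pair S 1 l \<A> \<B>)"
proof -
  have AD: "\<exists>x. A = {x} \<and> x \<in> S" if "A \<in> \<A>" for A
    using that A by (auto simp: nsets_def card_1_singleton_iff)
  have sb: "star_bound n 1 l = 2 * ((n - 2) choose (l - 2))" using l by (simp add: star_bound_def)
  have sbpos: "0 < star_bound n 1 l" unfolding sb using l by simp
  show ?thesis
  proof (cases "card \<A> * card \<B> = 0")
    case True
    then show ?thesis unfolding True using sbpos by blast
  next
    case False
    then have ne: "\<A> \<noteq> {}" by auto
    then obtain A1 where A1: "A1 \<in> \<A>" by blast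
    then obtain x where x: "A1 = {x}" "x \<in> S" using AD by blast
    have xB: "x \<in> B" if "B \<in> \<B>" for B using ci A1 x that by (auto simp: cross_intersecting_def)
    obtain A2 where A2: "A2 \<in> \<A>" "x \<notin> A2" using nontriv xB by blast
    then obtain y where y: "A2 = {y}" "y \<in> S" using AD by blast
    have xy: "x \<noteq> y" using A2 y by auto
    have yB: "y \<in> B" if "B \<in> \<B>" for B using ci A2 y that by (auto simp: cross_intersecting_def)
    have sub: "\<B> \<subseteq> {B\<in>[S]\<^bsup>l\<^esup>. x \<in> B \<and> y \<in> B}" using B xB yB by auto
    have cd: "card {B\<in>[S]\<^bsup>l\<^esup>. x \<in> B \<and> y \<in> B} = (n - 2) choose (l - 2)"
      using card_double_star[OF S(1) x(2) y(2) xy l(1)] S by simp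
    have fin: "finite {B\<in>[S]\<^bsup>l\<^esup>. x \<in> B \<and> y \<in> B}" using S by (simp add: finite_imp_finite_nsets)
    have "n - 2 - (l - 2) = n - l" using l by simp
    then have sym: "(n - 2) choose (n - l) = (n - 2) choose (l - 2)"
      using binomial_symmetric[of "l - 2" "n - 2"] l by simp
    have cB: "card \<B> \<le> (n - 2) choose (n - l)" using card_mono[OF fin sub] cd sym by simp
    have ic: "cross_intersecting \<B> \<A>" using ci by (auto simp: cross_intersecting_def)
    have slope: "real (n - l + 1) * real ((n - 2) choose 1) \<le> real (n - l) * real (n choose 1)"
    proof -
      have "(n - l + 1) * (n - 2) \<le> (n - l) * n"
      proof -
        obtain d where "n = 2 * l + d" using l le_Suc_ex by blast
        then show ?thesis using l by (simp add: algebra_simps)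
      qed
      then have "real ((n - l + 1) * (n - 2)) \<le> real ((n - l) * n)" by (rule of_nat_mono)
      then show ?thesis by (simp add: distrib_right)
    qed
    have "card \<B> * card \<A> \<le> real ((n - 2) choose (n - l)) * (real (n choose 1) - real ((n - 2) choose 1)) \<and>
      (card \<B> < (n - 2) choose (n - l) \<longrightarrow> card \<B> * card \<A> < real ((n - 2) choose (n - l)) * (real (n choose 1) - real ((n - 2) choose 1)))"
      by (rule product_chain[OF S B A ic _ _ _ refl slope _ _ cB]) (use l in auto)
    moreover have "real ((n - 2) choose (n - l)) * (real (n choose 1) - real ((n - 2) choose 1)) = real (star_bound n 1 l)"
      unfolding sb sym using l by (simp add: of_nat_diff)
    ultimately have le: "card \<A> * card \<B> \<le> star_bound n 1 l"
      "card \<B> < (n - 2) choose (n - l) \<Longrightarrow> card \<A> * card \<B> < star_bound n 1 l"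
      by (simp_all add: mult.commute flip: of_nat_mult)
    show ?thesis
    proof (cases "card \<A> * card \<B> = star_bound n 1 l")
      case eq: True
      then have bq: "card \<B> = (n - 2) choose (l - 2)" using le(2) cB sym by (cases "card \<B> < (n - 2) choose (n - l)") auto
      moreover have "0 < (n - 2) choose (l - 2)" using l by simp
      ultimately have a2: "card \<A> = 2" using eq unfolding sb by simp
      have BE: "\<B> = {B\<in>[S]\<^bsup>l\<^esup>. x \<in> B \<and> y \<in> B}" using card_subset_eq[OF fin sub] bq cd by simp
      have finA: "finite \<A>" using a2 card.infinite by fastforce
      have "{{x}, {y}} \<subseteq> \<A>" "card {{x}, {y}} = 2" using A1 A2 x y xy by auto
      then have "\<A> = {{x}, {y}}" using card_subset_eq[OF finA, of "{{x}, {y}}"] a2 by simp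
      also have "\<dots> = {A\<in>[S]\<^bsup>1\<^esup>. x \<in> A \<or> y \<in> A}"
        using x y by (auto simp: nsets_def card_1_singleton_iff)
      finally have "two_star_pair S 1 l \<A> \<B>" unfolding two_star_pair_def using BE x y xy by blast
      then show ?thesis using eq by simp
    next
      case False
      then show ?thesis using le(1) by simp
    qed
  qed
qed

section \<open>Standard labelling and admissibility of the extremal pairs\<close>

lemma two_star_pair_perm:
  assumes "two_star_pair {1..n} k l \<A> \<B>" "2 \<le> n"
  shows "equal_up_to_perm n (\<A>, \<B>) (star_A n k, star_B n l)"
proof -
  obtain x y where xy: "x \<in> {1..n}" "y \<in> {1..n}" "x \<noteq> y"
    and A: "\<A> = {A\<in>[{1..n}]\<^bsup>k\<^esup>. x \<in> A \<or> y \<in> A}" and B: "\<B> = {B\<in>[{1..n}]\<^bsup>l\<^esup>. x \<in> B \<and> y \<in> B}"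
    using assms unfolding two_star_pair_def by blast
  obtain \<sigma> where s: "\<sigma> permutes {1..n}" "\<sigma> ` {1} = {x}" "\<sigma> ` {2} = {y}"
    using exists_permutes[of "{1..n}" "{1}" "{2}" "{x}" "{y}"] xy assms(2) by auto
  have e: "\<sigma> 1 = x" "\<sigma> 2 = y" using s by auto
  have inj: "\<sigma> u \<in> \<sigma> ` X \<longleftrightarrow> u \<in> X" for u X using permutes_inj[OF s(1)] by (simp add: inj_image_mem_iff)
  have "(\<lambda>S. \<sigma> ` S) ` star_A n k = \<A>" unfolding star_A_def A
    by (rule permutes_image_nsets[OF s(1)]) (simp add: e[symmetric] inj)
  moreover have "(\<lambda>S. \<sigma> ` S) ` star_B n l = \<B>" unfolding star_B_def B
    by (rule permutes_image_nsets[OF s(1)]) (simp add: e[symmetric] inj)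
  ultimately show ?thesis unfolding equal_up_to_perm_def using s(1) by (metis fst_conv snd_conv)
qed

lemma near_star_pair_perm:
  assumes "near_star_pair {1..n} k l \<A> \<B>" "k + 1 \<le> n"
  shows "equal_up_to_perm n (\<A>, \<B>) (hm_A n k, hm_B n k l)"
proof -
  obtain i A\<^sub>0 where i: "i \<in> {1..n}" "A\<^sub>0 \<subseteq> {1..n} - {i}" "card A\<^sub>0 = k"
    and A: "\<A> = {A\<in>[{1..n}]\<^bsup>k\<^esup>. i \<in> A} \<union> {A\<^sub>0}" and B: "\<B> = {B\<in>[{1..n}]\<^bsup>l\<^esup>. i \<in> B \<and> A\<^sub>0 \<inter> B \<noteq> {}}"
    using assms unfolding near_star_pair_def by blast
  have h: "{1} \<subseteq> {1..n}" "{2..k+1} \<subseteq> {1..n}" "{1} \<inter> {2..k+1} = {}" "{i} \<subseteq> {1..n}" "A\<^sub>0 \<subseteq> {1..n}" "{i} \<inter> A\<^sub>0 = {}"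
    "card {1::nat} = card {i}" "card {2..k+1} = card A\<^sub>0" using i assms(2) by auto
  obtain \<sigma> where s: "\<sigma> permutes {1..n}" "\<sigma> ` {1} = {i}" "\<sigma> ` {2..k+1} = A\<^sub>0"
    by (rule exists_permutes[OF _ h]) auto
  have e: "\<sigma> 1 = i" using s by auto
  have injs: "inj \<sigma>" using permutes_inj[OF s(1)] .
  have inj: "\<sigma> u \<in> \<sigma> ` X \<longleftrightarrow> u \<in> X" for u X using injs by (simp add: inj_image_mem_iff)
  have int: "A\<^sub>0 \<inter> \<sigma> ` X \<noteq> {} \<longleftrightarrow> X \<inter> {2..k+1} \<noteq> {}" for X
    unfolding s(3)[symmetric] image_Int[OF injs, symmetric] by auto
  have "(\<lambda>S. \<sigma> ` S) ` {A\<in>[{1..n}]\<^bsup>k\<^esup>. 1 \<in> A} = {A\<in>[{1..n}]\<^bsup>k\<^esup>. i \<in> A}"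
    by (rule permutes_image_nsets[OF s(1)]) (simp add: e[symmetric] inj)
  then have "(\<lambda>S. \<sigma> ` S) ` hm_A n k = \<A>" unfolding hm_A_def A image_Un using s(3) by simp
  moreover have "(\<lambda>S. \<sigma> ` S) ` hm_B n k l = \<B>" unfolding hm_B_def B
    by (rule permutes_image_nsets[OF s(1)]) (simp add: e[symmetric] inj int)
  ultimately show ?thesis unfolding equal_up_to_perm_def using s(1) by (metis fst_conv snd_conv)
qed

lemma sets_through_1:
  assumes "1 \<le> k" "k + 1 \<le> n" "x \<noteq> 1"
  obtains A where "A \<in> [{1..n}]\<^bsup>k\<^esup>" "1 \<in> A" "x \<notin> A"
proof -
  have "card ({1..n} - {1}) = n - 1" using assms by (simp add: card_Diff_subset)
  then have "n - 1 - 1 \<le> card ({1..n} - {1} - {x})"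
    using diff_card_le_card_Diff[of "{x}" "{1..n} - {1}"] by simp
  then have "k - 1 \<le> card ({1..n} - {1} - {x})" using assms by simp
  then obtain T where T: "T \<subseteq> {1..n} - {1} - {x}" "card T = k - 1" "finite T"
    by (meson obtain_subset_with_card_n)
  then have "1 \<notin> T" by auto
  then have "card (insert 1 T) = k" using T assms by simp
  then show ?thesis using that[of "insert 1 T"] T assms by (auto simp: nsets_def)
qed

lemma star_pair_admissible:
  assumes "1 \<le> k" "1 \<le> l" "k + l < n"
  shows "nontrivial_cross_pair n k l (star_A n k) (star_B n l)" "card (star_A n k) * card (star_B n l) = star_bound n k l"
proof -
  have "\<exists>A\<in>star_A n k. x \<notin> A" for x
  proof (cases "x = 1")
    case True
    have "{2..k+1} \<in> star_A n k" using assms by (auto simp: star_A_def nsets_def)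
    then show ?thesis using True by (intro bexI[of _ "{2..k+1}"]) auto
  next
    case False
    then obtain A where "A \<in> [{1..n}]\<^bsup>k\<^esup>" "1 \<in> A" "x \<notin> A" using sets_through_1[of k n x] assms by auto
    then show ?thesis by (auto simp: star_A_def)
  qed
  then have "\<Inter> (star_A n k \<union> star_B n l) = {}" by auto
  moreover have "cross_intersecting (star_A n k) (star_B n l)"
    by (auto simp: cross_intersecting_def star_A_def star_B_def)
  ultimately show "nontrivial_cross_pair n k l (star_A n k) (star_B n l)"
    by (auto simp: nontrivial_cross_pair_def star_A_def star_B_def)
  have "card (star_A n k) = (n choose k) - ((n - 2) choose k)"
    unfolding star_A_def using card_two_cover[of "{1..n}" 1 2 k] assms by simp
  also have "\<dots> = ((n - 1) choose (k - 1)) + ((n - 2) choose (k - 1))"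
  proof -
    have "n - 1 - 1 = n - 2" by simp
    then show ?thesis using choose_reduce_nat[of n k] choose_reduce_nat[of "n - 1" k] assms by simp
  qed
  finally have a: "card (star_A n k) = ((n - 1) choose (k - 1)) + ((n - 2) choose (k - 1))" .
  have b: "card (star_B n l) = (if l < 2 then 0 else (n - 2) choose (l - 2))"
  proof (cases "l < 2")
    case True
    then have "l = 1" using assms by simp
    then have "star_B n l = {}" by (auto simp: star_B_def nsets_def card_1_singleton_iff)
    then show ?thesis using True by simp
  next
    case False
    have "star_B n l = {B\<in>[{1..n}]\<^bsup>l\<^esup>. 1 \<in> B \<and> 2 \<in> B}" by (auto simp: star_B_def)
    then show ?thesis using card_double_star[of "{1..n}" 1 2 l] False assms by simp
  qed
  show "card (star_A n k) * card (star_B n l) = star_bound n k l" unfolding a b star_bound_def ..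
qed

lemma hm_pair_admissible:
  assumes "1 \<le> k" "1 \<le> l" "k + l < n"
  shows "nontrivial_cross_pair n k l (hm_A n k) (hm_B n k l)" "card (hm_A n k) * card (hm_B n k l) = hm_bound n k l"
proof -
  have D: "{2..k+1} \<in> [{1..n}]\<^bsup>k\<^esup>" using assms by (auto simp: nsets_def)
  have "\<exists>A\<in>hm_A n k. x \<notin> A" for x
  proof (cases "x = 1")
    case True
    then show ?thesis by (intro bexI[of _ "{2..k+1}"]) (auto simp: hm_A_def)
  next
    case False
    then obtain A where "A \<in> [{1..n}]\<^bsup>k\<^esup>" "1 \<in> A" "x \<notin> A" using sets_through_1[of k n x] assms by auto
    then show ?thesis by (auto simp: hm_A_def)
  qed
  then have "\<Inter> (hm_A n k \<union> hm_B n k l) = {}" by auto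
  moreover have "cross_intersecting (hm_A n k) (hm_B n k l)"
    unfolding cross_intersecting_def hm_A_def hm_B_def by auto
  ultimately show "nontrivial_cross_pair n k l (hm_A n k) (hm_B n k l)"
    unfolding nontrivial_cross_pair_def using D by (auto simp: hm_A_def hm_B_def)
  have fin: "finite {A\<in>[{1..n}]\<^bsup>k\<^esup>. 1 \<in> A}" by (simp add: finite_imp_finite_nsets)
  have a: "card (hm_A n k) = ((n - 1) choose (k - 1)) + 1"
    unfolding hm_A_def using card_star[of "{1..n}" 1 k] fin assms by simp
  have "hm_B n k l = {B\<in>[{1..n}]\<^bsup>l\<^esup>. 1 \<in> B \<and> {2..k+1} \<inter> B \<noteq> {}}" by (auto simp: hm_B_def)
  then have "card (hm_B n k l) = ((n - 1) choose (l - 1)) - ((n - 1 - k) choose (l - 1))"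
    using card_star_meeting[of "{1..n}" n 1 "{2..k+1}" k l] assms by simp
  moreover have "n - 1 - k = n - k - 1" by simp
  ultimately show "card (hm_A n k) * card (hm_B n k l) = hm_bound n k l" unfolding a hm_bound_def by simp
qed

theorem theorem1p5:
  fixes n k l :: nat
  assumes "0 < n" and "0 < k" and "0 < l"
    and "(n \<ge> 2 * l \<and> 2 * l > 2 * k) \<or> (n > 2 * l \<and> 2 * l = 2 * k)"
  shows "(\<forall>\<A> \<B>. nontrivial_cross_pair n k l \<A> \<B> \<longrightarrow>
            card \<A> * card \<B> \<le> max (star_bound n k l) (hm_bound n k l) \<and>
            (2 \<le> l \<longrightarrow>
               (card \<A> * card \<B> \<le> star_bound n k l \<and>
                (card \<A> * card \<B> = star_bound n k l \<longrightarrow>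
                   unique_pair_form n k l (\<A>, \<B>) (star_A n k, star_B n l)))
             \<or> (card \<A> * card \<B> \<le> hm_bound n k l \<and>
                (card \<A> * card \<B> = hm_bound n k l \<longrightarrow>
                   unique_pair_form n k l (\<A>, \<B>) (hm_A n k, hm_B n k l)))))
       \<and> (nontrivial_cross_pair n k l (star_A n k) (star_B n l) \<and>
          card (star_A n k) * card (star_B n l) = star_bound n k l)
       \<and> (nontrivial_cross_pair n k l (hm_A n k) (hm_B n k l) \<and>
          card (hm_A n k) * card (hm_B n k l) = hm_bound n k l)"
proof -
  have kl: "k \<le> l" "2 * l \<le> n" "2 * k < n" "k + l < n" "1 \<le> k" "1 \<le> l" using assms by auto
  have "card \<A> * card \<B> \<le> max (star_bound n k l) (hm_bound n k l) \<and>
    (2 \<le> l \<longrightarrow>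
       (card \<A> * card \<B> \<le> star_bound n k l \<and>
        (card \<A> * card \<B> = star_bound n k l \<longrightarrow> unique_pair_form n k l (\<A>, \<B>) (star_A n k, star_B n l)))
     \<or> (card \<A> * card \<B> \<le> hm_bound n k l \<and>
        (card \<A> * card \<B> = hm_bound n k l \<longrightarrow> unique_pair_form n k l (\<A>, \<B>) (hm_A n k, hm_B n k l))))"
    if pair: "nontrivial_cross_pair n k l \<A> \<B>" for \<A> \<B>
  proof -
    have A: "\<A> \<subseteq> [{1..n}]\<^bsup>k\<^esup>" and B: "\<B> \<subseteq> [{1..n}]\<^bsup>l\<^esup>" and ci: "cross_intersecting \<A> \<B>" and nt: "\<Inter> (\<A> \<union> \<B>) = {}"
      using pair by (auto simp: nontrivial_cross_pair_def)
    have S: "finite {1..n}" "card {1..n} = n" by auto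
    have n: "2 \<le> n" "k + 1 \<le> n" using kl by auto
    show ?thesis
    proof (cases "l = 1")
      case True
      then have k1: "k = 1" using kl by simp
      \<comment> \<open>Nonempty cross-intersecting families of singletons would all consist of one
        and the same set, which has a common element; so one family is empty.\<close>
      have "card \<A> * card \<B> = 0"
      proof (rule ccontr)
        assume "card \<A> * card \<B> \<noteq> 0"
        then have "\<A> \<noteq> {}" "\<B> \<noteq> {}" by auto
        then obtain A0 B0 where AB: "A0 \<in> \<A>" "B0 \<in> \<B>" by blast
        have sA: "\<exists>x. X = {x}" if "X \<in> \<A> \<union> \<B>" for X
          using that A B True k1 by (auto simp: nsets_def card_1_singleton_iff)
        have meet: "X \<inter> Y \<noteq> {}" if "X \<in> \<A>" "Y \<in> \<B>" for X Y using ci that by (auto simp: cross_intersecting_def)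
        obtain x where x: "A0 = {x}" using sA AB by blast
        have "x \<in> Y" if "Y \<in> \<B>" for Y using meet[OF AB(1) that] x by auto
        moreover have "x \<in> X" if X: "X \<in> \<A>" for X
        proof -
          have "B0 = {x}" using sA[of B0] AB(2) calculation[OF AB(2)] by auto
          then show ?thesis using meet[OF X AB(2)] by auto
        qed
        ultimately have "x \<in> \<Inter> (\<A> \<union> \<B>)" by blast
        then show False using nt by simp
      qed
      then show ?thesis unfolding \<open>card \<A> * card \<B> = 0\<close> using True by linarith
    next
      case False
      then have l2: "2 \<le> l" using kl by simp
      have main: "card \<A> * card \<B> < max (star_bound n k l) (hm_bound n k l) \<or>
        (card \<A> * card \<B> = star_bound n k l \<and> unique_pair_form n k l (\<A>, \<B>) (star_A n k, star_B n l)) \<or>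
        (card \<A> * card \<B> = hm_bound n k l \<and> unique_pair_form n k l (\<A>, \<B>) (hm_A n k, hm_B n k l))"
      proof (cases "k = 1")
        case True
        then show ?thesis using singleton_case[OF S _ B ci nt l2 kl(2)] A two_star_pair_perm[of n k l \<A> \<B>] kl
          unfolding unique_pair_form_def by fastforce
      next
        case False
        then interpret sizes n k l using kl by unfold_locales auto
        have mx: "max hm star = real (max (star_bound n k l) (hm_bound n k l))"
          unfolding bounds_real by (simp add: max.commute)
        show ?thesis
        proof (cases "k < l \<or> card \<B> \<le> Q \<or> P < card \<A>")
          case True
          have "card \<A> * card \<B> < max (star_bound n k l) (hm_bound n k l) \<or>
            (card \<A> * card \<B> = star_bound n k l \<and> two_star_pair {1..n} k l \<A> \<B>) \<or>
            (card \<A> * card \<B> = hm_bound n k l \<and> near_star_pair {1..n} k l \<A> \<B>)"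
            using product_trichotomy[OF S A B ci nt True] unfolding mx unfolding bounds_real of_nat_less_iff of_nat_eq_iff .
          then show ?thesis using two_star_pair_perm[OF _ n(1)] near_star_pair_perm[OF _ n(2)]
            unfolding unique_pair_form_def by blast
        next
          \<comment> \<open>Now \<open>k = l\<close>, the second family exceeds a full star and the
            first does not. The theorem is applied to the exchanged pair, which
            \<open>unique_pair_form\<close> accepts.\<close>
          case sw: False
          then have eq: "k = l" using kl by simp
          have PQ: "P = Q" unfolding P_def Q_def using eq by simp
          have ic: "cross_intersecting \<B> \<A>" using ci by (auto simp: cross_intersecting_def)
          have A': "\<A> \<subseteq> [{1..n}]\<^bsup>l\<^esup>" and B': "\<B> \<subseteq> [{1..n}]\<^bsup>k\<^esup>" using A B eq by auto
          have nt': "\<Inter> (\<B> \<union> \<A>) = {}" using nt by (simp add: Un_commute)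
          have c: "k < l \<or> card \<A> \<le> Q \<or> P < card \<B>" using sw PQ by simp
          have "card \<B> * card \<A> < max (star_bound n k l) (hm_bound n k l) \<or>
            (card \<B> * card \<A> = star_bound n k l \<and> two_star_pair {1..n} k l \<B> \<A>) \<or>
            (card \<B> * card \<A> = hm_bound n k l \<and> near_star_pair {1..n} k l \<B> \<A>)"
            using product_trichotomy[OF S B' A' ic nt' c] unfolding mx unfolding bounds_real of_nat_less_iff of_nat_eq_iff .
          then show ?thesis using two_star_pair_perm[OF _ n(1)] near_star_pair_perm[OF _ n(2)] eq
            unfolding unique_pair_form_def mult.commute[of "card \<B>"] by simp blast
        qed
      qed
      \<comment> \<open>A product strictly below the maximum satisfies the alternative belonging to
        the larger bound, whose equality clause is then vacuous.\<close>
      then show ?thesis using l2 by (auto simp: max_def split: if_splits)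
    qed
  qed
  then show ?thesis using star_pair_admissible[OF kl(5,6,4)] hm_pair_admissible[OF kl(5,6,4)] by blast
qed

end
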